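(* Let $\mathcal X$ be a complex Banach space, $s<0$, $0<p<\infty$ and $1\le q<\infty$. Then $$H^p(\mathcal X)\cdot F^s_{\infty,q}\subset F^s_{p,q}(\mathcal X),$$ i.e. there is $C$ such that $\|gh\|_{F^s_{p,q}(\mathcal X)}\le C\|g\|_{H^p(\mathcal X)}\|h\|_{F^s_{\infty,q}}$ for all $g\in H^p(\mathcal X)$, $h\in F^s_{\infty,q}$. Moreover, if $\mathcal H$ is an infinite-dimensional separable complex Hilbert space, then there exists $f\in F^s_{1,2}(\mathcal H)$ such that $f\neq gh$ for every $g\in H^1(\mathcal H)$ and every $h\in F^s_{\infty,2}$.
   Context: Notation: $\mathbb D$ unit disc, $\mathbb T$ unit circle, $\zeta_x=e^{2\pi ix}$, $dx$ normalized arc length, $|I|$ normalized length of an arc. $\mathcal A(\mathcal X)$: analytic functions $\mathbb D\to\mathcal X$. $H^p(\mathcal X)$: $f\in\mathcal A(\mathcal X)$ with $\|f\|_{H^p(\mathcal X)}=\sup_{0<r<1}(\int_{\mathbb T}\|f(r\zeta_x)\|_{\mathcal X}^pdx)^{1/p}<\infty$. Dyadic arcs $\mathcal D(\mathbb T)$: images of $[2^{-j}k,2^{-j}(k+1))$, $j\ge0$, $0\le k<2^j$. Stolz angle $\Gamma(\zeta_x)$: convex hull of $\{\zeta_x\}\cup\{|w|=1/2\}$. Tent $T(E)=\mathbb D\setminus\bigcup_{\zeta\notin E}\Gamma(\zeta)$. $A_qF(\zeta_x)=(\int_{\Gamma(\zeta_x)}|F(z)|^q(1-|z|)^{-2}dA(z))^{1/q}$;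 $\|F\|_{T_{p,q}}=\|A_qF\|_{L^p(\mathbb T)}$ for $p<\infty$; $\|F\|_{T_{\infty,q}}^q=\sup_{I\in\mathcal D(\mathbb T)}|I|^{-1}\int_{T(I)}|F|^q(1-|z|)^{-1}dA$. $T_{p,q}(\mathcal X)$: strongly measurable $F:\mathbb D\to\mathcal X$ with $\|F\|_{\mathcal X}\in T_{p,q}$, norm $\|\,\|F\|_{\mathcal X}\|_{T_{p,q}}$. For $s<0$, $0<p\le\infty$, $1\le q<\infty$: $F^s_{p,q}(\mathcal X)=\{f\in\mathcal A(\mathcal X):\|(1-|z|)^{-s}f\|_{T_{p,q}(\mathcal X)}<\infty\}$ with that norm; $F^s_{p,q}=F^s_{p,q}(\mathbb C)$. *)

theory Defs
  imports "HOL-Analysis.Analysis"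
begin

definition complex_space :: "(complex \<Rightarrow> 'a::real_normed_vector \<Rightarrow> 'a) \<Rightarrow> bool" where
  "complex_space sm \<longleftrightarrow>
     (\<forall>a x y. sm a (x + y) = sm a x + sm a y) \<and>
     (\<forall>a b x. sm (a + b) x = sm a x + sm b x) \<and>
     (\<forall>a b x. sm a (sm b x) = sm (a * b) x) \<and>
     (\<forall>x. sm 1 x = x) \<and>
     (\<forall>r x. sm (complex_of_real r) x = r *\<^sub>R x) \<and>
     (\<forall>a x. norm (sm a x) = cmod a * norm x)"

definition c_analytic_on :: "(complex \<Rightarrow> 'a \<Rightarrow> 'a::real_normed_vector) \<Rightarrow> complex set \<Rightarrow> (complex \<Rightarrow> 'a) \<Rightarrow> bool" where
  "c_analytic_on sm S f \<longleftrightarrow> (\<forall>z\<in>S. \<exists>f'. (f has_derivative (\<lambda>w. sm w f')) (at z))"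

definition zeta :: "real \<Rightarrow> complex" where
  "zeta x = cis (2 * pi * x)"

definition enn_powr :: "ennreal \<Rightarrow> real \<Rightarrow> ennreal" where
  "enn_powr a t = (if a = \<infinity> then \<infinity> else ennreal (enn2real a powr t))"

definition hardy_pow :: "real \<Rightarrow> (complex \<Rightarrow> 'a::real_normed_vector) \<Rightarrow> ennreal" where
  "hardy_pow p f = (SUP r\<in>{0<..<1}.
      \<integral>\<^sup>+ x\<in>{0..1}. ennreal (norm (f (complex_of_real r * zeta x)) powr p) \<partial>lborel)"

definition in_Hp :: "(complex \<Rightarrow> 'a \<Rightarrow> 'a::real_normed_vector) \<Rightarrow> real \<Rightarrow> (complex \<Rightarrow> 'a) \<Rightarrow> bool" where
  "in_Hp sm p f \<longleftrightarrow> c_analytic_on sm (ball 0 1) f \<and> hardy_pow p f < \<infinity>"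

definition Hp_norm :: "real \<Rightarrow> (complex \<Rightarrow> 'a::real_normed_vector) \<Rightarrow> real" where
  "Hp_norm p f = enn2real (hardy_pow p f) powr (1 / p)"

definition stolz :: "complex \<Rightarrow> complex set" where
  "stolz w = convex hull (insert w (sphere 0 (1/2)))"

definition tent :: "complex set \<Rightarrow> complex set" where
  "tent E = ball 0 1 - (\<Union>\<zeta>\<in>sphere 0 1 - E. stolz \<zeta>)"

definition area_q :: "real \<Rightarrow> (complex \<Rightarrow> real) \<Rightarrow> complex \<Rightarrow> ennreal" where
  "area_q q F \<zeta> = (\<integral>\<^sup>+ z\<in>stolz \<zeta> \<inter> ball 0 1.
       ennreal (\<bar>F z\<bar> powr q / (1 - norm z)\<^sup>2) \<partial>lborel)"

definition tent_pow :: "real \<Rightarrow> real \<Rightarrow> (complex \<Rightarrow> real) \<Rightarrow> ennreal" where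
  "tent_pow p q F = (\<integral>\<^sup>+ x\<in>{0..1}. enn_powr (area_q q F (zeta x)) (p / q) \<partial>lborel)"

(* dyadic arc: image of [2^-j k, 2^-j (k+1)), k < 2^j; normalized length 2^-j *)
definition dyadic_arc :: "nat \<Rightarrow> nat \<Rightarrow> complex set" where
  "dyadic_arc j k = zeta ` {real k / 2 ^ j ..< (real k + 1) / 2 ^ j}"

definition tent_inf_pow :: "real \<Rightarrow> (complex \<Rightarrow> real) \<Rightarrow> ennreal" where
  "tent_inf_pow q F = (SUP jk\<in>{(j, k). k < (2::nat) ^ j}.
      ennreal (2 ^ fst jk) * (\<integral>\<^sup>+ z\<in>tent (dyadic_arc (fst jk) (snd jk)).
          ennreal (\<bar>F z\<bar> powr q / (1 - norm z)) \<partial>lborel))"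

definition weighted :: "real \<Rightarrow> (complex \<Rightarrow> 'a::real_normed_vector) \<Rightarrow> complex \<Rightarrow> real" where
  "weighted s f z = (1 - norm z) powr (- s) * norm (f z)"

definition in_F :: "(complex \<Rightarrow> 'a \<Rightarrow> 'a::real_normed_vector) \<Rightarrow> real \<Rightarrow> real \<Rightarrow> real \<Rightarrow> (complex \<Rightarrow> 'a) \<Rightarrow> bool" where
  "in_F sm s p q f \<longleftrightarrow> c_analytic_on sm (ball 0 1) f \<and> tent_pow p q (weighted s f) < \<infinity>"

definition F_norm :: "real \<Rightarrow> real \<Rightarrow> real \<Rightarrow> (complex \<Rightarrow> 'a::real_normed_vector) \<Rightarrow> real" where
  "F_norm s p q f = enn2real (tent_pow p q (weighted s f)) powr (1 / p)"

definition in_Finf :: "real \<Rightarrow> real \<Rightarrow> (complex \<Rightarrow> complex) \<Rightarrow> bool" where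
  "in_Finf s q h \<longleftrightarrow> h holomorphic_on ball 0 1 \<and> tent_inf_pow q (weighted s h) < \<infinity>"

definition Finf_norm :: "real \<Rightarrow> real \<Rightarrow> (complex \<Rightarrow> complex) \<Rightarrow> real" where
  "Finf_norm s q h = enn2real (tent_inf_pow q (weighted s h)) powr (1 / q)"

end

theory Submission
  imports Defs "HOL-Complex_Analysis.Complex_Analysis"
begin

text \<open>For the inclusion, decompose the disc into dyadic Whitney boxes.  The mass that
  \<open>|h|\<^sup>q (1 - |z|)\<^bsup>-sq-1\<^esup>\<close> puts on the boxes is a discrete Carleson measure.  Since a dyadic tent
  avoids the Stolz angles at the end points of its arc, the hypothesis controls \<open>h\<close> only away from finitely
  many cones; there \<open>h\<close> is estimated by a Phragmen-Lindelof argument.  The area function of \<open>g h\<close> is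
  dominated by sums over dyadic ancestors of box masses times the largest value of \<open>|g|\<^sup>q\<close> on the box, and
  a discrete Carleson embedding bounds their \<open>L\<^bsup>p/q\<^esup>\<close> norm by the nontangential maximal function of
  \<open>g\<close>.  The latter is controlled by \<open>H\<^sup>p\<close> for every \<open>p > 0\<close>: norming functionals and an outer majorant
  reduce it to the \<open>L\<^sup>2\<close> bound for the Poisson maximal function.

  For the example let \<open>f z = (\<Sum>n. c\<^sub>n z\<^sup>n e\<^sub>n)\<close> with \<open>e\<^sub>n\<close> orthonormal and \<open>c\<^sub>n\<close> such that
  \<open>|f z|\<^sup>2 = (1 - |z|\<^sup>2) powr s\<close>.  If \<open>f = g h\<close>, then \<open>h\<close> has no zeros, so the mean value property of
  \<open>1 / h\<close> on \<open>|z| = r\<close>, where \<open>|1 / h| = |g| / |f|\<close> and \<open>|f|\<close> is constant, gives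
  \<open>(1 - r\<^sup>2) powr (s / 2) \<le> |h 0| |g|\<close> with the \<open>H\<^sup>1\<close> norm of \<open>g\<close>, which fails as \<open>r\<close> tends to \<open>1\<close>.\<close>

section \<open>Norming functionals on complex normed spaces\<close>

text \<open>The dyadic condition and the area function see the boxes differently. In each generation
  a Stolz angle at x meets the box over the dyadic arc of x and possibly its two neighbours, which
  are not ancestors of the leaf at x. The mass of a neighbour is therefore carried to the ancestor
  by a cyclic shift of positions. This keeps the tree structure but destroys the containment of
  boxes in the tent near the ends of an arc. At most four boxes per generation are lost. The
  pointwise bound on \<open>h\<close> makes each cost a multiple of its length, and these lengths
  form a geometric series; hence the pointwise bound has to hold up to the dyadic end points before
  any embedding is available.

  Since p/q may lie on either side of 1, the embedding is proved directly for all positive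
  exponents, on a finite tree with \<open>2 ^ n\<close> leaves and with constants independent of n.
  The maximal theorem is discretised in the same way, with one point per leaf, and the limit is a
  single monotone convergence. All constants depend on s, p and q only.\<close>

definition sublinear :: "('a::real_normed_vector \<Rightarrow> real) \<Rightarrow> bool" where
  "sublinear f \<longleftrightarrow> (\<forall>x y. f (x + y) \<le> f x + f y) \<and> (\<forall>x. \<forall>t>0. f (t *\<^sub>R x) \<le> t * f x)
     \<and> (\<forall>x. f x \<le> norm x)"

lemma sublinear_add: "sublinear f \<Longrightarrow> f (x + y) \<le> f x + f y"
  and sublinear_scale: "sublinear f \<Longrightarrow> t > 0 \<Longrightarrow> f (t *\<^sub>R x) \<le> t * f x"
  and sublinear_le_norm: "sublinear f \<Longrightarrow> f x \<le> norm x"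
  unfolding sublinear_def by blast+

lemma sublinear_minus_le_norm: "sublinear f \<Longrightarrow> f (- x) \<le> norm x"
  using sublinear_le_norm[of f "- x"] by simp

text \<open>The bound by the norm is built into \<open>sublinear\<close> because it yields this
  lower bound, which keeps all infima of the Zorn argument finite.\<close>

lemma sublinear_lower:
  assumes f: "sublinear f" shows "- norm x \<le> f x"
proof -
  have "f 0 \<ge> 0" using sublinear_add[OF f, of 0 0] by simp
  moreover have "f 0 \<le> f x + f (- x)" using sublinear_add[OF f, of x "- x"] by simp
  ultimately show ?thesis using sublinear_minus_le_norm[OF f, of x] by linarith
qed

text \<open>Pushes \<open>f\<close> down along the ray through \<open>x\<close>. If \<open>f\<close>
  is unchanged for every \<open>x\<close>, the term t = 1 gives
  \<open>f y + f x \<le> f (y + x)\<close>. So a minimal sublinear functional is additive, and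
  Hahn-Banach reduces to the existence of minimal elements.\<close>

definition shrink_at :: "('a::real_normed_vector \<Rightarrow> real) \<Rightarrow> 'a \<Rightarrow> 'a \<Rightarrow> real" where
  "shrink_at f x y = (INF t\<in>{0..}. f (y + t *\<^sub>R x) - t * f x)"

lemma shrink_at_bdd:
  assumes "sublinear f"
  shows "bdd_below ((\<lambda>t. f (y + t *\<^sub>R x) - t * f x) ` {0..})"
proof (rule bdd_belowI2)
  fix t :: real assume t: "t \<in> {0..}"
  have 1: "t * f x \<le> f (t *\<^sub>R x)"
  proof (cases "t = 0")
    case True
    then show ?thesis using sublinear_lower[OF assms, of 0] by simp
  next
    case False
    with t have tp: "t > 0" by simp
    have "f (inverse t *\<^sub>R (t *\<^sub>R x)) \<le> inverse t * f (t *\<^sub>R x)"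
      by (rule sublinear_scale[OF assms]) (use tp in simp)
    then show ?thesis using tp by (simp add: field_simps)
  qed
  have "f ((y + t *\<^sub>R x) + (- y)) \<le> f (y + t *\<^sub>R x) + f (- y)" by (rule sublinear_add[OF assms])
  with 1 sublinear_minus_le_norm[OF assms, of y]
  show "- norm y \<le> f (y + t *\<^sub>R x) - t * f x" by simp
qed

lemma shrink_at_le:
  assumes "sublinear f" "t \<ge> 0"
  shows "shrink_at f x y \<le> f (y + t *\<^sub>R x) - t * f x"
  unfolding shrink_at_def by (rule cINF_lower[OF shrink_at_bdd[OF assms(1)]]) (use assms in auto)

lemma shrink_at_ge:
  assumes "\<And>t. t \<ge> 0 \<Longrightarrow> c \<le> f (y + t *\<^sub>R x) - t * f x"
  shows "c \<le> shrink_at f x y"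
  unfolding shrink_at_def by (rule cINF_greatest) (use assms in auto)

lemma shrink_at_sublinear:
  assumes f: "sublinear f"
  shows "sublinear (shrink_at f x)"
  unfolding sublinear_def
proof (intro conjI allI impI)
  fix y z
  have "shrink_at f x (y + z) - shrink_at f x y \<le> shrink_at f x z"
  proof (rule shrink_at_ge)
    fix u :: real assume u: "u \<ge> 0"
    \<comment> \<open>Parameters \<open>t\<close> for \<open>y\<close> and \<open>u\<close> for
      \<open>z\<close> merge into \<open>t + u\<close> for \<open>y + z\<close>; fixing
      \<open>u\<close> first lets the two infima be taken one after the other.\<close>
    have "shrink_at f x (y + z) - (f (z + u *\<^sub>R x) - u * f x) \<le> shrink_at f x y"
    proof (rule shrink_at_ge)
      fix t :: real assume t: "t \<ge> 0"
      have "shrink_at f x (y + z) \<le> f ((y + z) + (t + u) *\<^sub>R x) - (t + u) * f x"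
        using shrink_at_le[OF f] t u by simp
      also have "(y + z) + (t + u) *\<^sub>R x = (y + t *\<^sub>R x) + (z + u *\<^sub>R x)"
        by (simp add: algebra_simps)
      also have "f \<dots> \<le> f (y + t *\<^sub>R x) + f (z + u *\<^sub>R x)" using f unfolding sublinear_def by blast
      finally show "shrink_at f x (y + z) - (f (z + u *\<^sub>R x) - u * f x) \<le> f (y + t *\<^sub>R x) - t * f x"
        by (simp add: algebra_simps)
    qed
    then show "shrink_at f x (y + z) - shrink_at f x y \<le> f (z + u *\<^sub>R x) - u * f x" by simp
  qed
  then show "shrink_at f x (y + z) \<le> shrink_at f x y + shrink_at f x z" by simp
next
  fix y and t :: real assume t: "t > 0"
  have "shrink_at f x (t *\<^sub>R y) / t \<le> shrink_at f x y"
  proof (rule shrink_at_ge)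
    fix u :: real assume u: "u \<ge> 0"
    have "shrink_at f x (t *\<^sub>R y) \<le> f (t *\<^sub>R y + (t * u) *\<^sub>R x) - (t * u) * f x"
      using shrink_at_le[OF f] t u by simp
    also have "t *\<^sub>R y + (t * u) *\<^sub>R x = t *\<^sub>R (y + u *\<^sub>R x)" by (simp add: algebra_simps)
    also have "f \<dots> \<le> t * f (y + u *\<^sub>R x)" using f t unfolding sublinear_def by blast
    finally show "shrink_at f x (t *\<^sub>R y) / t \<le> f (y + u *\<^sub>R x) - u * f x"
      using t by (simp add: field_simps)
  qed
  then show "shrink_at f x (t *\<^sub>R y) \<le> t * shrink_at f x y" using t by (simp add: field_simps)
next
  fix y
  have "shrink_at f x y \<le> f y" using shrink_at_le[OF f, of 0 x y] by simp
  also have "f y \<le> norm y" using f unfolding sublinear_def by blast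
  finally show "shrink_at f x y \<le> norm y" .
qed

text \<open>Subadditivity survives the infimum because two members of a chain have a common lower
  member: with \<open>k\<close> below \<open>f\<close> and \<open>g\<close>,
  \<open>k (x + y)\<close> is at most \<open>f x + g y\<close>.\<close>

lemma sublinear_INF_chain:
  fixes C :: "('a::real_normed_vector \<Rightarrow> real) set"
  assumes C: "\<And>f. f \<in> C \<Longrightarrow> sublinear f" and ne: "C \<noteq> {}"
    and chain: "\<And>f g. f \<in> C \<Longrightarrow> g \<in> C \<Longrightarrow> f \<le> g \<or> g \<le> f"
  shows "sublinear (\<lambda>x. INF f\<in>C. f x)" and "\<And>f. f \<in> C \<Longrightarrow> (\<lambda>x. INF f\<in>C. f x) \<le> f"
proof -
  have bdd: "bdd_below ((\<lambda>f. f x) ` C)" for x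
    by (rule bdd_belowI2[of _ "- norm x"]) (use C sublinear_lower in blast)
  have low: "(INF f\<in>C. f x) \<le> f x" if "f \<in> C" for f x
    by (rule cINF_lower[OF bdd that])
  show "\<And>f. f \<in> C \<Longrightarrow> (\<lambda>x. INF f\<in>C. f x) \<le> f" using low by (simp add: le_fun_def)
  show "sublinear (\<lambda>x. INF f\<in>C. f x)"
    unfolding sublinear_def
  proof (intro conjI allI impI)
    fix x y
    have "(INF f\<in>C. f (x + y)) - (INF f\<in>C. f x) \<le> (INF f\<in>C. f y)"
    proof (rule cINF_greatest[OF ne])
      fix g assume g: "g \<in> C"
      have "(INF f\<in>C. f (x + y)) - g y \<le> (INF f\<in>C. f x)"
      proof (rule cINF_greatest[OF ne])
        fix f assume f: "f \<in> C"
        obtain k where k: "k \<in> C" "k \<le> f" "k \<le> g" using chain[OF f g] f g by blast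
        have "(INF f\<in>C. f (x + y)) \<le> k (x + y)" by (rule low[OF k(1)])
        also have "\<dots> \<le> k x + k y" using C[OF k(1)] unfolding sublinear_def by blast
        also have "\<dots> \<le> f x + g y" using k(2,3) by (simp add: le_fun_def add_mono)
        finally show "(INF f\<in>C. f (x + y)) - g y \<le> f x" by simp
      qed
      then show "(INF f\<in>C. f (x + y)) - (INF f\<in>C. f x) \<le> g y" by simp
    qed
    then show "(INF f\<in>C. f (x + y)) \<le> (INF f\<in>C. f x) + (INF f\<in>C. f y)" by simp
  next
    fix x and t :: real assume t: "t > 0"
    have "(INF f\<in>C. f (t *\<^sub>R x)) / t \<le> (INF f\<in>C. f x)"
    proof (rule cINF_greatest[OF ne])
      fix f assume f: "f \<in> C"
      have "(INF f\<in>C. f (t *\<^sub>R x)) \<le> f (t *\<^sub>R x)" by (rule low[OF f])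
      also have "\<dots> \<le> t * f x" using C[OF f] t unfolding sublinear_def by blast
      finally show "(INF f\<in>C. f (t *\<^sub>R x)) / t \<le> f x" using t by (simp add: field_simps)
    qed
    then show "(INF f\<in>C. f (t *\<^sub>R x)) \<le> t * (INF f\<in>C. f x)" using t by (simp add: field_simps)
  next
    fix x
    obtain f where f: "f \<in> C" using ne by blast
    show "(INF f\<in>C. f x) \<le> norm x"
      using low[OF f, of x] C[OF f] unfolding sublinear_def by (meson order_trans)
  qed
qed

lemma minimal_sublinear_exists:
  fixes f :: "'a::real_normed_vector \<Rightarrow> real"
  assumes f: "sublinear f"
  obtains m where "sublinear m" "m \<le> f" "\<And>g. sublinear g \<Longrightarrow> g \<le> m \<Longrightarrow> g = m"
proof -
  let ?A = "{g. sublinear g \<and> g \<le> f}"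
  \<comment> \<open>The order is reversed, so that the maximal element of Zorn's lemma is a minimal
    functional.\<close>
  let ?P = "\<lambda>g k :: 'a \<Rightarrow> real. k \<le> g"
  have "\<exists>m\<in>?A. \<forall>a\<in>?A. ?P m a \<longrightarrow> a = m"
  proof (rule predicate_Zorn)
    show "partial_order_on ?A (relation_of ?P ?A)"
      by (rule partial_order_on_relation_ofI) auto
    fix C assume C: "C \<in> Chains (relation_of ?P ?A)"
    show "\<exists>u\<in>?A. \<forall>a\<in>C. u \<le> a"
    proof (cases "C = {}")
      case True
      then show ?thesis using f by auto
    next
      case False
      have C': "\<And>g. g \<in> C \<Longrightarrow> sublinear g" "\<And>g. g \<in> C \<Longrightarrow> g \<le> f"
        "\<And>g k. g \<in> C \<Longrightarrow> k \<in> C \<Longrightarrow> g \<le> k \<or> k \<le> g"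
        using C unfolding Chains_def relation_of_def by blast+
      note inf = sublinear_INF_chain[OF C'(1) False C'(3)]
      have "(\<lambda>x. INF g\<in>C. g x) \<in> ?A" using inf False C'(2) by (metis (mono_tags, lifting) ex_in_conv mem_Collect_eq order_trans)
      then show ?thesis using inf(2) by blast
    qed
  qed
  then obtain m where "sublinear m" "m \<le> f" "\<And>a. sublinear a \<Longrightarrow> a \<le> f \<Longrightarrow> a \<le> m \<Longrightarrow> a = m"
    by auto
  then show ?thesis using that by (metis order_trans)
qed

lemma real_norming_functional:
  fixes x :: "'a::real_normed_vector"
  obtains l where "linear l" "\<And>y. l y \<le> norm y" "l x = norm x"
proof -
  have n: "sublinear (norm :: 'a \<Rightarrow> real)" by (simp add: sublinear_def norm_triangle_ineq)
  \<comment> \<open>Starting below \<open>shrink_at norm x\<close> rather than below the norm forces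
    \<open>m (- x) \<le> - norm x\<close>, hence \<open>m x \<ge> norm x\<close>.\<close>
  obtain m where m: "sublinear m" "m \<le> shrink_at norm x" and min: "\<And>g. sublinear g \<Longrightarrow> g \<le> m \<Longrightarrow> g = m"
    using minimal_sublinear_exists[OF shrink_at_sublinear[OF n]] by blast
  have eq: "shrink_at m a = m" for a
  proof (rule min)
    show "sublinear (shrink_at m a)" by (rule shrink_at_sublinear[OF m(1)])
    show "shrink_at m a \<le> m" using shrink_at_le[OF m(1), of 0 a] by (simp add: le_fun_def)
  qed
  have add: "m (a + b) = m a + m b" for a b
  proof (rule antisym)
    show "m (a + b) \<le> m a + m b" using m(1) unfolding sublinear_def by blast
    have "m b \<le> m (b + 1 *\<^sub>R a) - 1 * m a" using shrink_at_le[OF m(1), of 1 a b] by (simp add: eq)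
    then show "m a + m b \<le> m (a + b)" by (simp add: add.commute)
  qed
  have zero: "m 0 = 0" using add[of 0 0] by simp
  have neg: "m (- a) = - m a" for a using add[of a "- a"] zero by simp
  have pos: "m (t *\<^sub>R a) = t * m a" if "t > 0" for t a
  proof (rule antisym)
    show "m (t *\<^sub>R a) \<le> t * m a" using m(1) that unfolding sublinear_def by blast
    have "m (inverse t *\<^sub>R (t *\<^sub>R a)) \<le> inverse t * m (t *\<^sub>R a)"
      using m(1) that unfolding sublinear_def by (meson positive_imp_inverse_positive)
    then show "t * m a \<le> m (t *\<^sub>R a)" using that by (simp add: field_simps)
  qed
  have sc: "m (t *\<^sub>R a) = t * m a" for t a
  proof -
    consider "t > 0" | "t = 0" | "- t > 0" by linarith
    then show ?thesis
    proof cases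
      case 3
      have "m (t *\<^sub>R a) = - m ((- t) *\<^sub>R a)" using neg[of "(-t) *\<^sub>R a"] by simp
      then show ?thesis using pos[OF 3, of a] by simp
    qed (use pos zero in auto)
  qed
  have lin: "linear m" by (rule linearI) (use add sc in auto)
  have le: "m y \<le> norm y" for y using m(1) unfolding sublinear_def by blast
  have "m (- x) \<le> shrink_at norm x (- x)" using m(2) by (simp add: le_fun_def)
  also have "\<dots> \<le> norm (- x + 1 *\<^sub>R x) - 1 * norm x" by (rule shrink_at_le[OF n]) simp
  finally have "m x \<ge> norm x" using neg by simp
  with le have "m x = norm x" by (simp add: antisym)
  with that lin le show ?thesis by blast
qed

section \<open>Complex-linear norming functionals\<close>

lemma complex_space_bounded_bilinear:
  assumes "complex_space sm"
  shows "bounded_bilinear sm"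
proof
  have sr: "sm (complex_of_real r) x = r *\<^sub>R x" and ss: "sm a (sm b x) = sm (a * b) x" for r a b x
    using assms unfolding complex_space_def by auto
  show "sm (a + a') b = sm a b + sm a' b" "sm a (b + b') = sm a b + sm a b'" for a a' b b'
    using assms unfolding complex_space_def by auto
  show "sm (r *\<^sub>R a) b = r *\<^sub>R sm a b" for r a b
    by (metis scaleR_conv_of_real sr ss)
  show "sm a (r *\<^sub>R b) = r *\<^sub>R sm a b" for r a b
    by (metis mult.commute sr ss)
  show "\<exists>K. \<forall>a b. norm (sm a b) \<le> norm a * norm b * K"
    using assms unfolding complex_space_def by (intro exI[of _ 1]) auto
qed

text \<open>A real functional is the real part of exactly one complex-linear one,
  \<open>l y = m y - i m (i y)\<close>. The bound passes from \<open>m\<close> to \<open>l\<close>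
  by rotating \<open>l y\<close> onto the positive axis.\<close>

lemma complex_norming_functional:
  fixes x :: "'a::real_normed_vector"
  assumes sm: "complex_space sm"
  obtains l :: "'a \<Rightarrow> complex" where "bounded_linear l" "\<And>a y. l (sm a y) = a * l y"
    "\<And>y. norm (l y) \<le> norm y" "norm (l x) = norm x"
proof -
  interpret bounded_bilinear sm by (rule complex_space_bounded_bilinear[OF sm])
  have sr: "sm (complex_of_real r) y = r *\<^sub>R y" and ss: "sm a (sm b y) = sm (a * b) y"
    and s1: "sm 1 y = y" and ns: "norm (sm a y) = cmod a * norm y" for r a b y
    using sm unfolding complex_space_def by auto
  obtain m where m: "linear m" "\<And>y. m y \<le> norm y" "m x = norm x" using real_norming_functional by blast
  interpret m: linear m by (rule m(1))
  define l where "l y = Complex (m y) (- m (sm \<i> y))" for y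
  have sm_eq: "sm a y = Re a *\<^sub>R y + Im a *\<^sub>R sm \<i> y" for a y
  proof -
    have "a = of_real (Re a) + of_real (Im a) * \<i>" by (simp add: complex_eq_iff)
    then have "sm a y = sm (of_real (Re a)) y + sm (of_real (Im a)) (sm \<i> y)"
      by (metis add_left ss)
    then show ?thesis by (simp add: sr)
  qed
  have ii: "sm \<i> (sm \<i> y) = - y" for y using sm_eq[of "-1" y] by (simp add: ss)
  have hom: "l (sm a y) = a * l y" for a y
  proof -
    have 1: "m (sm a y) = Re a * m y + Im a * m (sm \<i> y)"
      by (subst sm_eq) (simp add: m.add m.scale)
    have "m (sm \<i> (sm a y)) = m (Re a *\<^sub>R sm \<i> y + Im a *\<^sub>R sm \<i> (sm \<i> y))"
      by (subst sm_eq[of a]) (simp only: add_right scaleR_right)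
    also have "\<dots> = Re a * m (sm \<i> y) - Im a * m y"
      by (simp only: ii) (simp add: m.add m.scale m.neg m.diff)
    finally show ?thesis using 1 by (simp add: l_def complex_eq_iff algebra_simps)
  qed
  have nl: "norm (l y) \<le> norm y" for y
  proof (cases "l y = 0")
    case False
    define c where "c = cnj (l y) / of_real (cmod (l y))"
    have c: "cmod c = 1" using False by (simp add: c_def norm_divide)
    have "l y * cnj (l y) = of_real (cmod (l y)) * of_real (cmod (l y))"
      by (metis complex_norm_square power2_eq_square of_real_power)
    then have "c * l y = of_real (cmod (l y))"
      using False by (simp add: c_def field_simps)
    then have "cmod (l y) = Re (l (sm c y))" by (simp add: hom)
    also have "\<dots> \<le> norm (sm c y)" by (simp add: l_def m(2))
    finally show ?thesis by (simp add: ns c)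
  qed simp
  have "l (y + z) = l y + l z" for y z
    by (simp only: l_def add_right m.add complex_eq_iff) simp
  moreover have "l (t *\<^sub>R y) = t *\<^sub>R l y" for t y
    using hom[of "of_real t" y] by (simp only: sr) (simp add: scaleR_conv_of_real)
  ultimately have "linear l" by (rule linearI)
  then have "bounded_linear l"
    by (intro bounded_linear.intro bounded_linear_axioms.intro exI[of _ 1]) (auto simp: nl)
  moreover have "norm (l x) \<ge> norm x"
    using complex_Re_le_cmod[of "l x"] by (simp add: l_def m(3))
  ultimately show ?thesis using that hom nl antisym by blast
qed

section \<open>The Poisson maximal function\<close>

definition trig_real :: "(complex \<Rightarrow> real) \<Rightarrow> bool" where
  "trig_real f \<longleftrightarrow> (\<exists>p. \<forall>\<zeta>. norm \<zeta> = 1 \<longrightarrow> f \<zeta> = Re (poly p \<zeta>))"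

lemma trig_real_add:
  assumes "trig_real f" "trig_real g" shows "trig_real (\<lambda>\<zeta>. f \<zeta> + g \<zeta>)"
proof -
  obtain p q where "\<forall>\<zeta>. norm \<zeta> = 1 \<longrightarrow> f \<zeta> = Re (poly p \<zeta>)" "\<forall>\<zeta>. norm \<zeta> = 1 \<longrightarrow> g \<zeta> = Re (poly q \<zeta>)"
    using assms unfolding trig_real_def by blast
  then show ?thesis unfolding trig_real_def by (intro exI[of _ "p + q"]) simp
qed

lemma trig_real_const: "trig_real (\<lambda>\<zeta>. c)"
  unfolding trig_real_def by (intro exI[of _ "[:of_real c:]"]) simp

lemma trig_real_sum:
  assumes "\<And>i. i \<in> I \<Longrightarrow> trig_real (f i)" shows "trig_real (\<lambda>\<zeta>. \<Sum>i\<in>I. f i \<zeta>)"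
  using assms
proof (induction I rule: infinite_finite_induct)
  case (insert i I)
  have "trig_real (\<lambda>\<zeta>. f i \<zeta> + (\<Sum>i\<in>I. f i \<zeta>))"
    by (rule trig_real_add) (use insert in auto)
  then show ?case using insert by simp
qed (simp_all add: trig_real_const)

lemma trig_real_monom: "trig_real (\<lambda>\<zeta>. Re (a * \<zeta> ^ i))"
  unfolding trig_real_def by (intro exI[of _ "monom a i"]) (simp add: poly_monom)

lemma trig_real_cong: "trig_real f \<Longrightarrow> (\<And>\<zeta>. norm \<zeta> = 1 \<Longrightarrow> g \<zeta> = f \<zeta>) \<Longrightarrow> trig_real g"
  unfolding trig_real_def by auto

text \<open>Product-to-sum formula: \<open>Re v * Re w\<close> is the real part of half of
  \<open>v * w\<close> plus half of \<open>cnj v * w\<close>, and on the circle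
  \<open>cnj \<zeta>\<close> is the inverse of \<open>\<zeta>\<close>. Taking
  \<open>i \<le> j\<close> makes \<open>j - i\<close> a true difference.\<close>

lemma trig_real_monom_mult: "trig_real (\<lambda>\<zeta>. Re (a * \<zeta> ^ i) * Re (b * \<zeta> ^ j))"
proof (induction i j arbitrary: a b rule: linorder_wlog)
  case (le i j)
  have "trig_real (\<lambda>\<zeta>. Re (a * b / 2 * \<zeta> ^ (i + j)) + Re (cnj a * b / 2 * \<zeta> ^ (j - i)))"
    by (intro trig_real_add trig_real_monom)
  then show ?case
  proof (rule trig_real_cong)
    fix \<zeta> :: complex assume z: "norm \<zeta> = 1"
    have "\<zeta> ^ j = \<zeta> ^ i * \<zeta> ^ (j - i)" using le by (simp flip: power_add)
    moreover have "\<zeta> ^ i * cnj (\<zeta> ^ i) = 1"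
      unfolding complex_norm_square[symmetric] by (simp add: norm_power z)
    ultimately have e: "cnj (\<zeta> ^ i) * \<zeta> ^ j = \<zeta> ^ (j - i)"
      by (metis (no_types, lifting) mult.assoc mult.commute mult_1)
    have 1: "cnj a * b / 2 * \<zeta> ^ (j - i) = cnj (a * \<zeta> ^ i) * (b * \<zeta> ^ j) / 2"
      unfolding e[symmetric] complex_cnj_mult by (simp add: mult_ac)
    have 2: "a * b / 2 * \<zeta> ^ (i + j) = (a * \<zeta> ^ i) * (b * \<zeta> ^ j) / 2"
      unfolding power_add by (simp add: mult_ac)
    have "Re v * Re w = Re (v * w / 2) + Re (cnj v * w / 2)" for v w by (simp add: field_simps)
    then show "Re (a * \<zeta> ^ i) * Re (b * \<zeta> ^ j) = Re (a * b / 2 * \<zeta> ^ (i + j)) + Re (cnj a * b / 2 * \<zeta> ^ (j - i))"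
      unfolding 1 2 .
  qed
next
  case (sym i j)
  show ?case using sym[of b a] by (simp add: mult.commute)
qed

lemma trig_real_mult:
  assumes "trig_real f" "trig_real g" shows "trig_real (\<lambda>\<zeta>. f \<zeta> * g \<zeta>)"
proof -
  obtain p q where pq: "\<forall>\<zeta>. norm \<zeta> = 1 \<longrightarrow> f \<zeta> = Re (poly p \<zeta>)" "\<forall>\<zeta>. norm \<zeta> = 1 \<longrightarrow> g \<zeta> = Re (poly q \<zeta>)"
    using assms unfolding trig_real_def by blast
  have "trig_real (\<lambda>\<zeta>. \<Sum>i\<le>degree p. \<Sum>j\<le>degree q. Re (coeff p i * \<zeta> ^ i) * Re (coeff q j * \<zeta> ^ j))"
    by (intro trig_real_sum trig_real_monom_mult)
  then show ?thesis
    by (rule trig_real_cong) (simp add: pq poly_altdef sum_product)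
qed

lemma trig_real_polynomial_function:
  fixes f :: "complex \<Rightarrow> real"
  assumes "real_polynomial_function f" shows "trig_real f"
  using assms
proof (induction rule: real_polynomial_function.induct)
  case (linear f)
  interpret bounded_linear f by (rule linear)
  have e: "f \<zeta> = Re ((of_real (f 1) - \<i> * of_real (f \<i>)) * \<zeta> ^ 1)" for \<zeta>
  proof -
    have "\<zeta> = Re \<zeta> *\<^sub>R 1 + Im \<zeta> *\<^sub>R \<i>" by (simp add: complex_eq_iff)
    then have "f \<zeta> = f (Re \<zeta> *\<^sub>R 1 + Im \<zeta> *\<^sub>R \<i>)" by (rule arg_cong)
    also have "\<dots> = Re \<zeta> * f 1 + Im \<zeta> * f \<i>" by (simp only: add scaleR real_scaleR_def)
    finally show ?thesis by (simp only: power_one_right) simp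
  qed
  show ?case by (rule trig_real_cong[OF trig_real_monom e])
qed (rule trig_real_const trig_real_add trig_real_mult; assumption)+

text \<open>Stone-Weierstrass for real trigonometric polynomials. Writing them as
  \<open>Re (poly p \<zeta>)\<close> supplies at once a harmonic extension that is the real part of
  an entire function; its exponential will serve as an outer function.\<close>

lemma circle_poly_approx:
  fixes u :: "complex \<Rightarrow> real"
  assumes "continuous_on (sphere 0 1) u" "e > 0"
  obtains p where "\<And>\<zeta>. norm \<zeta> = 1 \<Longrightarrow> \<bar>u \<zeta> - Re (poly p \<zeta>)\<bar> < e"
proof -
  obtain g where "real_polynomial_function g" and g: "\<And>x. x \<in> sphere 0 1 \<Longrightarrow> \<bar>u x - g x\<bar> < e"
    using Stone_Weierstrass_real_polynomial_function[OF compact_sphere assms] by blast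
  then obtain p where p: "\<forall>\<zeta>. norm \<zeta> = 1 \<longrightarrow> g \<zeta> = Re (poly p \<zeta>)"
    using trig_real_polynomial_function unfolding trig_real_def by blast
  have "\<bar>u \<zeta> - Re (poly p \<zeta>)\<bar> < e" if "norm \<zeta> = 1" for \<zeta>
    using g[of \<zeta>] p that by simp
  then show ?thesis using that by blast
qed

section \<open>Poisson kernels and their composition\<close>

lemma norm_zeta [simp]: "norm (zeta x) = 1"
  by (simp add: zeta_def)

lemma continuous_on_zeta [continuous_intros]: "continuous_on S zeta"
  unfolding zeta_def by (intro continuous_intros)

definition poisson :: "complex \<Rightarrow> complex \<Rightarrow> real" where
  "poisson z \<zeta> = (1 - (cmod z)\<^sup>2) / (cmod (\<zeta> - z))\<^sup>2"

lemma poisson_nonneg: "norm z < 1 \<Longrightarrow> 0 \<le> poisson z \<zeta>"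
  unfolding poisson_def by (simp add: power_le_one)

lemma continuous_on_poisson [continuous_intros]:
  assumes "norm z < 1" shows "continuous_on S (\<lambda>t. poisson z (zeta t))"
proof -
  have "zeta t \<noteq> z" for t using assms norm_zeta[of t] by auto
  then show ?thesis unfolding poisson_def by (intro continuous_intros) auto
qed

lemma one_minus_mult_neq_0:
  fixes z w :: complex assumes "norm z < 1" "norm w \<le> 1" shows "1 - cnj z * w \<noteq> 0"
proof
  assume "1 - cnj z * w = 0"
  then have "norm (cnj z * w) = 1" by (metis eq_iff_diff_eq_0 norm_one)
  moreover have "norm (cnj z * w) < 1"
  proof -
    have "cmod z * cmod w \<le> cmod z * 1" by (rule mult_left_mono) (use assms in auto)
    then show ?thesis using assms by (simp add: norm_mult)
  qed
  ultimately show False by simp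
qed

lemma poisson_representation:
  assumes f: "f holomorphic_on cball 0 1" and z: "norm z < 1"
  shows "((\<lambda>t. f (zeta t) * of_real (poisson z (zeta t))) has_integral f z) {0..1}"
proof -
  \<comment> \<open>Multiplying by \<open>(1 - |z|^2) / (1 - cnj z * u)\<close> changes nothing at
    \<open>u = z\<close>, but turns the Cauchy kernel on the circle into the Poisson kernel.\<close>
  define k where "k u = f u * of_real (1 - (cmod z)\<^sup>2) / (1 - cnj z * u)" for u
  have "k holomorphic_on cball 0 1"
    unfolding k_def by (intro holomorphic_intros f) (use one_minus_mult_neq_0[OF z] in auto)
  from Cauchy_integral_circlepath_simple[OF this, of z]
  have "((\<lambda>u. k u / (u - z)) has_contour_integral 2 * of_real pi * \<i> * k z) (circlepath 0 1)"
    using z by simp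
  then have I: "((\<lambda>t. k (circlepath 0 1 t) / (circlepath 0 1 t - z) * vector_derivative (circlepath 0 1) (at t))
      has_integral 2 * of_real pi * \<i> * k z) {0..1}"
    by (simp add: has_contour_integral)
  have cz: "circlepath 0 1 t = zeta t" for t
    by (simp add: circlepath zeta_def cis_conv_exp mult_ac)
  have kz: "k z = f z"
  proof -
    have "1 - cnj z * z \<noteq> 0" by (rule one_minus_mult_neq_0) (use z in auto)
    moreover have "of_real (1 - (cmod z)\<^sup>2) = 1 - cnj z * z"
      by (simp only: of_real_diff of_real_1 complex_norm_square mult.commute)
    ultimately show ?thesis by (simp add: k_def)
  qed
  have "k (zeta t) / (zeta t - z) * vector_derivative (circlepath 0 1) (at t)
      = 2 * of_real pi * \<i> * (f (zeta t) * of_real (poisson z (zeta t)))" for t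
  proof -
    let ?u = "zeta t"
    have uu: "?u * cnj ?u = 1" by (simp flip: complex_norm_square)
    have ne: "?u - z \<noteq> 0" using norm_zeta[of t] z by auto
    then have nc: "cnj ?u - cnj z \<noteq> 0" by (metis complex_cnj_diff complex_cnj_zero_iff)
    have e: "1 - cnj z * ?u = ?u * (cnj ?u - cnj z)" by (simp add: algebra_simps uu)
    have alg: "F * R / (u * b) / a * (c * u) = c * (F * (R / (a * b)))"
      if "u \<noteq> 0" "a \<noteq> 0" "b \<noteq> 0" for F R u a b c :: complex
      using that by (simp add: field_simps)
    have u0: "?u \<noteq> 0" by (metis norm_zeta norm_zero zero_neq_one)
    have d: "complex_of_real ((cmod (?u - z))\<^sup>2) = (?u - z) * (cnj ?u - cnj z)"
      by (simp only: complex_norm_square complex_cnj_diff)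
    have "vector_derivative (circlepath 0 1) (at t) = 2 * of_real pi * \<i> * ?u"
      unfolding vector_derivative_circlepath cz[symmetric] by (simp add: circlepath)
    then show ?thesis
      unfolding k_def poisson_def e of_real_divide d using alg ne nc u0 by simp
  qed
  with I have "((\<lambda>t. 2 * of_real pi * \<i> * (f (zeta t) * of_real (poisson z (zeta t))))
      has_integral 2 * of_real pi * \<i> * f z) {0..1}"
    by (simp only: cz kz)
  note I2 = has_integral_mult_right[OF this, of "inverse (2 * of_real pi * \<i>)"]
  have inv: "inverse (2 * of_real pi * \<i>) * (2 * of_real pi * \<i> * x) = x" for x :: complex
    by (simp add: field_simps)
  from I2 show ?thesis unfolding inv .
qed

text \<open>The kernel at \<open>w\<close> is the boundary value of the real part of the Herglotz
  function \<open>f\<close>, which is holomorphic on the closed disc; integrating it against the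
  kernel at \<open>z\<close> evaluates \<open>Re f\<close> at \<open>z\<close>.\<close>

lemma poisson_convolution:
  assumes z: "norm z < 1" and w: "norm w < 1"
  shows "((\<lambda>t. poisson z (zeta t) * poisson w (zeta t)) has_integral
      (1 - (cmod z)\<^sup>2 * (cmod w)\<^sup>2) / (cmod (1 - cnj w * z))\<^sup>2) {0..1}"
proof -
  define f where "f u = (1 + cnj w * u) / (1 - cnj w * u)" for u
  have re: "Re (f u) = (1 - (cmod w)\<^sup>2 * (cmod u)\<^sup>2) / (cmod (1 - cnj w * u))\<^sup>2" for u
  proof -
    have "Re ((1 + a) / (1 - a)) = (1 - (cmod a)\<^sup>2) / (cmod (1 - a))\<^sup>2" for a
      unfolding Re_divide cmod_power2 by (simp add: algebra_simps power2_eq_square)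
    then show ?thesis by (simp add: f_def norm_mult power_mult_distrib)
  qed
  have "f holomorphic_on cball 0 1"
    unfolding f_def by (intro holomorphic_intros) (use one_minus_mult_neq_0[OF w] in auto)
  from has_integral_Re[OF poisson_representation[OF this z]]
  have I: "((\<lambda>t. Re (f (zeta t)) * poisson z (zeta t)) has_integral Re (f z)) {0..1}" by simp
  have fw: "Re (f (zeta t)) = poisson w (zeta t)" for t
  proof -
    have uu: "zeta t * cnj (zeta t) = 1" by (simp flip: complex_norm_square)
    have "1 - cnj w * zeta t = zeta t * cnj (zeta t - w)" by (simp add: algebra_simps uu)
    then have "cmod (1 - cnj w * zeta t) = cmod (zeta t - w)"
      by (metis complex_mod_cnj mult_1 norm_mult norm_zeta)
    then show ?thesis by (simp add: re poisson_def)
  qed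
  have fz: "Re (f z) = (1 - (cmod z)\<^sup>2 * (cmod w)\<^sup>2) / (cmod (1 - cnj w * z))\<^sup>2"
    by (simp add: re mult.commute)
  show ?thesis using I unfolding fw fz by (simp only: mult.commute)
qed

text \<open>The pairing of two Poisson kernels is dominated by the kernel of the point
  \<open>z\<close> further from the circle, evaluated at any boundary point whose cone contains
  \<open>w\<close>. Replacing \<open>w\<close> by \<open>zeta t\<close> moves it by at most
  \<open>A * (1 - |w|)\<close>, which the denominator \<open>|1 - cnj w * z|\<close>
  absorbs.\<close>

lemma poisson_convolution_le:
  assumes z: "norm z < 1" and w: "norm w < 1" and le: "norm z \<le> norm w"
    and t: "norm (zeta t - w) \<le> A * (1 - norm w)" and A: "1 \<le> A"
  shows "(1 - (cmod z)\<^sup>2 * (cmod w)\<^sup>2) / (cmod (1 - cnj w * z))\<^sup>2 \<le> 2 * (A + 3)\<^sup>2 * poisson z (zeta t)"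
proof -
  let ?D = "cmod (1 - cnj w * z)"
  have D: "1 - cmod w \<le> ?D"
  proof -
    have "cmod w * cmod z \<le> cmod w * 1" by (rule mult_left_mono) (use z in auto)
    then show ?thesis using norm_triangle_ineq2[of 1 "cnj w * z"] by (simp add: norm_mult)
  qed
  then have Dpos: "?D > 0" using w by linarith
  have "w - z = w * (1 - cnj w * z) - (1 - (cmod w)\<^sup>2) *\<^sub>R z"
  proof -
    have "complex_of_real (1 - (cmod w)\<^sup>2) = 1 - w * cnj w"
      by (simp only: of_real_diff of_real_1 complex_norm_square)
    then show ?thesis by (simp only: scaleR_conv_of_real) (simp add: algebra_simps)
  qed
  then have "cmod (w - z) \<le> cmod w * ?D + \<bar>1 - (cmod w)\<^sup>2\<bar> * cmod z"
    by (metis norm_mult norm_scaleR norm_triangle_ineq4)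
  also have "\<dots> \<le> 1 * ?D + (2 * ?D) * 1"
  proof (intro add_mono mult_mono)
    have "1 - (cmod w)\<^sup>2 = (1 + cmod w) * (1 - cmod w)" by (simp add: power2_eq_square algebra_simps)
    also have "\<dots> \<le> 2 * ?D" by (rule mult_mono) (use w D in auto)
    finally show "\<bar>1 - (cmod w)\<^sup>2\<bar> \<le> 2 * ?D" using w by (simp add: power_le_one)
  qed (use w z in auto)
  finally have 1: "cmod (w - z) \<le> 3 * ?D" by simp
  have "cmod (zeta t - z) \<le> cmod (zeta t - w) + cmod (w - z)"
    using norm_triangle_ineq[of "zeta t - w" "w - z"] by simp
  also have "\<dots> \<le> A * ?D + 3 * ?D"
    using t 1 mult_left_mono[OF D, of A] A by linarith
  finally have 2: "cmod (zeta t - z) \<le> (A + 3) * ?D" by (simp add: algebra_simps)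
  have tz: "cmod (zeta t - z) > 0" using norm_zeta[of t] z by auto
  have zz: "(cmod z)\<^sup>2 \<le> (cmod w)\<^sup>2" using le by (rule power_mono) simp
  have z1: "0 \<le> 1 - (cmod z)\<^sup>2" using z by (simp add: power_le_one)
  have w1: "(cmod w)\<^sup>2 \<le> 1" using w by (simp add: power_le_one)
  have num: "1 - (cmod z)\<^sup>2 * (cmod w)\<^sup>2 \<le> 2 * (1 - (cmod z)\<^sup>2)"
  proof -
    have "(1 - (cmod z)\<^sup>2) * (cmod z)\<^sup>2 \<le> (1 - (cmod z)\<^sup>2) * 1"
      by (rule mult_left_mono[OF _ z1]) (use z in \<open>simp add: power_le_one\<close>)
    moreover have "(cmod z)\<^sup>2 * (cmod z)\<^sup>2 \<le> (cmod z)\<^sup>2 * (cmod w)\<^sup>2"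
      by (rule mult_left_mono[OF zz]) simp
    ultimately show ?thesis by (simp add: algebra_simps)
  qed
  have "(1 - (cmod z)\<^sup>2 * (cmod w)\<^sup>2) / ?D\<^sup>2 \<le> 2 * (1 - (cmod z)\<^sup>2) / ?D\<^sup>2"
    by (rule divide_right_mono[OF num]) simp
  also have "\<dots> \<le> 2 * (1 - (cmod z)\<^sup>2) * ((A + 3)\<^sup>2 / (cmod (zeta t - z))\<^sup>2)"
  proof -
    have "(cmod (zeta t - z))\<^sup>2 \<le> ((A + 3) * ?D)\<^sup>2" by (rule power_mono[OF 2]) simp
    moreover have "Y \<le> X * E \<Longrightarrow> 0 < Y \<Longrightarrow> 0 < E \<Longrightarrow> 1 / E \<le> X / Y" for X Y E :: real
      by (simp add: field_simps)
    ultimately have "1 / ?D\<^sup>2 \<le> (A + 3)\<^sup>2 / (cmod (zeta t - z))\<^sup>2"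
      using tz Dpos unfolding power_mult_distrib by (meson zero_less_power)
    from mult_left_mono[OF this, of "2 * (1 - (cmod z)\<^sup>2)"] z1 show ?thesis by simp
  qed
  finally show ?thesis unfolding poisson_def times_divide_eq_right by (simp only: mult_ac)
qed

section \<open>The discretised nontangential maximal operator in the square mean\<close>

lemma integral_split_uniform:
  fixes f :: "real \<Rightarrow> real"
  assumes f: "continuous_on {0..1} f" and N: "0 < N"
  shows "integral {0..1} f = (\<Sum>j<N. integral {real j / N..(real j + 1) / N} f)"
proof -
  have "integral {0..real m / N} f = (\<Sum>j<m. integral {real j / N..(real j + 1) / N} f)" if "m \<le> N" for m
    using that
  proof (induction m)
    case (Suc m)
    have "f integrable_on {0..real (Suc m) / N}"
      by (rule integrable_continuous_real, rule continuous_on_subset[OF f]) (use Suc.prems N in auto)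
    then have "integral {0..real m / N} f + integral {real m / N..real (Suc m) / N} f = integral {0..real (Suc m) / N} f"
      by (intro Henstock_Kurzweil_Integration.integral_combine) (auto intro!: divide_right_mono)
    then show ?case using Suc by (simp add: add.commute)
  qed simp
  from this[of N] show ?thesis using N by simp
qed

text \<open>The adjoint of the linearised maximal operator is \<open>g \<mapsto> S\<close>; the kernel of \<open>T T*\<close>
  is dominated by that of \<open>T + T*\<close>, which bounds \<open>S\<close> in \<open>L\<^sup>2\<close> without any covering argument.\<close>

lemma L2_maximal_adjoint:
  assumes N: "0 < N" and z: "\<And>i. i < N \<Longrightarrow> norm (z i) < 1" and A: "1 \<le> A" and g: "\<And>i. 0 \<le> g i"
    and cone: "\<And>i t. i < N \<Longrightarrow> t \<in> {real i / N..(real i + 1) / N} \<Longrightarrow>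
      norm (zeta t - z i) \<le> A * (1 - norm (z i))"
    and S: "\<And>t. S t = (\<Sum>i<N. g i * poisson (z i) (zeta t)) / N"
  shows "integral {0..1} (\<lambda>t. (S t)\<^sup>2) \<le> 16 * (A + 3) ^ 4 * ((\<Sum>i<N. (g i)\<^sup>2) / N)"
proof -
  define C where "C = 2 * (A + 3)\<^sup>2"
  define J where "J j = {real j / N..(real j + 1) / N}" for j
  define P where "P i t = poisson (z i) (zeta t)" for i t
  define M where "M i j = integral {0..1} (\<lambda>t. P i t * P j t)" for i j
  have C0: "0 \<le> C" by (simp add: C_def)
  have JI: "J j \<subseteq> {0..1}" if "j < N" for j
    using that N by (auto simp: J_def field_simps)
  have contP: "continuous_on T (P i)" if "i < N" for T i
    unfolding P_def[abs_def] by (rule continuous_on_poisson) (rule z[OF that])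
  have S': "S t = (\<Sum>i<N. g i * P i t) / N" for t unfolding S P_def ..
  have contS: "continuous_on T S" for T
    unfolding S'[abs_def] by (intro continuous_intros contP) (use N in auto)
  have Jlen: "integral (J j) (\<lambda>t. c) = c / N" for j c
  proof -
    have "real j / N \<le> (real j + 1) / N" by (rule divide_right_mono) auto
    moreover have "(real j + 1) / N - real j / N = 1 / N" by (simp add: diff_divide_distrib[symmetric])
    ultimately show ?thesis by (simp add: J_def)
  qed
  \<comment> \<open>Averaging the kernel bound over the arc of \<open>j\<close> turns the entry
    \<open>M i j\<close> into an integral of \<open>P i\<close> over that arc, an entry of the
    linearised operator itself.\<close>
  have Mle: "M i j / N \<le> C * integral (J j) (P i)" if "i < N" "j < N" "norm (z i) \<le> norm (z j)" for i j
  proof -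
    have "M i j / N = integral (J j) (\<lambda>t. M i j)" by (simp add: Jlen)
    also have "\<dots> \<le> integral (J j) (\<lambda>t. C * P i t)"
    proof (rule integral_le)
      show "(\<lambda>t. C * P i t) integrable_on J j"
        unfolding J_def by (intro integrable_continuous_real continuous_intros contP that)
      show "(\<lambda>t. M i j) integrable_on J j" unfolding J_def by (rule integrable_const_ivl)
      fix t assume "t \<in> J j"
      then show "M i j \<le> C * P i t"
        unfolding M_def C_def P_def integral_unique[OF poisson_convolution[OF z[OF that(1)] z[OF that(2)]]]
        by (intro poisson_convolution_le z cone that A) (simp add: J_def)
    qed
    also have "\<dots> = C * integral (J j) (P i)" by simp
    finally show ?thesis .
  qed
  have Pint0: "0 \<le> integral (J j) (P i)" if "i < N" for i j
    using that by (intro integral_nonneg) (auto simp: J_def P_def poisson_nonneg z intro!: integrable_continuous_real continuous_intros)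
  have Mle2: "M i j / N \<le> C * integral (J j) (P i) + C * integral (J i) (P j)" if "i < N" "j < N" for i j
  proof (cases "norm (z i) \<le> norm (z j)")
    case True
    then show ?thesis using Mle[OF that] mult_nonneg_nonneg[OF C0 Pint0[OF that(2)]] by (smt (verit))
  next
    case False
    then have "M j i / N \<le> C * integral (J i) (P j)" using Mle that by simp
    moreover have "M j i = M i j" by (simp add: M_def mult.commute)
    ultimately show ?thesis using mult_nonneg_nonneg[OF C0 Pint0[OF that(1)]] by (smt (verit))
  qed
  have intS: "integral (J j) S = (\<Sum>i<N. g i * integral (J j) (P i)) / N" for j
  proof -
    have "integral (J j) S = integral (J j) (\<lambda>t. \<Sum>i<N. g i * P i t) / N"
      unfolding S'[abs_def] by (simp add: divide_inverse)
    also have "integral (J j) (\<lambda>t. \<Sum>i<N. g i * P i t) = (\<Sum>i<N. integral (J j) (\<lambda>t. g i * P i t))"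
      by (rule integral_sum) (auto simp: J_def intro!: integrable_continuous_real continuous_intros contP)
    finally show ?thesis by simp
  qed
  have "integral {0..1} (\<lambda>t. (S t)\<^sup>2) = integral {0..1} (\<lambda>t. \<Sum>i<N. \<Sum>j<N. g i * g j / (real N)\<^sup>2 * (P i t * P j t))"
    by (simp add: S' power2_eq_square sum_product sum_divide_distrib mult_ac)
  also have "\<dots> = (\<Sum>i<N. integral {0..1} (\<lambda>t. \<Sum>j<N. g i * g j / (real N)\<^sup>2 * (P i t * P j t)))"
    by (rule integral_sum) (auto intro!: integrable_continuous_real continuous_intros contP)
  also have "\<dots> = (\<Sum>i<N. \<Sum>j<N. integral {0..1} (\<lambda>t. g i * g j / (real N)\<^sup>2 * (P i t * P j t)))"
    by (intro sum.cong refl integral_sum) (auto intro!: integrable_continuous_real continuous_intros contP)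
  also have "\<dots> = (\<Sum>i<N. \<Sum>j<N. g i * g j / (real N)\<^sup>2 * M i j)"
    by (simp add: M_def)
  also have "\<dots> = (\<Sum>i<N. \<Sum>j<N. (g i * g j / N) * (M i j / N))"
    by (simp add: power2_eq_square)
  also have "\<dots> \<le> (\<Sum>i<N. \<Sum>j<N. (g i * g j / N) * (C * integral (J j) (P i) + C * integral (J i) (P j)))"
    by (intro sum_mono mult_left_mono Mle2) (auto simp: g)
  also have "\<dots> = (\<Sum>i<N. \<Sum>j<N. C * (g j * (g i * integral (J j) (P i) / N)))
      + (\<Sum>i<N. \<Sum>j<N. C * (g i * (g j * integral (J i) (P j) / N)))"
    by (simp add: sum.distrib distrib_left mult_ac)
  also have "(\<Sum>i<N. \<Sum>j<N. C * (g j * (g i * integral (J j) (P i) / N)))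
      = (\<Sum>i<N. \<Sum>j<N. C * (g i * (g j * integral (J i) (P j) / N)))"
    by (rule sum.swap)
  also have "(\<Sum>i<N. \<Sum>j<N. C * (g i * (g j * integral (J i) (P j) / N))) = (\<Sum>i<N. C * (g i * integral (J i) S))"
    by (simp add: intS sum_distrib_left sum_divide_distrib)
  also have "(\<Sum>i<N. C * (g i * integral (J i) S)) + (\<Sum>i<N. C * (g i * integral (J i) S))
      = (\<Sum>i<N. integral (J i) (\<lambda>t. 2 * C * g i * S t))"
    by (simp add: sum.distrib[symmetric] mult_ac)
  \<comment> \<open>Arithmetic-geometric mean, weighted so that half of the integral of
    \<open>S\<^sup>2\<close> can be absorbed in the left-hand side; that integral is finite because
    \<open>S\<close> is continuous.\<close>
  also have "\<dots> \<le> (\<Sum>i<N. integral (J i) (\<lambda>t. 1 / 2 * (S t)\<^sup>2 + 2 * C\<^sup>2 * (g i)\<^sup>2))"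
  proof (rule sum_mono, rule integral_le)
    fix i t
    have "0 \<le> (S t - 2 * C * g i)\<^sup>2" by simp
    then show "2 * C * g i * S t \<le> 1 / 2 * (S t)\<^sup>2 + 2 * C\<^sup>2 * (g i)\<^sup>2"
      by (simp add: power2_eq_square algebra_simps)
  qed (auto simp: J_def intro!: integrable_continuous_real continuous_intros contS)
  also have "\<dots> = (\<Sum>i<N. 1 / 2 * integral (J i) (\<lambda>t. (S t)\<^sup>2) + 2 * C\<^sup>2 * (g i)\<^sup>2 / N)"
  proof (rule sum.cong[OF refl])
    fix i
    have "integral (J i) (\<lambda>t. 1 / 2 * (S t)\<^sup>2 + 2 * C\<^sup>2 * (g i)\<^sup>2)
      = integral (J i) (\<lambda>t. 1 / 2 * (S t)\<^sup>2) + integral (J i) (\<lambda>t. 2 * C\<^sup>2 * (g i)\<^sup>2)"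
      by (rule integral_add) (auto simp: J_def intro!: integrable_continuous_real continuous_intros contS)
    then show "integral (J i) (\<lambda>t. 1 / 2 * (S t)\<^sup>2 + 2 * C\<^sup>2 * (g i)\<^sup>2)
      = 1 / 2 * integral (J i) (\<lambda>t. (S t)\<^sup>2) + 2 * C\<^sup>2 * (g i)\<^sup>2 / N"
      unfolding Jlen by simp
  qed
  also have "\<dots> = 1 / 2 * (\<Sum>i<N. integral (J i) (\<lambda>t. (S t)\<^sup>2)) + 2 * C\<^sup>2 * ((\<Sum>i<N. (g i)\<^sup>2) / N)"
    by (simp add: sum.distrib sum_distrib_left sum_divide_distrib)
  also have "(\<Sum>i<N. integral (J i) (\<lambda>t. (S t)\<^sup>2)) = integral {0..1} (\<lambda>t. (S t)\<^sup>2)"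
    unfolding J_def by (rule integral_split_uniform[symmetric]) (auto intro!: continuous_intros contS N)
  finally show ?thesis by (simp add: C_def power_mult_distrib flip: power_mult)
qed

text \<open>Duality with the values themselves as coefficients: for
  \<open>g i = cmod (f (z i))\<close> the mean of the squares is at most the integral of
  \<open>|f| * S\<close>. The weight \<open>B\<close> in the arithmetic-geometric mean is the one
  for which the adjoint bound returns exactly half of that mean.\<close>

lemma L2_maximal:
  assumes f: "f holomorphic_on cball 0 1"
    and N: "0 < N" and z: "\<And>i. i < N \<Longrightarrow> norm (z i) < 1" and A: "1 \<le> A"
    and cone: "\<And>i t. i < N \<Longrightarrow> t \<in> {real i / N..(real i + 1) / N} \<Longrightarrow>
      norm (zeta t - z i) \<le> A * (1 - norm (z i))"
  shows "(\<Sum>i<N. (cmod (f (z i)))\<^sup>2) / N \<le> 16 * (A + 3) ^ 4 * integral {0..1} (\<lambda>t. (cmod (f (zeta t)))\<^sup>2)"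
proof -
  define B where "B = 16 * (A + 3) ^ 4"
  have B: "B > 0" using A by (simp add: B_def)
  define g where "g i = cmod (f (z i))" for i
  define S where "S t = (\<Sum>i<N. g i * poisson (z i) (zeta t)) / N" for t
  have contf: "continuous_on T (\<lambda>t. f (zeta t))" for T
    by (rule continuous_on_compose2[OF holomorphic_on_imp_continuous_on[OF f] continuous_on_zeta]) auto
  have contS: "continuous_on T S" for T
    unfolding S_def[abs_def] by (intro continuous_intros z) (use N in auto)
  have gle: "g i \<le> integral {0..1} (\<lambda>t. cmod (f (zeta t)) * poisson (z i) (zeta t))" if "i < N" for i
  proof -
    note I = poisson_representation[OF f z[OF that]]
    have "cmod (integral {0..1} (\<lambda>t. f (zeta t) * of_real (poisson (z i) (zeta t))))
        \<le> integral {0..1} (\<lambda>t. cmod (f (zeta t)) * poisson (z i) (zeta t))"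
    proof (rule integral_norm_bound_integral)
      show "(\<lambda>t. cmod (f (zeta t)) * poisson (z i) (zeta t)) integrable_on {0..1}"
        by (intro integrable_continuous_real continuous_intros contf z that)
    qed (use I poisson_nonneg[OF z[OF that]] in \<open>auto simp: norm_mult\<close>)
    then show ?thesis using integral_unique[OF I] by (simp add: g_def)
  qed
  have "(\<Sum>i<N. (g i)\<^sup>2) / N \<le> (\<Sum>i<N. g i * integral {0..1} (\<lambda>t. cmod (f (zeta t)) * poisson (z i) (zeta t))) / N"
    unfolding power2_eq_square
    by (intro divide_right_mono sum_mono mult_left_mono gle) (auto simp: g_def)
  also have "\<dots> = (\<Sum>i<N. integral {0..1} (\<lambda>t. g i * (cmod (f (zeta t)) * poisson (z i) (zeta t)) / N))"
    by (simp add: sum_divide_distrib)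
  also have "\<dots> = integral {0..1} (\<lambda>t. \<Sum>i<N. g i * (cmod (f (zeta t)) * poisson (z i) (zeta t)) / N)"
    by (rule integral_sum[symmetric])
       (use N in \<open>auto intro!: integrable_continuous_real continuous_intros contf z\<close>)
  also have "\<dots> = integral {0..1} (\<lambda>t. cmod (f (zeta t)) * S t)"
    by (simp add: S_def sum_distrib_left sum_divide_distrib mult_ac)
  also have "\<dots> \<le> integral {0..1} (\<lambda>t. B / 2 * (cmod (f (zeta t)))\<^sup>2 + 1 / (2 * B) * (S t)\<^sup>2)"
  proof (rule integral_le)
    fix t
    have "0 \<le> (B * cmod (f (zeta t)) - S t)\<^sup>2 / (2 * B)" using B by simp
    also have "\<dots> = B / 2 * (cmod (f (zeta t)))\<^sup>2 + 1 / (2 * B) * (S t)\<^sup>2 - cmod (f (zeta t)) * S t"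
      using B by (simp add: power2_eq_square field_simps)
    finally show "cmod (f (zeta t)) * S t \<le> B / 2 * (cmod (f (zeta t)))\<^sup>2 + 1 / (2 * B) * (S t)\<^sup>2" by simp
  qed (use B in \<open>auto intro!: integrable_continuous_real continuous_intros contf contS\<close>)
  also have "\<dots> = integral {0..1} (\<lambda>t. B / 2 * (cmod (f (zeta t)))\<^sup>2) + integral {0..1} (\<lambda>t. 1 / (2 * B) * (S t)\<^sup>2)"
    by (rule integral_add) (use B in \<open>auto intro!: integrable_continuous_real continuous_intros contf contS\<close>)
  also have "\<dots> = B / 2 * integral {0..1} (\<lambda>t. (cmod (f (zeta t)))\<^sup>2) + 1 / (2 * B) * integral {0..1} (\<lambda>t. (S t)\<^sup>2)"
    by simp
  also have "\<dots> \<le> B / 2 * integral {0..1} (\<lambda>t. (cmod (f (zeta t)))\<^sup>2) + 1 / (2 * B) * (B * ((\<Sum>i<N. (g i)\<^sup>2) / N))"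
    unfolding B_def using A
    by (intro add_left_mono mult_left_mono L2_maximal_adjoint[OF N z A _ cone S_def]) (auto simp: g_def)
  finally show ?thesis using B by (simp add: g_def B_def[symmetric])
qed

section \<open>A discrete Carleson embedding\<close>

lemma young_powr:
  fixes x y a b :: real
  assumes "0 \<le> x" "0 \<le> y" "0 \<le> a" "0 \<le> b" "a + b = 1"
  shows "x powr a * y powr b \<le> a * x + b * y"
proof (cases "x = 0 \<or> y = 0")
  case True
  then show ?thesis using assms by auto
next
  case False
  then show ?thesis using assms by (intro Youngs_inequality_0) auto
qed

text \<open>The graph of \<open>t powr r\<close> lies above its tangent at \<open>x\<close>.
  Deriving this from Young's inequality covers \<open>x = 0\<close> and \<open>y = 0\<close>
  uniformly.\<close>

lemma powr_tangent:
  fixes x y r :: real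
  assumes "0 \<le> x" "0 \<le> y" "1 \<le> r"
  shows "x powr r - y powr r \<le> r * x powr (r - 1) * (x - y)"
proof -
  have "(x powr r) powr ((r - 1) / r) * (y powr r) powr (1 / r) \<le> (r - 1) / r * x powr r + 1 / r * y powr r"
    by (rule young_powr) (use assms in \<open>auto simp: field_simps\<close>)
  moreover have "(x powr r) powr ((r - 1) / r) = x powr (r - 1)" "(y powr r) powr (1 / r) = y"
    using assms by (simp_all add: powr_powr)
  ultimately have "x powr (r - 1) * y \<le> (r - 1) / r * x powr r + 1 / r * y powr r" by simp
  then have "r * (x powr (r - 1) * y) \<le> r * ((r - 1) / r * x powr r + 1 / r * y powr r)"
    using assms by (intro mult_left_mono) auto
  then have "r * (x powr (r - 1) * y) \<le> (r - 1) * x powr r + y powr r"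
    using assms by (simp add: distrib_left)
  moreover have "x powr (r - 1) * x = x powr r"
    using assms powr_mult_base[of x "r - 1"] by (simp add: mult.commute)
  ultimately show ?thesis by (simp add: algebra_simps)
qed

text \<open>A dyadic tree of finite depth: \<open>L\<close> is the set of leaves,
  \<open>\<kappa> j i\<close> names the ancestor of leaf \<open>i\<close> in generation
  \<open>j\<close>, and counting leaves replaces Lebesgue measure. \<open>carleson\<close> is the
  packing condition: over a node of generation \<open>j\<close>, the weights of generations
  \<open>j\<close> to \<open>n - 1\<close> integrate to at most \<open>K\<close> times the measure
  of the node.\<close>

locale carleson_filtration =
  fixes L :: "'l set" and \<kappa> :: "nat \<Rightarrow> 'l \<Rightarrow> 'b" and n :: nat
    and \<alpha> :: "nat \<Rightarrow> 'l \<Rightarrow> real" and K :: real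
  assumes finite_L: "finite L"
    and refine: "\<And>j i i'. \<kappa> (Suc j) i = \<kappa> (Suc j) i' \<Longrightarrow> \<kappa> j i = \<kappa> j i'"
    and \<alpha>_nonneg: "\<And>j i. 0 \<le> \<alpha> j i"
    and \<alpha>_adapted: "\<And>j i i'. \<kappa> j i = \<kappa> j i' \<Longrightarrow> \<alpha> j i = \<alpha> j i'"
    and K_nonneg: "0 \<le> K"
    and carleson: "\<And>j b. j < n \<Longrightarrow>
      (\<Sum>i | i \<in> L \<and> \<kappa> j i = b. \<Sum>m\<in>{j..<n}. \<alpha> m i) \<le> K * card {i \<in> L. \<kappa> j i = b}"
begin

definition adapted :: "(nat \<Rightarrow> 'l \<Rightarrow> real) \<Rightarrow> bool" where
  "adapted W \<longleftrightarrow> (\<forall>j i i'. \<kappa> j i = \<kappa> j i' \<longrightarrow> W j i = W j i')"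

lemma adaptedD: "adapted W \<Longrightarrow> \<kappa> j i = \<kappa> j i' \<Longrightarrow> W j i = W j i'"
  unfolding adapted_def by blast

lemma \<kappa>_mono: "k \<le> j \<Longrightarrow> \<kappa> j i = \<kappa> j i' \<Longrightarrow> \<kappa> k i = \<kappa> k i'"
proof (induction j)
  case (Suc j)
  then show ?case using refine[of j i i'] by (cases "k = Suc j") simp_all
qed simp

lemma weighted_carleson:
  assumes j: "j < n" and w: "\<And>i i'. \<kappa> j i = \<kappa> j i' \<Longrightarrow> w i = w i'" and w0: "\<And>i. 0 \<le> w i"
  shows "(\<Sum>i\<in>L. w i * (\<Sum>m\<in>{j..<n}. \<alpha> m i)) \<le> K * (\<Sum>i\<in>L. w i)"
proof -
  have grp: "(\<Sum>i\<in>L. h i) = (\<Sum>b\<in>\<kappa> j ` L. \<Sum>i | i \<in> L \<and> \<kappa> j i = b. h i)" for h :: "'l \<Rightarrow> real"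
    by (rule sum.group[symmetric]) (use finite_L in auto)
  have "(\<Sum>i | i \<in> L \<and> \<kappa> j i = b. w i * (\<Sum>m\<in>{j..<n}. \<alpha> m i)) \<le> K * (\<Sum>i | i \<in> L \<and> \<kappa> j i = b. w i)"
    if "b \<in> \<kappa> j ` L" for b
  proof -
    from that obtain i0 where i0: "i0 \<in> L" "b = \<kappa> j i0" by auto
    have eq: "w i = w i0" if "\<kappa> j i = b" for i by (rule w) (use that i0 in simp)
    have "(\<Sum>i | i \<in> L \<and> \<kappa> j i = b. w i * (\<Sum>m\<in>{j..<n}. \<alpha> m i))
        = w i0 * (\<Sum>i | i \<in> L \<and> \<kappa> j i = b. \<Sum>m\<in>{j..<n}. \<alpha> m i)"
      unfolding sum_distrib_left by (rule sum.cong) (use eq in auto)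
    also have "\<dots> \<le> w i0 * (K * card {i \<in> L. \<kappa> j i = b})"
      by (rule mult_left_mono[OF carleson[OF j] w0])
    also have "\<dots> = K * (\<Sum>i | i \<in> L \<and> \<kappa> j i = b. w i0)" by simp
    also have "(\<Sum>i | i \<in> L \<and> \<kappa> j i = b. w i0) = (\<Sum>i | i \<in> L \<and> \<kappa> j i = b. w i)"
      by (rule sum.cong) (use eq in auto)
    finally show ?thesis .
  qed
  then show ?thesis unfolding grp sum_distrib_left[of K] by (rule sum_mono)
qed

text \<open>Summation by parts over generations: an increasing \<open>W\<close> is the sum of its
  nonnegative increments \<open>D\<close>, and the increment of generation \<open>k\<close> is
  paired with the tail of the weights from \<open>k\<close> on, which is what the packing condition
  bounds.\<close>

lemma sum_increasing_adapted:
  assumes W: "adapted W" and mono: "\<And>j i. W j i \<le> W (Suc j) i" and W0: "\<And>j i. 0 \<le> W j i"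
    and n: "n = Suc l"
  shows "(\<Sum>i\<in>L. \<Sum>j<n. \<alpha> j i * W j i) \<le> K * (\<Sum>i\<in>L. W l i)"
proof -
  define D where "D j i = (case j of 0 \<Rightarrow> W 0 i | Suc k \<Rightarrow> W j i - W k i)" for j i
  have D0: "0 \<le> D j i" for j i unfolding D_def using W0 mono by (cases j) auto
  have Dad: "D j i = D j i'" if "\<kappa> j i = \<kappa> j i'" for j i i'
  proof (cases j)
    case 0
    then show ?thesis using adaptedD[OF W that] by (simp add: D_def)
  next
    case (Suc k)
    then show ?thesis using adaptedD[OF W that] adaptedD[OF W refine[of k i i']] that by (simp add: D_def)
  qed
  have Wsum: "W j i = (\<Sum>k\<le>j. D k i)" for j i
    by (induction j) (auto simp: D_def)
  have "(\<Sum>j<n. \<alpha> j i * W j i) = (\<Sum>k<n. D k i * (\<Sum>m\<in>{k..<n}. \<alpha> m i))" for i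
  proof -
    have "(\<Sum>j<n. \<alpha> j i * W j i) = (\<Sum>j<n. \<Sum>k\<le>j. D k i * \<alpha> j i)"
      unfolding Wsum by (simp add: sum_distrib_left mult.commute)
    also have "\<dots> = (\<Sum>j<n. \<Sum>k | k < n \<and> k \<le> j. D k i * \<alpha> j i)"
      by (intro sum.cong refl) auto
    also have "\<dots> = (\<Sum>k<n. \<Sum>j | j < n \<and> k \<le> j. D k i * \<alpha> j i)"
      by (subst sum.swap_restrict[of "{..<n}" "{..<n}" _ "\<lambda>j k. k \<le> j", simplified]) auto
    also have "\<dots> = (\<Sum>k<n. D k i * (\<Sum>m\<in>{k..<n}. \<alpha> m i))"
      unfolding sum_distrib_left by (intro sum.cong refl) auto
    finally show ?thesis .
  qed
  then have "(\<Sum>i\<in>L. \<Sum>j<n. \<alpha> j i * W j i) = (\<Sum>k<n. \<Sum>i\<in>L. D k i * (\<Sum>m\<in>{k..<n}. \<alpha> m i))"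
    by (simp add: sum.swap[of _ L])
  also have "\<dots> \<le> (\<Sum>k<n. K * (\<Sum>i\<in>L. D k i))"
  proof (rule sum_mono, rule weighted_carleson)
    fix k i i' assume "k \<in> {..<n}"
    then show "k < n" by simp
    show "D k i = D k i'" if "\<kappa> k i = \<kappa> k i'" by (rule Dad[OF that])
    show "0 \<le> D k i" by (rule D0)
  qed
  also have "\<dots> = K * (\<Sum>k<n. \<Sum>i\<in>L. D k i)" by (simp add: sum_distrib_left)
  also have "(\<Sum>k<n. \<Sum>i\<in>L. D k i) = (\<Sum>i\<in>L. \<Sum>k<n. D k i)" by (rule sum.swap)
  also have "\<dots> = (\<Sum>i\<in>L. W l i)" by (simp add: n lessThan_Suc_atMost flip: Wsum)
  finally show ?thesis .
qed

text \<open>The tangent inequality telescopes the power of the sum into a linear sum with the factor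
  \<open>W = c * P powr (r - 1)\<close>, again adapted and increasing, so that the linear case
  applies. Young's inequality then separates \<open>c\<close> from \<open>P\<close> and absorbs the
  term with \<open>P n\<close>.\<close>

lemma sum_powr_ge1:
  assumes c: "adapted c" and mono: "\<And>j i. c j i \<le> c (Suc j) i" and c0: "\<And>j i. 0 \<le> c j i"
    and n: "n = Suc l" and r: "1 \<le> r"
  shows "(\<Sum>i\<in>L. (\<Sum>j<n. \<alpha> j i * c j i) powr r) \<le> (r * K) powr r * (\<Sum>i\<in>L. c l i powr r)"
proof -
  define P where "P j i = (\<Sum>k<j. \<alpha> k i * c k i)" for j i
  have P0: "0 \<le> P j i" for j i unfolding P_def by (intro sum_nonneg mult_nonneg_nonneg \<alpha>_nonneg c0)
  have Pm: "P j i \<le> P (Suc j) i" for j i unfolding P_def by (simp add: \<alpha>_nonneg c0)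
  have Pad: "P (Suc j) i = P (Suc j) i'" if "\<kappa> j i = \<kappa> j i'" for j i i'
    unfolding P_def
  proof (rule sum.cong[OF refl])
    fix k assume "k \<in> {..<Suc j}"
    then have "\<kappa> k i = \<kappa> k i'" by (intro \<kappa>_mono[OF _ that]) simp
    then show "\<alpha> k i * c k i = \<alpha> k i' * c k i'" using \<alpha>_adapted[of k i i'] adaptedD[OF c, of k i i'] by simp
  qed
  \<comment> \<open>\<open>P (Suc j)\<close> and not \<open>P j\<close>: the tangent is taken at the
    larger partial sum, which still depends only on the generations up to \<open>j\<close>.\<close>
  define W where "W j i = c j i * P (Suc j) i powr (r - 1)" for j i
  have "adapted W" unfolding adapted_def
  proof (intro allI impI)
    fix j i i' assume "\<kappa> j i = \<kappa> j i'"
    then show "W j i = W j i'" unfolding W_def by (simp only: Pad[of j i i'] adaptedD[OF c, of j i i'])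
  qed
  moreover have "W j i \<le> W (Suc j) i" for j i
    unfolding W_def by (intro mult_mono mono powr_mono2 Pm P0 c0) (use r in auto)
  moreover have "0 \<le> W j i" for j i unfolding W_def by (simp add: c0)
  ultimately have *: "(\<Sum>i\<in>L. \<Sum>j<n. \<alpha> j i * W j i) \<le> K * (\<Sum>i\<in>L. W l i)"
    using sum_increasing_adapted n by blast
  have tel: "P j i powr r \<le> r * (\<Sum>k<j. \<alpha> k i * W k i)" for j i
  proof (induction j)
    case (Suc j)
    have "P (Suc j) i powr r - P j i powr r \<le> r * P (Suc j) i powr (r - 1) * (P (Suc j) i - P j i)"
      by (rule powr_tangent[OF P0 P0 r])
    also have "P (Suc j) i - P j i = \<alpha> j i * c j i" by (simp add: P_def)
    finally have "P (Suc j) i powr r - P j i powr r \<le> r * (\<alpha> j i * W j i)"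
      by (simp add: W_def mult_ac)
    with Suc.IH show ?case by (simp add: algebra_simps)
  qed (simp add: P_def)
  have "(\<Sum>i\<in>L. P n i powr r) \<le> (\<Sum>i\<in>L. r * (\<Sum>k<n. \<alpha> k i * W k i))"
    by (intro sum_mono tel)
  also have "\<dots> \<le> r * (K * (\<Sum>i\<in>L. W l i))"
    unfolding sum_distrib_left[symmetric] by (rule mult_left_mono[OF *]) (use r in simp)
  also have "\<dots> = (\<Sum>i\<in>L. (r * K * c l i) * P n i powr (r - 1))"
    unfolding W_def n sum_distrib_left by (simp add: mult_ac)
  also have "\<dots> \<le> (\<Sum>i\<in>L. (1 / r) * (r * K * c l i) powr r + ((r - 1) / r) * P n i powr r)"
  proof (rule sum_mono)
    fix i
    have "((r * K * c l i) powr r) powr (1 / r) * (P n i powr r) powr ((r - 1) / r)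
      \<le> (1 / r) * (r * K * c l i) powr r + ((r - 1) / r) * P n i powr r"
      by (rule young_powr) (use r in \<open>auto simp: field_simps\<close>)
    then show "(r * K * c l i) * P n i powr (r - 1) \<le> (1 / r) * (r * K * c l i) powr r + ((r - 1) / r) * P n i powr r"
      using r c0 K_nonneg by (simp add: powr_powr)
  qed
  also have "\<dots> = (1 / r) * ((r * K) powr r * (\<Sum>i\<in>L. c l i powr r)) + ((r - 1) / r) * (\<Sum>i\<in>L. P n i powr r)"
    using r c0 K_nonneg by (simp add: sum.distrib sum_distrib_left powr_mult)
  finally have "(1 / r) * (\<Sum>i\<in>L. P n i powr r) \<le> (1 / r) * ((r * K) powr r * (\<Sum>i\<in>L. c l i powr r))"
    using r by (simp add: field_simps)
  then show ?thesis using r by (simp add: P_def field_simps)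
qed

text \<open>For \<open>r < 1\<close> the tangent inequality is reversed. Instead \<open>c j\<close>
  is split into the powers \<open>1 - r\<close> and \<open>r\<close>, the first is enlarged to its
  value in the last generation, and the linear case is applied to the second. Young's inequality for
  \<open>W l i\<close> and \<open>S i / K\<close> plays the role of Hoelder's.\<close>

lemma sum_powr_lt1:
  assumes c: "adapted c" and mono: "\<And>j i. c j i \<le> c (Suc j) i" and c0: "\<And>j i. 0 \<le> c j i"
    and n: "n = Suc l" and r: "0 < r" "r < 1"
  shows "(\<Sum>i\<in>L. (\<Sum>j<n. \<alpha> j i * c j i) powr r) \<le> K powr r * (\<Sum>i\<in>L. c l i powr r)"
proof -
  define W where "W j i = c j i powr r" for j i
  define S where "S i = (\<Sum>j<n. \<alpha> j i * W j i)" for i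
  have "adapted W" unfolding adapted_def
  proof (intro allI impI)
    fix j i i' assume "\<kappa> j i = \<kappa> j i'"
    then show "W j i = W j i'" unfolding W_def by (simp only: adaptedD[OF c, of j i i'])
  qed
  moreover have "W j i \<le> W (Suc j) i" for j i
    unfolding W_def by (intro mono powr_mono2 c0) (use r in auto)
  moreover have W0: "0 \<le> W j i" for j i unfolding W_def by simp
  ultimately have *: "(\<Sum>i\<in>L. S i) \<le> K * (\<Sum>i\<in>L. W l i)"
    unfolding S_def using sum_increasing_adapted n by blast
  have S0: "0 \<le> S i" for i unfolding S_def by (intro sum_nonneg mult_nonneg_nonneg \<alpha>_nonneg W0)
  have cl: "c j i \<le> c l i" if "j < n" for i j
    using that n lift_Suc_mono_le[of "\<lambda>j. c j i" j l] mono by simp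
  have bd: "(\<Sum>j<n. \<alpha> j i * c j i) powr r \<le> (W l i) powr (1 - r) * S i powr r" for i
  proof -
    have "(\<Sum>j<n. \<alpha> j i * c j i) \<le> (\<Sum>j<n. c l i powr (1 - r) * (\<alpha> j i * W j i))"
    proof (rule sum_mono)
      fix j assume j: "j \<in> {..<n}"
      have "c j i = c j i powr (1 - r) * c j i powr r" using c0[of j i] by (cases "c j i = 0") (simp_all flip: powr_add)
      also have "\<dots> \<le> c l i powr (1 - r) * c j i powr r"
        by (intro mult_right_mono powr_mono2) (use r c0 cl j in auto)
      finally have "\<alpha> j i * c j i \<le> \<alpha> j i * (c l i powr (1 - r) * c j i powr r)"
        by (rule mult_left_mono[OF _ \<alpha>_nonneg])
      then show "\<alpha> j i * c j i \<le> c l i powr (1 - r) * (\<alpha> j i * W j i)" by (simp add: W_def mult_ac)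
    qed
    also have "\<dots> = c l i powr (1 - r) * S i" by (simp add: S_def sum_distrib_left)
    finally have "(\<Sum>j<n. \<alpha> j i * c j i) powr r \<le> (c l i powr (1 - r) * S i) powr r"
      by (intro powr_mono2) (use r in \<open>auto intro!: sum_nonneg mult_nonneg_nonneg \<alpha>_nonneg c0\<close>)
    then show ?thesis by (simp add: powr_mult powr_powr W_def mult.commute)
  qed
  show ?thesis
  \<comment> \<open>The Young step divides by \<open>K\<close>; for \<open>K = 0\<close> every
    \<open>S i\<close> vanishes and with it the left-hand side.\<close>
  proof (cases "K = 0")
    case True
    with * S0 have "(\<Sum>i\<in>L. S i) = 0" by (metis mult_zero_left sum_nonneg antisym)
    then have "\<And>i. i \<in> L \<Longrightarrow> S i = 0" using sum_nonneg_eq_0_iff[OF finite_L] S0 by blast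
    then have "(\<Sum>i\<in>L. (\<Sum>j<n. \<alpha> j i * c j i) powr r) \<le> (\<Sum>i\<in>L. 0)"
      using bd by (intro sum_mono) (metis mult_zero_right powr_zero_eq_one powr_0)
    then show ?thesis by (simp add: True)
  next
    case False
    with K_nonneg have K: "K > 0" by simp
    have "(\<Sum>i\<in>L. (\<Sum>j<n. \<alpha> j i * c j i) powr r) \<le> (\<Sum>i\<in>L. K powr r * ((1 - r) * W l i + r * (S i / K)))"
    proof (rule sum_mono)
      fix i
      have "(W l i) powr (1 - r) * S i powr r = K powr r * ((W l i) powr (1 - r) * (S i / K) powr r)"
        using K S0 by (simp add: powr_divide)
      also have "\<dots> \<le> K powr r * ((1 - r) * W l i + r * (S i / K))"
        by (intro mult_left_mono young_powr) (use r K S0 W0 in auto)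
      finally show "(\<Sum>j<n. \<alpha> j i * c j i) powr r \<le> K powr r * ((1 - r) * W l i + r * (S i / K))"
        using bd[of i] by linarith
    qed
    also have "\<dots> = K powr r * ((1 - r) * (\<Sum>i\<in>L. W l i) + r * ((\<Sum>i\<in>L. S i) / K))"
      by (simp add: sum_distrib_left sum.distrib sum_divide_distrib distrib_left)
    also have "\<dots> \<le> K powr r * ((1 - r) * (\<Sum>i\<in>L. W l i) + r * (\<Sum>i\<in>L. W l i))"
      using * K r by (intro mult_left_mono add_left_mono) (auto simp: field_simps)
    also have "\<dots> = K powr r * (\<Sum>i\<in>L. W l i)" by (simp add: algebra_simps)
    finally show ?thesis by (simp add: W_def)
  qed
qed

text \<open>The running maximum over generations is adapted, increasing and dominates
  \<open>c\<close>, which reduces arbitrary \<open>c\<close> to the monotone case. In the last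
  generation it is the maximal function along the branch.\<close>

lemma sum_powr_le:
  assumes c: "adapted c" and c0: "\<And>j i. 0 \<le> c j i" and n: "0 < n" and r: "0 < r"
  shows "(\<Sum>i\<in>L. (\<Sum>j<n. \<alpha> j i * c j i) powr r)
    \<le> (max 1 r * K) powr r * (\<Sum>i\<in>L. Max ((\<lambda>j. c j i) ` {..<n}) powr r)"
proof -
  define M where "M j i = Max ((\<lambda>k. c k i) ` {..j})" for j i
  obtain l where l: "n = Suc l" using n gr0_implies_Suc by blast
  have ad: "adapted M"
    unfolding adapted_def
  proof (intro allI impI)
    fix j i i' assume k: "\<kappa> j i = \<kappa> j i'"
    have "(\<lambda>k. c k i) ` {..j} = (\<lambda>k. c k i') ` {..j}"
      by (intro image_cong refl adaptedD[OF c] \<kappa>_mono[OF _ k]) simp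
    then show "M j i = M j i'" by (simp add: M_def)
  qed
  have cM: "c j i \<le> M j i" for j i unfolding M_def by (rule Max_ge) auto
  have M0: "0 \<le> M j i" for j i using c0 cM order_trans by blast
  have mono: "M j i \<le> M (Suc j) i" for j i unfolding M_def by (rule Max_mono) auto
  have le: "(\<Sum>i\<in>L. (\<Sum>j<n. \<alpha> j i * c j i) powr r) \<le> (\<Sum>i\<in>L. (\<Sum>j<n. \<alpha> j i * M j i) powr r)"
    by (intro sum_mono powr_mono2 mult_left_mono sum_nonneg mult_nonneg_nonneg \<alpha>_nonneg c0 cM)
       (use r in auto)
  also have "\<dots> \<le> (max 1 r * K) powr r * (\<Sum>i\<in>L. M l i powr r)"
    using sum_powr_ge1[OF ad mono M0 l, of r] sum_powr_lt1[OF ad mono M0 l, of r] r by (cases "1 \<le> r") auto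
  finally show ?thesis by (simp add: M_def l lessThan_Suc_atMost)
qed

end

section \<open>Area means of holomorphic functions\<close>

text \<open>Transfers integrals over the complex plane to the product of two real lines, where
  iterated integrals are available.\<close>

lemma lborel_complex: "(lborel :: complex measure) = distr lborel borel (\<lambda>p. Complex (fst p) (snd p))"
proof (rule lborel_eqI)
  have meas: "(\<lambda>p. Complex (fst p) (snd p)) \<in> borel_measurable borel"
    by (intro borel_measurable_continuous_onI continuous_intros)
  fix l u :: complex assume le: "\<And>b. b \<in> Basis \<Longrightarrow> l \<bullet> b \<le> u \<bullet> b"
  have le2: "Re l \<le> Re u" "Im l \<le> Im u" using le[of 1] le[of \<i>] by (auto simp: Basis_complex_def)
  have "(\<lambda>p. Complex (fst p) (snd p)) -` box l u = box (Re l, Im l) (Re u, Im u)"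
    by (auto simp: in_box_complex_iff mem_box Basis_prod_def)
  then have "emeasure (distr lborel borel (\<lambda>p. Complex (fst p) (snd p))) (box l u)
      = emeasure lborel (box (Re l, Im l) (Re u, Im u))"
    using meas by (subst emeasure_distr) auto
  also have "\<dots> = ennreal ((Re u - Re l) * (Im u - Im l))"
    using le2 by (subst emeasure_lborel_box) (auto simp: Basis_prod_def prod.union_disjoint inj_on_def prod.reindex)
  finally show "emeasure (distr lborel borel (\<lambda>p. Complex (fst p) (snd p))) (box l u)
      = (\<Prod>b\<in>Basis. (u - l) \<bullet> b)"
    by (simp add: Basis_complex_def complex_eq_iff)
qed simp

lemma has_real_derivative_max_square:
  "((\<lambda>t::real. (max 0 t)\<^sup>2) has_real_derivative 2 * max 0 t) (at t)"
proof -
  consider "t > 0" | "t < 0" | "t = 0" by linarith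
  then show ?thesis
  proof cases
    case 1
    have "((\<lambda>t::real. t\<^sup>2) has_real_derivative 2 * t) (at t)"
      by (auto intro!: derivative_eq_intros)
    moreover have "eventually (\<lambda>x. (max 0 x)\<^sup>2 = x\<^sup>2) (nhds t)"
      using 1 eventually_nhds_in_open[of "{0<..}" t] by (auto elim!: eventually_mono)
    ultimately show ?thesis using 1 by (subst DERIV_cong_ev[OF refl _ refl, of _ "\<lambda>t. t\<^sup>2"]) auto
  next
    case 2
    have "((\<lambda>t::real. 0) has_real_derivative 0) (at t)" by simp
    moreover have "eventually (\<lambda>x. (max 0 x)\<^sup>2 = 0) (nhds t)"
      using 2 eventually_nhds_in_open[of "{..<0}" t] by (auto elim!: eventually_mono)
    ultimately show ?thesis using 2 by (subst DERIV_cong_ev[OF refl _ refl, of _ "\<lambda>t. 0"]) auto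
  next
    case 3
    have "((\<lambda>h. max 0 h * (max 0 h / h)) \<longlongrightarrow> 0) (at (0::real))"
    proof (rule tendsto_rabs_zero_cancel, rule tendsto_sandwich[OF _ _ tendsto_const tendsto_rabs_zero[OF tendsto_ident_at]])
      show "eventually (\<lambda>h::real. \<bar>max 0 h * (max 0 h / h)\<bar> \<le> \<bar>h\<bar>) (at 0)"
        by (rule always_eventually) (auto simp: max_def)
    qed auto
    then show ?thesis using 3 by (simp add: DERIV_def power2_eq_square)
  qed
qed


text \<open>Apply the Cauchy-Riemann operator to \<open>k (\<rho>\<^sup>2 - |w|\<^sup>2)\<^sub>+\<^sup>2\<close> for \<open>k = (h - h 0) / w\<close>: its integral
  vanishes, and the Cauchy-Riemann derivative of the cut-off is \<open>-2 w (\<rho>\<^sup>2 - |w|\<^sup>2)\<^sub>+\<close>.\<close>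

lemma weighted_area_mean:
  fixes h :: "complex \<Rightarrow> complex"
  assumes h: "h holomorphic_on ball 0 \<delta>" and \<rho>: "0 < \<rho>" "2 * \<rho> \<le> \<delta>"
  defines "om \<equiv> \<lambda>p :: real \<times> real. max 0 (\<rho>\<^sup>2 - (fst p)\<^sup>2 - (snd p)\<^sup>2)"
  shows "integral (cbox (-\<rho>, -\<rho>) (\<rho>, \<rho>)) (\<lambda>p. (h (Complex (fst p) (snd p)) - h 0) * of_real (om p)) = 0"
proof -
  let ?Q = "cbox (-\<rho>, -\<rho>) (\<rho>, \<rho>) :: (real \<times> real) set"
  define k where "k w = (if w = 0 then deriv h 0 else (h w - h 0) / (w - 0))" for w
  have kh: "k holomorphic_on ball 0 \<delta>"
    unfolding k_def[abs_def] by (rule pole_lemma[OF h]) (use \<rho> in auto)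
  have dk: "deriv k holomorphic_on ball 0 \<delta>" by (rule holomorphic_deriv[OF kh open_ball])
  have inb: "Complex x y \<in> ball 0 \<delta>" if "x \<in> {-\<rho>..\<rho>}" "y \<in> {-\<rho>..\<rho>}" for x y
  proof -
    have "x\<^sup>2 \<le> \<rho>\<^sup>2" "y\<^sup>2 \<le> \<rho>\<^sup>2" using that by (auto intro!: abs_le_square_iff[THEN iffD1])
    then have "x\<^sup>2 + y\<^sup>2 < (2 * \<rho>)\<^sup>2" using \<rho> by (simp add: power2_eq_square) (smt (verit) mult_pos_pos)
    then have "cmod (Complex x y) < 2 * \<rho>"
      using \<rho> by (simp add: cmod_def real_less_lsqrt)
    then show ?thesis using \<rho> by simp
  qed
  have contC: "continuous_on ?Q (\<lambda>p. F (Complex (fst p) (snd p)))" if "F holomorphic_on ball 0 \<delta>" for F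
    by (rule continuous_on_compose2[OF holomorphic_on_imp_continuous_on[OF that]])
       (auto intro!: continuous_intros inb simp: cbox_Pair_eq)
  have contom: "continuous_on T om" for T unfolding om_def by (intro continuous_intros)
  \<comment> \<open>\<open>u\<close> and \<open>v\<close> are the partial derivatives of
    \<open>k * om\<^sup>2\<close>. Each integrates to zero along its own direction, since
    \<open>om\<close> vanishes on the boundary of the square.\<close>
  define u where "u p = deriv k (Complex (fst p) (snd p)) * of_real ((om p)\<^sup>2)
      + k (Complex (fst p) (snd p)) * of_real (2 * om p * (- 2 * fst p))" for p
  define v where "v p = \<i> * deriv k (Complex (fst p) (snd p)) * of_real ((om p)\<^sup>2)
      + k (Complex (fst p) (snd p)) * of_real (2 * om p * (- 2 * snd p))" for p
  have contu: "continuous_on ?Q u" and contv: "continuous_on ?Q v"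
    unfolding u_def v_def by (intro continuous_intros contC kh dk contom)+
  have Du: "((\<lambda>x. u (x, y)) has_integral 0) {-\<rho>..\<rho>}" if y: "y \<in> {-\<rho>..\<rho>}" for y
  proof -
    have "((\<lambda>x. u (x, y)) has_integral
        (k (Complex \<rho> y) * of_real ((om (\<rho>, y))\<^sup>2) - k (Complex (-\<rho>) y) * of_real ((om (-\<rho>, y))\<^sup>2))) {-\<rho>..\<rho>}"
    proof (rule fundamental_theorem_of_calculus)
      fix x assume x: "x \<in> {-\<rho>..\<rho>}"
      have 1: "((\<lambda>x. Complex x y) has_vector_derivative 1) (at x within {-\<rho>..\<rho>})"
        unfolding Complex_eq by (auto intro!: derivative_eq_intros simp: has_vector_derivative_of_real)
      have 2: "(k has_field_derivative deriv k (Complex x y)) (at (Complex x y))"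
        by (rule holomorphic_derivI[OF kh open_ball inb[OF x y]])
      have 3: "((\<lambda>x. k (Complex x y)) has_vector_derivative deriv k (Complex x y)) (at x within {-\<rho>..\<rho>})"
        using field_vector_diff_chain_within[OF 1 has_field_derivative_at_within[OF 2]] by (simp add: o_def)
      have "((\<lambda>x. (om (x, y))\<^sup>2) has_real_derivative 2 * om (x, y) * (- 2 * x)) (at x within {-\<rho>..\<rho>})"
        unfolding om_def fst_conv snd_conv
        by (rule DERIV_chain2[OF has_real_derivative_max_square]) (auto intro!: derivative_eq_intros)
      then have 4: "((\<lambda>x. complex_of_real ((om (x, y))\<^sup>2)) has_vector_derivative of_real (2 * om (x, y) * (- 2 * x)))
          (at x within {-\<rho>..\<rho>})"
        by (intro has_vector_derivative_of_real) (simp add: has_real_derivative_iff_has_vector_derivative)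
      show "((\<lambda>x. k (Complex x y) * of_real ((om (x, y))\<^sup>2)) has_vector_derivative u (x, y)) (at x within {-\<rho>..\<rho>})"
        using has_vector_derivative_mult[OF 3 4] by (simp add: u_def add.commute)
    qed (use \<rho> in auto)
    then show ?thesis by (simp add: om_def)
  qed
  have Dv: "((\<lambda>y. v (x, y)) has_integral 0) {-\<rho>..\<rho>}" if x: "x \<in> {-\<rho>..\<rho>}" for x
  proof -
    have "((\<lambda>y. v (x, y)) has_integral
        (k (Complex x \<rho>) * of_real ((om (x, \<rho>))\<^sup>2) - k (Complex x (-\<rho>)) * of_real ((om (x, -\<rho>))\<^sup>2))) {-\<rho>..\<rho>}"
    proof (rule fundamental_theorem_of_calculus)
      fix y assume y: "y \<in> {-\<rho>..\<rho>}"
      have 1: "((\<lambda>y. Complex x y) has_vector_derivative \<i>) (at y within {-\<rho>..\<rho>})"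
        unfolding Complex_eq by (auto intro!: derivative_eq_intros simp: has_vector_derivative_of_real)
      have 2: "(k has_field_derivative deriv k (Complex x y)) (at (Complex x y))"
        by (rule holomorphic_derivI[OF kh open_ball inb[OF x y]])
      have 3: "((\<lambda>y. k (Complex x y)) has_vector_derivative \<i> * deriv k (Complex x y)) (at y within {-\<rho>..\<rho>})"
        using field_vector_diff_chain_within[OF 1 has_field_derivative_at_within[OF 2]] by (simp add: o_def)
      have "((\<lambda>y. (om (x, y))\<^sup>2) has_real_derivative 2 * om (x, y) * (- 2 * y)) (at y within {-\<rho>..\<rho>})"
        unfolding om_def fst_conv snd_conv
        by (rule DERIV_chain2[OF has_real_derivative_max_square]) (auto intro!: derivative_eq_intros)
      then have 4: "((\<lambda>y. complex_of_real ((om (x, y))\<^sup>2)) has_vector_derivative of_real (2 * om (x, y) * (- 2 * y)))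
          (at y within {-\<rho>..\<rho>})"
        by (intro has_vector_derivative_of_real) (simp add: has_real_derivative_iff_has_vector_derivative)
      show "((\<lambda>y. k (Complex x y) * of_real ((om (x, y))\<^sup>2)) has_vector_derivative v (x, y)) (at y within {-\<rho>..\<rho>})"
        using has_vector_derivative_mult[OF 3 4] by (simp add: v_def add.commute)
    qed (use \<rho> in auto)
    then show ?thesis by (simp add: om_def)
  qed
  have Iv: "integral ?Q v = 0"
  proof -
    have "integral ?Q v = integral {-\<rho>..\<rho>} (\<lambda>x. integral {-\<rho>..\<rho>} (\<lambda>y. v (x, y)))"
      using integral_prod_continuous[OF contv] by simp
    also have "\<dots> = integral {-\<rho>..\<rho>} (\<lambda>x. 0)"
      by (rule Henstock_Kurzweil_Integration.integral_cong) (rule integral_unique[OF Dv])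
    finally show ?thesis by simp
  qed
  have Iu: "integral ?Q u = 0"
  proof -
    have "integral ?Q u = integral {-\<rho>..\<rho>} (\<lambda>x. integral {-\<rho>..\<rho>} (\<lambda>y. u (x, y)))"
      using integral_prod_continuous[OF contu] by simp
    also have "\<dots> = integral {-\<rho>..\<rho>} (\<lambda>y. integral {-\<rho>..\<rho>} (\<lambda>x. u (x, y)))"
      using integral_swap_continuous[of "-\<rho>" "-\<rho>" \<rho> \<rho> "\<lambda>x y. u (x, y)"] contu by simp
    also have "\<dots> = integral {-\<rho>..\<rho>} (\<lambda>y. 0)"
      by (rule Henstock_Kurzweil_Integration.integral_cong) (rule integral_unique[OF Du])
    finally show ?thesis by simp
  qed
  have "integral ?Q (\<lambda>p. u p + \<i> * v p) = integral ?Q u + integral ?Q (\<lambda>p. \<i> * v p)"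
    by (rule integral_add) (auto intro!: integrable_continuous continuous_intros contu contv)
  then have 0: "integral ?Q (\<lambda>p. u p + \<i> * v p) = 0" by (simp add: Iu Iv)
  have kw: "k w * w = h w - h 0" for w by (simp add: k_def)
  \<comment> \<open>In this combination the terms with \<open>deriv k\<close> cancel; the
    derivatives of the cut-off contribute the factor \<open>x + i y\<close>, which restores
    \<open>h - h 0\<close> from \<open>k\<close>.\<close>
  have "u p + \<i> * v p = - 4 * ((h (Complex (fst p) (snd p)) - h 0) * of_real (om p))" for p
    unfolding kw[symmetric] by (simp add: u_def v_def Complex_eq algebra_simps)
  with 0 show ?thesis by simp
qed


text \<open>Sub-mean value property of \<open>|h| powr q\<close>, from the weighted mean value and
  Jensen. With \<rho> = \<delta> / 2 the weight is at most \<rho>^2 and has total mass at least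
  \<rho>^4 / 2; the quotient of the two is the constant \<delta>^2 / 8.\<close>

lemma area_mean_powr:
  fixes h :: "complex \<Rightarrow> complex"
  assumes h: "h holomorphic_on ball z \<delta>" and \<delta>: "0 < \<delta>" and q: "1 \<le> q"
  shows "ennreal (cmod (h z) powr q * (\<delta>\<^sup>2 / 8))
    \<le> (\<integral>\<^sup>+w\<in>ball z (\<delta> / 2). ennreal (cmod (h w) powr q) \<partial>lborel)"
proof -
  define \<rho> where "\<rho> = \<delta> / 2"
  have \<rho>: "0 < \<rho>" "2 * \<rho> \<le> \<delta>" using \<delta> by (auto simp: \<rho>_def)
  define H where "H w = h (z + w)" for w
  define C where "C p = Complex (fst p) (snd p)" for p
  define Q where "Q = (cbox (-\<rho>, -\<rho>) (\<rho>, \<rho>) :: (real \<times> real) set)"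
  define om where "om p = max 0 (\<rho>\<^sup>2 - (fst p)\<^sup>2 - (snd p)\<^sup>2)" for p :: "real \<times> real"
  have Hh: "H holomorphic_on ball 0 \<delta>"
    unfolding H_def[abs_def]
    by (rule holomorphic_on_compose_gen[OF _ h, unfolded o_def]) (auto intro!: holomorphic_intros simp: dist_norm)
  note mean = weighted_area_mean[OF Hh \<rho>, folded C_def Q_def om_def]
  have om0: "0 \<le> om p" for p by (simp add: om_def)
  have CQ: "C p \<in> ball 0 \<delta>" if "p \<in> Q" for p
  proof -
    have "\<bar>fst p\<bar> \<le> \<rho>" "\<bar>snd p\<bar> \<le> \<rho>" using that by (cases p; auto simp: Q_def cbox_Pair_eq)+
    then have "(fst p)\<^sup>2 \<le> \<rho>\<^sup>2" "(snd p)\<^sup>2 \<le> \<rho>\<^sup>2" using \<rho> by (auto simp: abs_le_square_iff[symmetric])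
    moreover have "2 * \<rho>\<^sup>2 < (2 * \<rho>)\<^sup>2" using \<rho> by (simp add: power2_eq_square)
    ultimately have "(fst p)\<^sup>2 + (snd p)\<^sup>2 < (2 * \<rho>)\<^sup>2" by linarith
    then have "cmod (C p) < 2 * \<rho>" using \<rho> by (simp add: C_def cmod_def real_less_lsqrt)
    then show ?thesis using \<rho> by simp
  qed
  have contH: "continuous_on Q (\<lambda>p. H (C p))"
  proof (rule continuous_on_compose2[OF holomorphic_on_imp_continuous_on[OF Hh]])
    show "continuous_on Q C" unfolding C_def by (intro continuous_intros)
  qed (use CQ in blast)
  have contom: "continuous_on T om" for T unfolding om_def by (intro continuous_intros)
  have contq: "continuous_on Q (\<lambda>p. cmod (H (C p)) powr q)"
    by (intro continuous_on_powr' continuous_intros contH) (use q in auto)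
  define W where "W = integral Q om"
  define a where "a = cmod (h z)"
  have Hz: "H 0 = h z" by (simp add: H_def)
  have intQ: "f integrable_on Q" if "continuous_on Q f" for f :: "real \<times> real \<Rightarrow> 'b::banach"
    using that unfolding Q_def by (rule integrable_continuous)
  have 1: "a * W \<le> integral Q (\<lambda>p. cmod (H (C p)) * om p)"
  proof -
    have "integral Q (\<lambda>p. H (C p) * of_real (om p)) - integral Q (\<lambda>p. H 0 * of_real (om p))
        = integral Q (\<lambda>p. (H (C p) - H 0) * of_real (om p))"
      by (subst integral_diff[symmetric])
         (auto intro!: intQ continuous_intros contH contom simp: left_diff_distrib)
    also have "\<dots> = 0" by (rule mean)
    also have "integral Q (\<lambda>p. H 0 * of_real (om p)) = H 0 * of_real W"
      using integral_linear[OF intQ[OF contom], of "of_real :: real \<Rightarrow> complex"] bounded_linear_of_real[where 'a = complex]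
      by (simp add: W_def o_def)
    finally have "cmod (H 0 * of_real W) = cmod (integral Q (\<lambda>p. H (C p) * of_real (om p)))" by simp
    also have "\<dots> \<le> integral Q (\<lambda>p. cmod (H (C p)) * om p)"
      by (rule integral_norm_bound_integral)
         (auto intro!: intQ continuous_intros contH contom simp: norm_mult om0)
    finally have "a * \<bar>W\<bar> \<le> integral Q (\<lambda>p. cmod (H (C p)) * om p)" by (simp add: norm_mult a_def Hz)
    moreover have "a * W \<le> a * \<bar>W\<bar>" by (rule mult_left_mono) (auto simp: a_def)
    ultimately show ?thesis by linarith
  qed
  have 2: "a powr q * W \<le> integral Q (\<lambda>p. cmod (H (C p)) powr q * om p)"
  proof -
    \<comment> \<open>Jensen's inequality by hand: \<open>c\<close> is the slope of the tangent to
      \<open>t powr q\<close> at \<open>a\<close>, and the weighted integral of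
      \<open>a - |H|\<close> is nonpositive by the previous step.\<close>
    define c where "c = q * a powr (q - 1)"
    have c0: "0 \<le> c" using q by (simp add: c_def)
    have "integral Q (\<lambda>p. a powr q * om p - cmod (H (C p)) powr q * om p)
        \<le> integral Q (\<lambda>p. c * a * om p - c * (cmod (H (C p)) * om p))"
    proof (rule integral_le)
      fix p
      have "(a powr q - cmod (H (C p)) powr q) * om p \<le> (c * (a - cmod (H (C p)))) * om p"
        by (rule mult_right_mono[OF _ om0]) (use powr_tangent[of a "cmod (H (C p))" q] q in \<open>simp add: a_def c_def\<close>)
      then show "a powr q * om p - cmod (H (C p)) powr q * om p \<le> c * a * om p - c * (cmod (H (C p)) * om p)"
        by (simp add: algebra_simps)
    qed (intro intQ continuous_intros contH contom contq)+
    also have "integral Q (\<lambda>p. c * a * om p - c * (cmod (H (C p)) * om p))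
        = c * (a * W - integral Q (\<lambda>p. cmod (H (C p)) * om p))"
      by (subst integral_diff) (auto intro!: intQ continuous_intros contH contom simp: W_def algebra_simps)
    also have "\<dots> \<le> 0" using 1 c0 by (simp add: mult_nonneg_nonpos)
    also have "integral Q (\<lambda>p. a powr q * om p - cmod (H (C p)) powr q * om p)
        = a powr q * W - integral Q (\<lambda>p. cmod (H (C p)) powr q * om p)"
      by (subst integral_diff) (auto intro!: intQ continuous_intros contom contq simp: W_def)
    finally show ?thesis by simp
  qed
  have 3: "\<rho> ^ 4 / 2 \<le> W"
  proof -
    \<comment> \<open>On the concentric square of half the side, of area \<rho>^2, the weight is at
      least \<rho>^2 / 2.\<close>
    let ?S = "cbox (-\<rho>/2, -\<rho>/2) (\<rho>/2, \<rho>/2) :: (real \<times> real) set"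
    have SQ: "?S \<subseteq> Q" using \<rho> unfolding Q_def cbox_Pair_eq by (intro Sigma_mono) auto
    have "\<rho> ^ 4 / 2 = integral ?S (\<lambda>p. \<rho>\<^sup>2 / 2)"
      using \<rho> by (simp add: content_Pair power2_eq_square power4_eq_xxxx)
    also have "\<dots> \<le> integral ?S om"
    proof (rule integral_le)
      fix p assume "p \<in> ?S"
      then have "\<bar>fst p\<bar> \<le> \<rho>/2" "\<bar>snd p\<bar> \<le> \<rho>/2" by (cases p; auto simp: cbox_Pair_eq)+
      then have "(fst p)\<^sup>2 \<le> (\<rho>/2)\<^sup>2" "(snd p)\<^sup>2 \<le> (\<rho>/2)\<^sup>2" using \<rho> by (auto simp: abs_le_square_iff[symmetric])
      moreover have "(\<rho> / 2)\<^sup>2 = \<rho>\<^sup>2 / 4" by (simp add: power_divide)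
      ultimately have "\<rho>\<^sup>2 / 2 \<le> \<rho>\<^sup>2 - (fst p)\<^sup>2 - (snd p)\<^sup>2" by argo
      then show "\<rho>\<^sup>2 / 2 \<le> om p" unfolding om_def by (rule order_trans[OF _ max.cobounded2])
    next
      show "(\<lambda>p. \<rho>\<^sup>2 / 2) integrable_on ?S" by (rule integrable_const)
      show "om integrable_on ?S" by (rule integrable_continuous[OF contom])
    qed
    also have "\<dots> \<le> W"
      unfolding W_def by (rule integral_subset_le[OF SQ]) (rule integrable_continuous intQ contom ballI om0)+
    finally show ?thesis .
  qed
  define X where "X = (\<integral>\<^sup>+w\<in>ball z (\<delta> / 2). ennreal (cmod (h w) powr q) \<partial>lborel)"
  define om' where "om' w = max 0 (\<rho>\<^sup>2 - (Re w)\<^sup>2 - (Im w)\<^sup>2)" for w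
  define Q' where "Q' = cbox (Complex (-\<rho>) (-\<rho>)) (Complex \<rho> \<rho>)"
  have CQ': "C p \<in> Q' \<longleftrightarrow> p \<in> Q" for p
    by (cases p) (simp add: C_def Q'_def Q_def in_cbox_complex_iff cbox_Pair_eq conj_ac)
  have Q'ball: "Q' \<subseteq> ball 0 \<delta>"
  proof
    fix w assume "w \<in> Q'"
    then show "w \<in> ball 0 \<delta>" using CQ[of "(Re w, Im w)"] CQ'[of "(Re w, Im w)"] by (simp add: C_def)
  qed
  define G where "G w = ennreal (indicator Q' w *\<^sub>R (cmod (H w) powr q * om' w))" for w
  have Gm: "G \<in> borel_measurable borel"
    unfolding G_def[abs_def]
  proof (intro measurable_compose[OF _ measurable_ennreal] borel_measurable_continuous_on_indicator)
    have "continuous_on Q' (\<lambda>w. cmod (H w))"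
      by (rule continuous_on_norm[OF continuous_on_subset[OF holomorphic_on_imp_continuous_on[OF Hh] Q'ball]])
    then have "continuous_on Q' (\<lambda>w. cmod (H w) powr q)"
      by (rule continuous_on_powr'[OF _ continuous_on_const]) (use q in auto)
    moreover have "continuous_on Q' om'" unfolding om'_def by (intro continuous_intros)
    ultimately show "continuous_on Q' (\<lambda>w. cmod (H w) powr q * om' w)" by (rule continuous_on_mult)
  qed (simp add: Q'_def)
  define F where "F w = ennreal (indicator (ball z \<rho>) w *\<^sub>R (cmod (h w) powr q))" for w
  have Fm: "F \<in> borel_measurable borel"
    unfolding F_def[abs_def]
  proof (intro measurable_compose[OF _ measurable_ennreal] borel_measurable_continuous_on_indicator)
    have "ball z \<rho> \<subseteq> ball z \<delta>" by (rule subset_ball) (use \<rho> in simp)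
    then have "continuous_on (ball z \<rho>) (\<lambda>w. cmod (h w))"
      by (rule continuous_on_norm[OF continuous_on_subset[OF holomorphic_on_imp_continuous_on[OF h]]])
    then show "continuous_on (ball z \<rho>) (\<lambda>w. cmod (h w) powr q)"
      by (rule continuous_on_powr'[OF _ continuous_on_const]) (use q in auto)
  qed simp
  have X: "X = integral\<^sup>N lborel F"
  proof -
    have F: "ennreal (cmod (h w) powr q) * indicator (ball z (\<delta> / 2)) w = F w" for w
      unfolding \<rho>_def[symmetric] F_def by (cases "w \<in> ball z \<rho>") (simp_all del: mem_ball)
    show ?thesis unfolding X_def F ..
  qed
  have "ennreal (a powr q * (\<rho> ^ 4 / 2)) \<le> ennreal (integral Q (\<lambda>p. cmod (H (C p)) powr q * om p))"
    using mult_left_mono[OF 3, of "a powr q"] 2 by (intro ennreal_leI) simp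
  also have "\<dots> = (\<integral>\<^sup>+p. ennreal (cmod (H (C p)) powr q * om p) * indicator Q p \<partial>lborel)"
  proof (rule nn_integral_has_integral_lebesgue'[symmetric])
    show "0 \<le> cmod (H (C p)) powr q * om p" for p by (rule mult_nonneg_nonneg[OF powr_ge_zero om0])
    show "((\<lambda>p. cmod (H (C p)) powr q * om p) has_integral integral Q (\<lambda>p. cmod (H (C p)) powr q * om p)) Q"
      by (rule integrable_integral[OF intQ[OF continuous_on_mult[OF contq contom]]])
  qed
  also have "\<dots> = (\<integral>\<^sup>+p. G (C p) \<partial>lborel)"
    by (intro nn_integral_cong) (simp add: G_def indicator_def CQ' om_def om'_def, simp add: C_def)
  also have "\<dots> = integral\<^sup>N lborel G"
  proof -
    have "integral\<^sup>N lborel G = integral\<^sup>N (distr lborel borel C) G"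
      using lborel_complex by (simp add: C_def[abs_def])
    also have "\<dots> = (\<integral>\<^sup>+p. G (C p) \<partial>lborel)"
      by (rule nn_integral_distr)
         (auto intro!: borel_measurable_continuous_onI continuous_intros Gm simp: C_def[abs_def])
    finally show ?thesis by simp
  qed
  also have "\<dots> \<le> (\<integral>\<^sup>+w. ennreal (\<rho>\<^sup>2) * F (z + w) \<partial>lborel)"
  proof (rule nn_integral_mono)
    fix w
    show "G w \<le> ennreal (\<rho>\<^sup>2) * F (z + w)"
    proof (cases "om' w = 0")
      case True
      then show ?thesis by (simp add: G_def)
    next
      case False
      then have "(cmod w)\<^sup>2 < \<rho>\<^sup>2" by (auto simp: om'_def cmod_power2 max_def split: if_splits)
      then have "cmod w < \<rho>" using \<rho> by (simp add: power2_less_imp_less)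
      moreover have "om' w \<le> \<rho>\<^sup>2" by (simp add: om'_def)
      ultimately show ?thesis
        by (auto simp: G_def F_def H_def indicator_def dist_norm ennreal_mult[symmetric] mult.commute[of "\<rho>\<^sup>2"]
            intro!: ennreal_leI mult_left_mono)
    qed
  qed
  also have "\<dots> = ennreal (\<rho>\<^sup>2) * (\<integral>\<^sup>+w. F (z + w) \<partial>lborel)"
    by (rule nn_integral_cmult) (use Fm in measurable)
  also have "(\<integral>\<^sup>+w. F (z + w) \<partial>lborel) = integral\<^sup>N (distr lborel borel ((+) z)) F"
    by (rule nn_integral_distr[symmetric]) (use Fm in auto)
  also have "\<dots> = X" by (simp add: lborel_distr_plus X)
  finally have fin: "ennreal (a powr q * (\<rho> ^ 4 / 2)) \<le> ennreal (\<rho>\<^sup>2) * X" .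
  have "ennreal (a powr q * (\<rho>\<^sup>2 / 2)) \<le> X"
  proof (cases X)
    case (real x)
    have "a powr q * (\<rho> ^ 4 / 2) \<le> \<rho>\<^sup>2 * x"
      using fin real by (simp add: ennreal_mult[symmetric])
    also have "a powr q * (\<rho> ^ 4 / 2) = \<rho>\<^sup>2 * (a powr q * (\<rho>\<^sup>2 / 2))"
      by (simp add: power2_eq_square power4_eq_xxxx)
    finally show ?thesis using \<rho> real by (simp add: ennreal_leI)
  qed simp
  moreover have "\<rho>\<^sup>2 / 2 = \<delta>\<^sup>2 / 8" by (simp add: \<rho>_def power_divide)
  ultimately show ?thesis by (simp only: a_def X_def)
qed

section \<open>Geometry of tents and Stolz angles\<close>

lemma jordan_inequality:
  assumes "\<bar>x\<bar> \<le> pi / 2" shows "2 / pi * \<bar>x\<bar> \<le> \<bar>sin x\<bar>"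
proof -
  have conv: "convex_on {0..pi/2} (\<lambda>x. - sin x)"
  proof (rule f''_ge0_imp_convex)
    fix x :: real assume "x \<in> {0..pi/2}"
    then show "0 \<le> sin x" by (intro sin_ge_zero) auto
  qed (auto intro!: derivative_eq_intros)
  define t where "t = 2 / pi * \<bar>x\<bar>"
  have t: "0 \<le> t" "t \<le> 1" using assms by (auto simp: t_def field_simps)
  have "- sin ((1 - t) *\<^sub>R 0 + t *\<^sub>R (pi / 2)) \<le> (1 - t) * (- sin 0) + t * (- sin (pi / 2))"
    by (rule convex_onD[OF conv t]) auto
  moreover have "t * (pi / 2) = \<bar>x\<bar>" by (simp add: t_def)
  ultimately have "t \<le> sin \<bar>x\<bar>" by simp
  also have "\<dots> \<le> \<bar>sin x\<bar>" by (simp add: abs_if)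
  finally show ?thesis by (simp add: t_def)
qed

lemma zeta_add: "zeta (x + y) = zeta x * zeta y"
  by (simp add: zeta_def cis_mult distrib_left)

lemma zeta_of_int [simp]: "zeta (of_int m) = 1"
  unfolding zeta_def by (rule cis_multiple_2pi) simp

lemma zeta_add_int [simp]: "zeta (x + of_int m) = zeta x"
  by (simp add: zeta_add)

lemma unit_eq_zeta:
  assumes "norm w = 1" shows "\<exists>x. w = zeta x"
proof -
  have "w \<noteq> 0" using assms by auto
  then have "cis (Arg w) = w" using assms by (simp add: cis_Arg sgn_div_norm)
  then show ?thesis unfolding zeta_def by (intro exI[of _ "Arg w / (2 * pi)"]) simp
qed

lemma polar_zeta: "\<exists>x. z = of_real (norm z) * zeta x"
proof (cases "z = 0")
  case False
  then have "norm (z / of_real (norm z)) = 1" by (simp add: norm_divide)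
  then obtain x where "z / of_real (norm z) = zeta x" using unit_eq_zeta by blast
  then show ?thesis using False by (intro exI[of _ x]) (simp add: field_simps)
qed simp

lemma norm_zeta_diff: "norm (zeta x - zeta y) = 2 * \<bar>sin (pi * (x - y))\<bar>"
proof -
  define a b where "a = 2 * pi * x" and "b = 2 * pi * y"
  have "(norm (cis a - cis b))\<^sup>2 = (cos a * cos a + sin a * sin a) + (cos b * cos b + sin b * sin b)
      - 2 * (cos a * cos b + sin a * sin b)"
    unfolding cmod_power2 by (simp add: power2_eq_square algebra_simps)
  also have "\<dots> = 2 - 2 * cos (a - b)" by (simp only: sin_cos_squared_add3 cos_diff one_add_one)
  also have "\<dots> = (2 * sin ((a - b) / 2))\<^sup>2"
  proof -
    have "2 - 2 * cos (2 * t) = (2 * sin t)\<^sup>2" for t :: real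
      unfolding cos_double_sin by (simp add: power_mult_distrib)
    from this[of "(a - b) / 2"] show ?thesis by (simp only: field_sum_of_halves mult_2)
  qed
  also have "\<dots> = \<bar>2 * sin ((a - b) / 2)\<bar>\<^sup>2" by simp
  finally have "norm (cis a - cis b) = \<bar>2 * sin ((a - b) / 2)\<bar>"
    by (rule power2_eq_imp_eq) auto
  moreover have "(a - b) / 2 = pi * (x - y)" by (simp add: a_def b_def right_diff_distrib diff_divide_distrib)
  ultimately show ?thesis by (simp add: zeta_def a_def b_def abs_mult)
qed

lemma norm_zeta_diff_le: "norm (zeta x - zeta y) \<le> 8 * \<bar>x - y\<bar>"
proof -
  have "2 * \<bar>sin (pi * (x - y))\<bar> \<le> 2 * \<bar>pi * (x - y)\<bar>"
    using abs_sin_x_le_abs_x by (intro mult_left_mono) auto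
  also have "\<dots> \<le> 2 * (4 * \<bar>x - y\<bar>)"
    unfolding abs_mult using pi_less_4 by (intro mult_left_mono mult_right_mono) auto
  finally show ?thesis by (simp add: norm_zeta_diff)
qed

text \<open>\<open>m\<close> is the integer nearest to \<open>x - y\<close>, so that half of the
  remaining angle stays within \<open>pi / 2\<close>. There Jordan's inequality gives 2 times 2 / pi
  times pi, which is 4.\<close>

lemma norm_zeta_diff_ge: "\<exists>m::int. 4 * \<bar>x - y - of_int m\<bar> \<le> norm (zeta x - zeta y)"
proof -
  define m where "m = round (x - y)"
  define d where "d = x - y - of_int m"
  have d: "\<bar>d\<bar> \<le> 1 / 2"
    using of_int_round_abs_le[of "x - y"] by (simp add: d_def m_def abs_minus_commute)
  have "norm (zeta x - zeta y) = norm (zeta (y + d) - zeta y)"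
    using zeta_add_int[of "y + d" m] by (simp add: d_def)
  also have "\<dots> = 2 * \<bar>sin (pi * d)\<bar>" by (simp add: norm_zeta_diff)
  also have "\<dots> \<ge> 2 * (2 / pi * \<bar>pi * d\<bar>)"
    using d by (intro mult_left_mono jordan_inequality) (auto simp: abs_mult field_simps)
  finally show ?thesis by (intro exI[of _ m]) (simp add: d_def abs_mult)
qed

text \<open>\<open>norm (z - \<zeta>) + 3 * norm z\<close> is convex in \<open>z\<close>; it equals
  3 at the vertex and is at most 3/2 + 3/2 on the circle of radius 1/2. The bound by 3 therefore
  holds on the convex hull. The constants in the tent inclusions go back to this aperture.\<close>

lemma stolz_dist:
  assumes "norm \<zeta> = 1" "z \<in> stolz \<zeta>" shows "norm (z - \<zeta>) \<le> 3 * (1 - norm z)"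
proof -
  let ?A = "{z. norm (z - \<zeta>) + 3 * norm z \<le> 3}"
  have "stolz \<zeta> \<subseteq> ?A"
    unfolding stolz_def
  proof (rule hull_minimal)
    have "norm (w - \<zeta>) + 3 * norm w \<le> 3" if "norm w = 1 / 2" for w
      using norm_triangle_ineq4[of w \<zeta>] assms that by simp
    then show "insert \<zeta> (sphere 0 (1 / 2)) \<subseteq> ?A" using assms by auto
    show "convex ?A"
    proof (rule convexI)
      fix x y and u v :: real
      assume *: "x \<in> ?A" "y \<in> ?A" and uv: "0 \<le> u" "0 \<le> v" "u + v = 1"
      have "u *\<^sub>R x + v *\<^sub>R y - \<zeta> = u *\<^sub>R (x - \<zeta>) + v *\<^sub>R (y - \<zeta>)"
        using uv(3) by (simp add: algebra_simps flip: scaleR_add_left)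
      then have 1: "norm (u *\<^sub>R x + v *\<^sub>R y - \<zeta>) \<le> u * norm (x - \<zeta>) + v * norm (y - \<zeta>)"
        using uv by (metis abs_of_nonneg norm_scaleR norm_triangle_ineq)
      have 2: "norm (u *\<^sub>R x + v *\<^sub>R y) \<le> u * norm x + v * norm y"
        using uv by (metis abs_of_nonneg norm_scaleR norm_triangle_ineq)
      have "u * (norm (x - \<zeta>) + 3 * norm x) + v * (norm (y - \<zeta>) + 3 * norm y) \<le> u * 3 + v * 3"
        using * uv by (intro add_mono mult_left_mono) auto
      also have "\<dots> = 3" using uv(3) by (simp flip: distrib_right)
      finally show "u *\<^sub>R x + v *\<^sub>R y \<in> ?A" using 1 2 by (simp add: algebra_simps)
    qed
  qed
  then show ?thesis using assms(2) by auto
qed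

text \<open>A tent omits only the Stolz angles of unit points outside the arc, so it suffices that
  every boundary point whose cone can contain \<open>z\<close> lies in the arc. The integer
  \<open>m\<close> accounts for the periodicity of \<open>zeta\<close>.\<close>

lemma in_tent_arc:
  assumes z: "norm z < 1" and near: "\<And>y. norm (z - zeta y) \<le> 3 * (1 - norm z) \<Longrightarrow> \<exists>m::int. y + of_int m \<in> {a..<b}"
  shows "z \<in> tent (zeta ` {a..<b})"
proof -
  have "z \<notin> stolz \<zeta>" if "\<zeta> \<in> sphere 0 1 - zeta ` {a..<b}" for \<zeta>
  proof
    assume s: "z \<in> stolz \<zeta>"
    have n: "norm \<zeta> = 1" using that by simp
    then obtain y where y: "\<zeta> = zeta y" using unit_eq_zeta by blast
    obtain m :: int where "y + of_int m \<in> {a..<b}"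
      using near[of y] stolz_dist[OF n s] y by auto
    then have "zeta y \<in> zeta ` {a..<b}" by (metis imageI zeta_add_int)
    then show False using that y by simp
  qed
  then show ?thesis using z unfolding tent_def by auto
qed

lemma in_tent_arc_polar:
  assumes z: "z = of_real r * zeta x" and r: "0 \<le> r" "r < 1"
    and ab: "a \<le> x - (1 - r)" "x + (1 - r) < b"
  shows "z \<in> tent (zeta ` {a..<b})"
proof (rule in_tent_arc)
  have nz: "norm z = r" using z r by (simp add: norm_mult)
  then show "norm z < 1" using r by simp
  fix y assume y: "norm (z - zeta y) \<le> 3 * (1 - norm z)"
  have "zeta x - z = of_real (1 - r) * zeta x" by (simp add: z algebra_simps)
  then have "norm (zeta x - z) = 1 - r" using r by (simp only: norm_mult norm_of_real norm_zeta) simp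
  then have "norm (zeta x - zeta y) \<le> 4 * (1 - r)"
    using norm_triangle_ineq[of "zeta x - z" "z - zeta y"] y nz by simp
  then obtain m :: int where "4 * \<bar>x - y - of_int m\<bar> \<le> 4 * (1 - r)"
    using norm_zeta_diff_ge order_trans by blast
  then have "\<bar>x - y - of_int m\<bar> \<le> 1 - r" by simp
  then show "\<exists>m::int. y + of_int m \<in> {a..<b}" using ab by (intro exI[of _ m]) (auto simp: abs_le_iff)
qed

text \<open>The margin 3/2 is a quarter of 6. In units of \<open>1 - r\<close>, the boundary point
  above \<open>z\<close> is 1 away from \<open>z\<close>, a point \<open>w\<close> of the ball less
  than 1/2 from \<open>z\<close>, and a vertex at most 3 * 3/2 from \<open>w\<close>; the 4 is that
  of \<open>norm_zeta_diff_ge\<close>.\<close>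

lemma ball_subset_tent:
  assumes z: "z = of_real r * zeta x" and r: "0 \<le> r" "r < 1"
    and ab: "a \<le> x - 3 / 2 * (1 - r)" "x + 3 / 2 * (1 - r) < b"
  shows "ball z ((1 - r) / 2) \<subseteq> tent (zeta ` {a..<b})"
proof
  fix w assume "w \<in> ball z ((1 - r) / 2)"
  then have zw: "norm (z - w) < (1 - r) / 2" by (simp add: dist_norm)
  have nz: "norm z = r" using z r by (simp add: norm_mult)
  have nw: "norm w < r + (1 - r) / 2" "r - (1 - r) / 2 < norm w"
    using zw norm_triangle_ineq3[of z w] nz by linarith+
  show "w \<in> tent (zeta ` {a..<b})"
  proof (rule in_tent_arc)
    show "norm w < 1" using nw(1) r by (simp add: field_simps)
    fix y assume y: "norm (w - zeta y) \<le> 3 * (1 - norm w)"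
    have "zeta x - z = of_real (1 - r) * zeta x" by (simp add: z algebra_simps)
    then have xz: "norm (zeta x - z) = 1 - r" using r by (simp only: norm_mult norm_of_real norm_zeta) simp
    have "norm (zeta x - zeta y) \<le> norm (zeta x - z) + norm (z - w) + norm (w - zeta y)"
      using norm_triangle_ineq[of "zeta x - z" "z - w"] norm_triangle_ineq[of "zeta x - w" "w - zeta y"] by simp
    also have "\<dots> \<le> 6 * (1 - r)" using xz zw y nw by argo
    finally obtain m :: int where "4 * \<bar>x - y - of_int m\<bar> \<le> 6 * (1 - r)"
      using norm_zeta_diff_ge order_trans by blast
    then have "\<bar>x - y - of_int m\<bar> \<le> 3 / 2 * (1 - r)" by simp
    then have "a \<le> y + of_int m" "y + of_int m < b" using ab by linarith+
    then show "\<exists>m::int. y + of_int m \<in> {a..<b}" by auto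
  qed
qed

text \<open>The half-open unit interval covers the whole circle, so no Stolz angle is
  removed.\<close>

lemma tent_full: "tent (zeta ` {of_int k..<of_int k + 1}) = ball 0 1"
proof -
  have "z \<in> tent (zeta ` {of_int k..<of_int k + 1})" if "norm z < 1" for z
  proof (rule in_tent_arc[OF that])
    fix y :: real
    have "y + of_int (k - \<lfloor>y\<rfloor>) \<in> {of_int k..<of_int k + 1}" by (auto; linarith)
    then show "\<exists>m::int. y + of_int m \<in> {of_int k..<of_int k + 1}" by blast
  qed
  then show ?thesis unfolding tent_def by auto
qed

lemma dyadic_scale:
  fixes t :: real assumes "0 < t" "t < 1"
  shows "\<exists>m. 1 / 2 ^ Suc m \<le> t \<and> t < 1 / 2 ^ m"
proof -
  define m where "m = (LEAST m. 1 / 2 ^ Suc m \<le> t)"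
  obtain n where n: "(1 / 2) ^ n < t" using real_arch_pow_inv[of t "1 / 2"] assms by auto
  have "1 / 2 ^ Suc n \<le> ((1 / 2) ^ n :: real)" by (simp add: power_divide divide_simps)
  with n have "1 / 2 ^ Suc n \<le> t" by simp
  then have 1: "1 / 2 ^ Suc m \<le> t" unfolding m_def by (rule LeastI)
  have "t < 1 / 2 ^ m"
  proof (cases m)
    case (Suc l)
    then have "\<not> 1 / 2 ^ Suc l \<le> t" using not_less_Least[of l "\<lambda>m. 1 / 2 ^ Suc m \<le> t"] by (simp add: m_def)
    then show ?thesis using Suc by simp
  qed (use assms in simp)
  with 1 show ?thesis by blast
qed

text \<open>The polynomially growing factor is damped by \<open>exp (-\<epsilon> / v)\<close> because the cone of aperture
  \<open>|v| \<le> \<kappa> Re v\<close> is strictly smaller than a half plane.\<close>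

lemma phragmen_lindelof_cone:
  fixes h :: "complex \<Rightarrow> complex" and \<zeta> :: complex
  assumes h: "h holomorphic_on ball 0 1" and \<zeta>: "norm \<zeta> = 1" and \<kappa>: "1 \<le> \<kappa>" and B: "0 \<le> B" and M: "0 \<le> M"
    and side: "\<And>w. w \<in> ball 0 1 \<Longrightarrow> norm (w - \<zeta>) = \<kappa> * (1 - norm w) \<Longrightarrow> norm (w - \<zeta>) \<le> \<Delta> \<Longrightarrow>
      norm (h w) * norm (w - \<zeta>) powr a \<le> B"
    and cap: "\<And>w. w \<in> ball 0 1 \<Longrightarrow> norm (w - \<zeta>) \<le> \<kappa> * (1 - norm w) \<Longrightarrow> norm (w - \<zeta>) = \<Delta> \<Longrightarrow>
      norm (h w) * norm (w - \<zeta>) powr a \<le> B"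
    and growth: "\<And>w. w \<in> ball 0 1 \<Longrightarrow> norm (h w) * (1 - norm w) ^ N \<le> M"
    and z: "z \<in> ball 0 1" "norm (z - \<zeta>) \<le> \<kappa> * (1 - norm z)" "norm (z - \<zeta>) \<le> \<Delta>"
  shows "norm (h z) * norm (z - \<zeta>) powr a \<le> B"
proof -
  \<comment> \<open>\<open>v\<close> vanishes at the vertex and
    \<open>1 - |w| \<le> Re (v w)\<close>, so \<open>|v| \<le> \<kappa> * Re v\<close> in the cone.
    This keeps \<open>v\<close> off the negative axis and makes \<open>Re (1 / v)\<close> comparable
    to \<open>1 / |v|\<close>.\<close>
  define v where "v w = 1 - cnj \<zeta> * w" for w
  have nv: "norm (v w) = norm (w - \<zeta>)" for w
  proof -
    have "cnj \<zeta> * (\<zeta> - w) = v w"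
      using \<zeta> by (simp add: v_def algebra_simps) (metis complex_norm_square mult.commute of_real_1 one_power2)
    then have "norm (v w) = norm (\<zeta> - w)" using \<zeta> by (metis complex_mod_cnj mult_1 norm_mult)
    then show ?thesis by (simp add: norm_minus_commute)
  qed
  have rev: "1 - norm w \<le> Re (v w)" for w
    using complex_Re_le_cmod[of "cnj \<zeta> * w"] \<zeta> by (simp add: v_def norm_mult)
  have npos: "0 < norm (w - \<zeta>)" if "w \<in> ball 0 1" for w
  proof -
    have "0 < 1 - norm w" using that by simp
    then show ?thesis using rev[of w] complex_Re_le_cmod[of "v w"] nv[of w] by linarith
  qed
  have Reinv: "Re (1 / v w) = Re (v w) / (norm (w - \<zeta>))\<^sup>2" for w
    by (simp add: Re_divide cmod_power2 flip: nv)
  define L where "L = norm (h z) * norm (z - \<zeta>) powr a"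
  have damp: "L * exp (- (\<epsilon> * Re (1 / v z))) \<le> B + \<eta>" if e: "\<epsilon> > 0" and \<eta>: "\<eta> > 0" for \<epsilon> \<eta>
  proof -
    define c where "c = \<epsilon> / \<kappa>"
    have c: "c > 0" using e \<kappa> by (simp add: c_def)
    obtain n :: nat where n: "real N - a \<le> real n" using real_arch_simple by blast
    define M' where "M' = M * \<kappa> ^ N / c ^ n + 1"
    have M': "M' > 0" using M \<kappa> c by (simp add: M'_def add_nonneg_pos)
    have "((\<lambda>x::real. x ^ n / exp x) \<longlongrightarrow> 0) at_top" by (rule tendsto_power_div_exp_0)
    then have "eventually (\<lambda>x::real. x ^ n / exp x < \<eta> / M') at_top"
      using \<eta> M' by (intro order_tendstoD) auto
    then obtain X where X: "\<And>x. x \<ge> X \<Longrightarrow> x ^ n / exp x < \<eta> / M'"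
      unfolding eventually_at_top_linorder by blast
    \<comment> \<open>The vertex is cut off at radius \<open>\<rho> = c / x\<close>. Here
      \<open>x\<close> is large enough for the exponential to beat the growth, for
      \<open>\<rho> \<le> 1\<close>, and for \<open>z\<close> to stay in the truncated cone.\<close>
    define x where "x = max (max 1 X) (max c (c / norm (z - \<zeta>)))"
    define \<rho> where "\<rho> = c / x"
    have x: "x \<ge> 1" "x \<ge> X" "x \<ge> c" "x \<ge> c / norm (z - \<zeta>)" by (auto simp: x_def)
    have \<rho>: "0 < \<rho>" "\<rho> \<le> 1" using x c by (auto simp: \<rho>_def field_simps)
    have \<rho>z: "\<rho> \<le> norm (z - \<zeta>)" using x(1,4) npos[OF z(1)] c by (simp add: \<rho>_def field_simps)
    define D where "D = {w. norm (w - \<zeta>) \<le> \<kappa> * (1 - norm w) \<and> \<rho> \<le> norm (w - \<zeta>) \<and> norm (w - \<zeta>) \<le> \<Delta>}"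
    have Dball: "w \<in> ball 0 1" if "w \<in> D" for w
    proof -
      have "0 < \<kappa> * (1 - norm w)" using that \<rho> unfolding D_def by auto
      then show ?thesis using \<kappa> by (simp add: zero_less_mult_iff)
    qed
    have Dclosed: "closed D"
      unfolding D_def by (intro closed_Collect_conj closed_Collect_le continuous_intros)
    define U where "U = {w. norm (w - \<zeta>) < \<kappa> * (1 - norm w) \<and> \<rho> < norm (w - \<zeta>) \<and> norm (w - \<zeta>) < \<Delta>}"
    have "open U"
      unfolding U_def by (intro open_Collect_conj open_Collect_less continuous_intros)
    \<comment> \<open>Hence a frontier point of \<open>D\<close> violates a strict inequality of
      \<open>U\<close>: it lies on the side, on the outer cap or on the small inner arc.\<close>
    then have UD: "U \<subseteq> interior D" by (rule interior_maximal[rotated]) (auto simp: U_def D_def)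
    define G where "G w = h w * (v w powr of_real a) * exp (- (of_real \<epsilon> / v w))" for w
    have vre: "0 < Re (v w)" if "w \<in> D" for w using rev[of w] Dball[OF that] by simp
    have Ghol: "G holomorphic_on D"
    proof -
      have "h holomorphic_on D" by (rule holomorphic_on_subset[OF h]) (use Dball in blast)
      moreover have "v holomorphic_on D" unfolding v_def[abs_def] by (intro holomorphic_intros)
      moreover have "v w \<noteq> 0" "v w \<notin> \<real>\<^sub>\<le>\<^sub>0" if "w \<in> D" for w
        using vre[OF that] by (auto simp: complex_nonpos_Reals_iff)
      ultimately show ?thesis unfolding G_def[abs_def] by (intro holomorphic_intros) auto
    qed
    have nG: "norm (G w) = norm (h w) * norm (w - \<zeta>) powr a * exp (- (\<epsilon> * Re (1 / v w)))" if "w \<in> D" for w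
    proof -
      have "norm (v w powr of_real a) = norm (w - \<zeta>) powr a"
        using vre[OF that] nv[of w] by (subst norm_powr_real_powr') auto
      moreover have "Re (of_real \<epsilon> / v w) = \<epsilon> * Re (1 / v w)" by (simp add: Re_divide)
      ultimately show ?thesis by (simp add: G_def norm_mult)
    qed
    have "norm (G z) \<le> B + \<eta>"
    proof (rule maximum_modulus_frontier[of G D])
      show "G holomorphic_on interior D" by (rule holomorphic_on_subset[OF Ghol interior_subset])
      show "continuous_on (closure D) G"
        using Dclosed holomorphic_on_imp_continuous_on[OF Ghol] by (simp add: closure_closed)
      show "bounded D" by (rule bounded_subset[of "ball 0 1"]) (use Dball in auto)
      show "z \<in> D" using z \<rho>z by (simp add: D_def)
      fix w assume "w \<in> frontier D"
      then have w: "w \<in> D" "w \<notin> U" using Dclosed UD by (auto simp: frontier_def closure_closed)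
      note wb = Dball[OF w(1)]
      have ex1: "exp (- (\<epsilon> * Re (1 / v w))) \<le> 1"
        using vre[OF w(1)] e by (simp add: Reinv)
      have w0: "0 \<le> norm (h w) * norm (w - \<zeta>) powr a" by simp
      consider "norm (w - \<zeta>) = \<kappa> * (1 - norm w)" | "norm (w - \<zeta>) = \<Delta>" | "norm (w - \<zeta>) = \<rho>"
        using w unfolding D_def U_def by fastforce
      then show "norm (G w) \<le> B + \<eta>"
      proof cases
        case 1
        then have "norm (h w) * norm (w - \<zeta>) powr a \<le> B" using side[OF wb] w(1) by (simp add: D_def)
        then show ?thesis unfolding nG[OF w(1)] using mult_left_mono[OF ex1 w0] \<eta> by linarith
      next
        case 2
        then have "norm (h w) * norm (w - \<zeta>) powr a \<le> B" using cap[OF wb] w(1) by (simp add: D_def)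
        then show ?thesis unfolding nG[OF w(1)] using mult_left_mono[OF ex1 w0] \<eta> by linarith
      next
        case 3
        have k: "\<rho> / \<kappa> \<le> 1 - norm w" using w(1) 3 \<kappa> by (simp add: D_def field_simps)
        have "\<epsilon> * Re (1 / v w) \<ge> \<epsilon> * ((\<rho> / \<kappa>) / \<rho>\<^sup>2)"
          unfolding Reinv 3 using k rev[of w] e by (intro mult_left_mono divide_right_mono) auto
        moreover have "\<epsilon> * ((\<rho> / \<kappa>) / \<rho>\<^sup>2) = x" using \<rho> c x e \<kappa> by (simp add: c_def \<rho>_def power2_eq_square)
        ultimately have ex: "exp (- (\<epsilon> * Re (1 / v w))) \<le> exp (- x)" by simp
        have "norm (h w) * (\<rho> / \<kappa>) ^ N \<le> M"
          using growth[OF wb] power_mono[OF k, of N] \<rho> \<kappa> by (smt (verit) divide_nonneg_pos mult_left_mono norm_ge_zero)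
        then have hw: "norm (h w) \<le> M * \<kappa> ^ N / \<rho> ^ N" using \<rho> \<kappa> by (simp add: power_divide field_simps)
        \<comment> \<open>Since \<open>n \<ge> N - a\<close>, the weight and the growth of
          \<open>h\<close> together cost at most the \<open>n\<close>-th power of
          \<open>1 / \<rho>\<close>, a polynomial in \<open>x\<close>.\<close>
        have "\<rho> powr a \<le> \<rho> powr (real N - real n)" using \<rho> n by (intro powr_mono') auto
        also have "\<dots> = \<rho> ^ N / \<rho> ^ n" using \<rho> by (simp add: powr_diff powr_realpow)
        finally have "norm (h w) * \<rho> powr a \<le> (M * \<kappa> ^ N / \<rho> ^ N) * (\<rho> ^ N / \<rho> ^ n)"
          using hw M \<kappa> \<rho> by (intro mult_mono) auto
        also have "\<dots> = M * \<kappa> ^ N / c ^ n * x ^ n" using \<rho> x c by (simp add: \<rho>_def power_divide)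
        also have "\<dots> \<le> M' * x ^ n" using x by (intro mult_right_mono) (auto simp: M'_def)
        finally have "norm (h w) * \<rho> powr a * exp (- (\<epsilon> * Re (1 / v w))) \<le> M' * x ^ n * exp (- x)"
          by (rule mult_mono[OF _ ex]) (use x M' in auto)
        also have "\<dots> = M' * (x ^ n / exp x)" by (simp add: exp_minus divide_inverse)
        also have "\<dots> \<le> \<eta>" using X[OF x(2)] M' by (simp add: field_simps)
        finally show ?thesis unfolding nG[OF w(1)] 3 using B by linarith
      qed
    qed
    moreover have "z \<in> D" using z \<rho>z by (simp add: D_def)
    ultimately show ?thesis using nG by (simp add: L_def)
  qed
  have "L * exp (- (\<epsilon> * Re (1 / v z))) \<le> B" if "\<epsilon> > 0" for \<epsilon>
    by (rule field_le_epsilon) (rule damp[OF that])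
  then have "eventually (\<lambda>\<epsilon>. L * exp (- (\<epsilon> * Re (1 / v z))) \<le> B) (at_right 0)"
    by (auto simp: eventually_at_filter)
  moreover have "((\<lambda>\<epsilon>. L * exp (- (\<epsilon> * Re (1 / v z)))) \<longlongrightarrow> L * exp (- (0 * Re (1 / v z)))) (at_right 0)"
    by (intro tendsto_intros)
  ultimately have "L * exp (- (0 * Re (1 / v z))) \<le> B"
    by (intro tendsto_upperbound) auto
  then show ?thesis by (simp add: L_def)
qed

section \<open>Pointwise bounds from the dyadic Carleson condition\<close>

text \<open>Integer positions instead of indices below \<open>2 ^ j\<close>: by periodicity these
  are the same arcs, and the arcs on both sides of any dyadic point can be named without wrapping
  around.\<close>

definition carleson_bound :: "real \<Rightarrow> real \<Rightarrow> (complex \<Rightarrow> complex) \<Rightarrow> real \<Rightarrow> bool" where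
  "carleson_bound s q h K \<longleftrightarrow> (\<forall>j (k::int).
     (\<integral>\<^sup>+ z\<in>tent (zeta ` {of_int k / 2 ^ j..<(of_int k + 1) / 2 ^ j}).
        ennreal (\<bar>weighted s h z\<bar> powr q / (1 - norm z)) \<partial>lborel) \<le> ennreal (K / 2 ^ j))"

lemma integer_dyadic_arc:
  "zeta ` {of_int k / 2 ^ j..<(of_int k + 1) / 2 ^ j} = dyadic_arc j (nat (k mod 2 ^ j))"
proof -
  define m where "m = k div 2 ^ j"
  define k' where "k' = nat (k mod 2 ^ j)"
  have k: "of_int k = real k' + of_int m * 2 ^ j"
  proof -
    have "k = k mod 2 ^ j + m * 2 ^ j" by (simp only: m_def mod_div_mult_eq)
    then have "real_of_int k = of_int (k mod 2 ^ j + m * 2 ^ j)" by (rule arg_cong)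
    then have "real_of_int k = of_int (k mod 2 ^ j) + of_int m * 2 ^ j" by (simp only: of_int_add of_int_mult of_int_power of_int_numeral)
    then show ?thesis by (simp add: k'_def)
  qed
  have "{of_int k / 2 ^ j..<(of_int k + 1) / 2 ^ j} = (\<lambda>x. x + of_int m) ` {real k' / 2 ^ j..<(real k' + 1) / 2 ^ j}"
    by (simp add: k field_simps)
  then show ?thesis by (simp only: dyadic_arc_def image_image k'_def[symmetric] zeta_add_int)
qed

lemma carleson_boundI:
  assumes "tent_inf_pow q (weighted s h) < \<infinity>"
  shows "carleson_bound s q h (enn2real (tent_inf_pow q (weighted s h)))"
  unfolding carleson_bound_def
proof (intro allI)
  fix j and k :: int
  let ?K = "enn2real (tent_inf_pow q (weighted s h))"
  define I where "I = (\<integral>\<^sup>+ z\<in>tent (dyadic_arc j (nat (k mod 2 ^ j))).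
        ennreal (\<bar>weighted s h z\<bar> powr q / (1 - norm z)) \<partial>lborel)"
  have "nat (k mod 2 ^ j) < 2 ^ j" by (simp add: nat_less_iff)
  then have "ennreal (2 ^ j) * I \<le> tent_inf_pow q (weighted s h)"
    unfolding tent_inf_pow_def I_def by (intro SUP_upper2[of "(j, nat (k mod 2 ^ j))"]) auto
  also have "\<dots> = ennreal ?K" using assms by simp
  finally have *: "ennreal (2 ^ j) * I \<le> ennreal ?K" .
  have "I \<le> ennreal (?K / 2 ^ j)"
  proof (cases I)
    case (real x)
    with * have "2 ^ j * x \<le> ?K" by (simp add: ennreal_mult[symmetric])
    then show ?thesis using real by (simp add: field_simps ennreal_leI)
  next
    case top
    with * show ?thesis by (simp add: ennreal_mult_top top_unique)
  qed
  then show "(\<integral>\<^sup>+ z\<in>tent (zeta ` {of_int k / 2 ^ j..<(of_int k + 1) / 2 ^ j}).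
        ennreal (\<bar>weighted s h z\<bar> powr q / (1 - norm z)) \<partial>lborel) \<le> ennreal (?K / 2 ^ j)"
    unfolding I_def integer_dyadic_arc .
qed

locale carleson_function =
  fixes s q :: real and h :: "complex \<Rightarrow> complex" and K :: real
  assumes s: "s < 0" and q: "1 \<le> q" and h: "h holomorphic_on ball 0 1"
    and K: "0 \<le> K" and carl: "carleson_bound s q h K"
begin

lemma sq: "0 \<le> - s * q" using s q by (simp add: mult_nonpos_nonneg)

text \<open>12 is 8 times 3/2: the 8 comes from the area mean, while 3/2 and the power of 2 come
  from comparing \<open>1 - |w|\<close> with \<open>1 - |z|\<close> on the ball of half the distance
  to the circle.\<close>

definition c0 :: real where "c0 = 12 * 2 powr (- s * q)"

lemma c0: "c0 \<ge> 1"
proof -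
  have "2 powr (- s * q) \<ge> 1" using sq by (intro ge_one_powr_ge_zero) auto
  then show ?thesis by (simp add: c0_def)
qed

definition F :: "complex \<Rightarrow> real" where "F z = (1 - norm z) powr (- s) * norm (h z)"

lemma F_nonneg: "0 \<le> F z" by (simp add: F_def)

text \<open>Sub-mean value property on a ball where the weight is comparable to its value at the
  centre. \<open>M\<close> measures how much longer the arc is than the distance of \<open>z\<close>
  to the circle.\<close>

lemma pointwise_tent:
  assumes z: "norm z < 1" and sub: "ball z ((1 - norm z) / 2) \<subseteq> tent (zeta ` {of_int k / 2 ^ j..<(of_int k + 1) / 2 ^ j})"
    and M: "1 / 2 ^ j \<le> M * (1 - norm z)"
  shows "F z powr q \<le> c0 * K * M"
proof -
  define \<delta> where "\<delta> = 1 - norm z"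
  have \<delta>: "0 < \<delta>" using z by (simp add: \<delta>_def)
  define c where "c = (\<delta> / 2) powr (- s * q) * (2 / (3 * \<delta>))"
  have c: "c > 0" using \<delta> by (simp add: c_def)
  let ?T = "tent (zeta ` {of_int k / 2 ^ j..<(of_int k + 1) / 2 ^ j})"
  have bsub: "ball z \<delta> \<subseteq> ball 0 1"
  proof
    fix w assume "w \<in> ball z \<delta>"
    then show "w \<in> ball 0 1" using norm_triangle_ineq[of z "w - z"] by (simp add: \<delta>_def dist_norm norm_minus_commute)
  qed
  have "ennreal c * ennreal (cmod (h z) powr q * (\<delta>\<^sup>2 / 8))
      \<le> ennreal c * (\<integral>\<^sup>+w\<in>ball z (\<delta> / 2). ennreal (cmod (h w) powr q) \<partial>lborel)"
    by (intro mult_left_mono area_mean_powr holomorphic_on_subset[OF h bsub] \<delta> q) auto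
  also have "\<dots> = (\<integral>\<^sup>+w. ennreal c * (ennreal (cmod (h w) powr q) * indicator (ball z (\<delta> / 2)) w) \<partial>lborel)"
  proof (rule nn_integral_cmult[symmetric])
    have "(\<lambda>w. ennreal (indicator (ball z (\<delta> / 2)) w *\<^sub>R (cmod (h w) powr q))) \<in> borel_measurable borel"
    proof (intro measurable_compose[OF _ measurable_ennreal] borel_measurable_continuous_on_indicator)
      show "continuous_on (ball z (\<delta> / 2)) (\<lambda>w. cmod (h w) powr q)"
        by (intro continuous_intros continuous_on_powr' continuous_on_subset[OF holomorphic_on_imp_continuous_on[OF h]])
           (use q bsub \<delta> in auto)
    qed simp
    moreover have "(\<lambda>w. ennreal (indicator (ball z (\<delta> / 2)) w *\<^sub>R (cmod (h w) powr q)))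
        = (\<lambda>w. ennreal (cmod (h w) powr q) * indicator (ball z (\<delta> / 2)) w)"
      by (auto simp: indicator_def)
    ultimately have "(\<lambda>w. ennreal (cmod (h w) powr q) * indicator (ball z (\<delta> / 2)) w) \<in> borel_measurable borel"
      by (simp only:)
    then show "(\<lambda>w. ennreal (cmod (h w) powr q) * indicator (ball z (\<delta> / 2)) w) \<in> borel_measurable lborel"
      by (simp only: measurable_lborel2)
  qed
  also have "\<dots> \<le> (\<integral>\<^sup>+w\<in>?T. ennreal (\<bar>weighted s h w\<bar> powr q / (1 - norm w)) \<partial>lborel)"
  proof (rule nn_integral_mono)
    fix w
    show "ennreal c * (ennreal (cmod (h w) powr q) * indicator (ball z (\<delta> / 2)) w)
      \<le> ennreal (\<bar>weighted s h w\<bar> powr q / (1 - norm w)) * indicator ?T w"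
    proof (cases "w \<in> ball z (\<delta> / 2)")
      case True
      then have "dist z w < \<delta> / 2" by simp
      then have w: "\<delta> / 2 \<le> 1 - norm w" "1 - norm w \<le> 3 / 2 * \<delta>"
        using norm_triangle_ineq[of z "w - z"] norm_triangle_ineq[of w "z - w"]
        by (simp_all add: \<delta>_def dist_norm norm_minus_commute field_simps)
      then have wp: "1 - norm w > 0" using \<delta> by simp
      have "c \<le> (1 - norm w) powr (- s * q) * (1 / (1 - norm w))"
        unfolding c_def
      proof (rule mult_mono)
        show "(\<delta> / 2) powr (- s * q) \<le> (1 - norm w) powr (- s * q)"
          by (rule powr_mono2) (use sq \<delta> w in auto)
        have "1 / (3 / 2 * \<delta>) \<le> 1 / (1 - norm w)"
          by (rule divide_left_mono) (use w wp \<delta> in auto)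
        then show "2 / (3 * \<delta>) \<le> 1 / (1 - norm w)" by simp
      qed (use \<delta> in auto)
      then have "c * cmod (h w) powr q \<le> (1 - norm w) powr (- s * q) * (1 / (1 - norm w)) * cmod (h w) powr q"
        by (rule mult_right_mono) simp
      also have "\<dots> = \<bar>weighted s h w\<bar> powr q / (1 - norm w)"
        using wp by (simp add: weighted_def powr_mult powr_powr abs_mult)
      finally have "ennreal (c * cmod (h w) powr q) \<le> ennreal (\<bar>weighted s h w\<bar> powr q / (1 - norm w))"
        by (rule ennreal_leI)
      moreover have "w \<in> ?T" using True sub by (auto simp: \<delta>_def)
      ultimately show ?thesis using True c by (simp add: ennreal_mult)
    qed simp
  qed
  also have "\<dots> \<le> ennreal (K / 2 ^ j)" using carl unfolding carleson_bound_def by blast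
  finally have "c * (cmod (h z) powr q * (\<delta>\<^sup>2 / 8)) \<le> K / 2 ^ j"
    using c K by (simp add: ennreal_mult[symmetric])
  also have "\<dots> \<le> K * (M * \<delta>)" using mult_left_mono[OF M K] by (simp add: \<delta>_def)
  finally have 1: "c * (cmod (h z) powr q * (\<delta>\<^sup>2 / 8)) \<le> K * (M * \<delta>)" .
  have Fz: "F z powr q = \<delta> powr (- s * q) * cmod (h z) powr q"
    using \<delta> by (simp add: F_def \<delta>_def[symmetric] powr_mult powr_powr)
  have "F z powr q * \<delta> = c0 * (c * (cmod (h z) powr q * (\<delta>\<^sup>2 / 8)))"
    unfolding Fz c0_def c_def using \<delta> by (simp add: powr_divide power2_eq_square field_simps)
  also have "\<dots> \<le> c0 * (K * (M * \<delta>))" using 1 c0 by (intro mult_left_mono) auto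
  finally have "F z powr q * \<delta> \<le> (c0 * K * M) * \<delta>" by (simp add: mult_ac)
  then show ?thesis using \<delta> by simp
qed

text \<open>Uses the largest tent, the whole disc, at the price of an \<open>M\<close> that grows
  like the reciprocal of the distance to the circle. It provides the a priori growth of
  \<open>h\<close> and the bound at points of bounded height.\<close>

lemma pointwise_disc:
  assumes z: "norm z < 1" and M: "1 \<le> M * (1 - norm z)"
  shows "F z powr q \<le> c0 * K * M"
proof (rule pointwise_tent[OF z, of 0 0])
  have "ball z ((1 - norm z) / 2) \<subseteq> ball 0 1"
  proof
    fix w assume "w \<in> ball z ((1 - norm z) / 2)"
    then have "dist z w < (1 - norm z) / 2" by simp
    then show "w \<in> ball 0 1" using norm_triangle_ineq[of z "w - z"] z
      by (simp add: dist_norm norm_minus_commute field_simps)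
  qed
  then show "ball z ((1 - norm z) / 2) \<subseteq> tent (zeta ` {of_int 0 / 2 ^ 0..<(of_int 0 + 1) / 2 ^ 0})"
    using tent_full[of 0] by simp
qed (use M in simp)

lemma pointwise_arc:
  assumes z: "z = of_real r * zeta x" and r: "0 \<le> r" "r < 1"
    and ab: "of_int k / 2 ^ j \<le> x - 3 / 2 * (1 - r)" "x + 3 / 2 * (1 - r) < (of_int k + 1) / 2 ^ j"
    and M: "1 / 2 ^ j \<le> M * (1 - r)"
  shows "F z powr q \<le> c0 * K * M"
proof (rule pointwise_tent)
  have nz: "norm z = r" using z r by (simp add: norm_mult)
  show "norm z < 1" using nz r by simp
  show "ball z ((1 - norm z) / 2) \<subseteq> tent (zeta ` {of_int k / 2 ^ j..<(of_int k + 1) / 2 ^ j})"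
    unfolding nz by (rule ball_subset_tent[OF z r ab])
  show "1 / 2 ^ j \<le> M * (1 - norm z)" using M nz by simp
qed

lemma F_powr_imp_growth:
  assumes z: "norm z < 1" and A: "0 \<le> A" and b: "F z powr q \<le> A"
    and t: "0 \<le> t" "t \<le> c * (1 - norm z)" "0 \<le> c"
  shows "norm (h z) * t powr (- s) \<le> c powr (- s) * A powr (1 / q)"
proof -
  have "F z = (F z powr q) powr (1 / q)" using q F_nonneg by (simp add: powr_powr)
  also have "\<dots> \<le> A powr (1 / q)" using b q by (intro powr_mono2) auto
  finally have 1: "F z \<le> A powr (1 / q)" .
  have "t powr (- s) \<le> (c * (1 - norm z)) powr (- s)" using t s by (intro powr_mono2) auto
  also have "\<dots> = c powr (- s) * (1 - norm z) powr (- s)" using t z by (simp add: powr_mult)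
  finally have "norm (h z) * t powr (- s) \<le> norm (h z) * (c powr (- s) * (1 - norm z) powr (- s))"
    by (rule mult_left_mono) simp
  also have "\<dots> = c powr (- s) * F z" by (simp add: F_def mult_ac)
  also have "\<dots> \<le> c powr (- s) * A powr (1 / q)" by (rule mult_left_mono[OF 1]) simp
  finally show ?thesis .
qed

text \<open>Bound on the boundary of a cone of aperture 15: there \<open>F powr q\<close> is at most
  \<open>c0 * K * 90\<close>, and \<open>15 powr (- s)\<close> passes from \<open>1 - |w|\<close> to
  the distance from the vertex.\<close>

definition B0 :: real where "B0 = 15 powr (- s) * (c0 * K * 90) powr (1 / q)"

text \<open>Picks the representative of the angle of \<open>w\<close> that lies close to
  \<open>d\<close>. The last estimate says that a point far from the vertex, compared with its
  height, also has its angle away from \<open>d\<close>.\<close>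

lemma polar_near:
  assumes w: "norm w < 1" and d: "norm (w - zeta d) \<le> A * (1 - norm w)"
  shows "\<exists>x. w = of_real (norm w) * zeta x \<and> 4 * \<bar>x - d\<bar> \<le> (A + 1) * (1 - norm w)
    \<and> norm (w - zeta d) - (1 - norm w) \<le> 8 * \<bar>x - d\<bar>"
proof -
  obtain x0 where x0: "w = of_real (norm w) * zeta x0" using polar_zeta by blast
  have "zeta x0 - w = of_real (1 - norm w) * zeta x0" by (subst x0) (simp add: algebra_simps)
  then have d0: "norm (zeta x0 - w) = 1 - norm w" using w by (simp only: norm_mult norm_of_real norm_zeta) simp
  obtain m :: int where m: "4 * \<bar>x0 - d - of_int m\<bar> \<le> norm (zeta x0 - zeta d)"
    using norm_zeta_diff_ge by blast
  define x where "x = x0 + of_int (- m)"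
  have zx: "zeta x = zeta x0" unfolding x_def by (rule zeta_add_int)
  have "norm (zeta x0 - zeta d) \<le> (A + 1) * (1 - norm w)"
    using norm_triangle_ineq[of "zeta x0 - w" "w - zeta d"] d0 d by (simp add: algebra_simps)
  with m have 1: "4 * \<bar>x - d\<bar> \<le> (A + 1) * (1 - norm w)" by (simp add: x_def algebra_simps)
  have "norm (w - zeta d) \<le> norm (w - zeta x) + norm (zeta x - zeta d)"
    using norm_triangle_ineq[of "w - zeta x" "zeta x - zeta d"] by simp
  then have "norm (w - zeta d) - (1 - norm w) \<le> 8 * \<bar>x - d\<bar>"
    using norm_zeta_diff_le[of x d] d0 by (simp add: zx norm_minus_commute)
  with 1 x0 zx show ?thesis by metis
qed

text \<open>A tent over a dyadic arc misses a whole cone at each of its end points, so the dyadic Carleson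
  condition says nothing directly about \<open>h\<close> in such a cone; analyticity has to fill the gap.\<close>

lemma dyadic_cone_bound:
  fixes d :: int and j :: nat
  assumes d: "j = 0 \<or> odd d"
    and z: "norm z < 1" "norm (z - zeta (of_int d / 2 ^ j)) \<le> 15 * (1 - norm z)"
      "norm (z - zeta (of_int d / 2 ^ j)) \<le> 1 / 2 ^ j / 3"
  shows "norm (h z) * norm (z - zeta (of_int d / 2 ^ j)) powr (- s) \<le> B0"
proof -
  define d0 where "d0 = (of_int d / 2 ^ j :: real)"
  define D where "D = (1 / 2 ^ j / 3 :: real)"
  have D: "D > 0" by (simp add: D_def)
  have K90: "0 \<le> c0 * K * 90" using c0 K by simp
  \<comment> \<open>From the tent of the whole disc, \<open>|h|\<close> is bounded by a multiple of
    \<open>(1 - |w|) powr (s - 1 / q)\<close>; this crude growth is what the damping has to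
    overcome.\<close>
  obtain N :: nat where N: "1 / q - s \<le> real N" using real_arch_simple by blast
  have grow: "norm (h w) * (1 - norm w) ^ N \<le> (c0 * K) powr (1 / q)" if "norm w < 1" for w
  proof -
    have w0: "0 < 1 - norm w" using that by simp
    have "F w powr q \<le> c0 * K * (1 / (1 - norm w))" by (rule pointwise_disc[OF that]) (use that in auto)
    then have "(F w powr q) powr (1 / q) \<le> (c0 * K * (1 / (1 - norm w))) powr (1 / q)"
      using q by (intro powr_mono2) auto
    then have "F w \<le> (c0 * K * (1 / (1 - norm w))) powr (1 / q)"
      using q F_nonneg[of w] by (simp add: powr_powr)
    also have "\<dots> = (c0 * K) powr (1 / q) * (1 - norm w) powr (- (1 / q))"
      using w0 c0 K by (simp add: powr_mult powr_divide powr_minus_divide)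
    finally have "F w * (1 - norm w) powr (1 / q) \<le> (c0 * K) powr (1 / q) * (1 - norm w) powr (- (1 / q)) * (1 - norm w) powr (1 / q)"
      by (rule mult_right_mono) simp
    also have "\<dots> = (c0 * K) powr (1 / q)" using w0 by (simp add: mult.assoc powr_add[symmetric])
    finally have 1: "norm (h w) * ((1 - norm w) powr (- s) * (1 - norm w) powr (1 / q)) \<le> (c0 * K) powr (1 / q)"
      by (simp add: F_def mult_ac)
    have "(1 - norm w) ^ N = (1 - norm w) powr real N" using w0 by (simp add: powr_realpow)
    also have "\<dots> \<le> (1 - norm w) powr (- s + 1 / q)" using w0 N by (intro powr_mono') auto
    also have "\<dots> = (1 - norm w) powr (- s) * (1 - norm w) powr (1 / q)" by (rule powr_add)
    finally have "norm (h w) * (1 - norm w) ^ N \<le> norm (h w) * ((1 - norm w) powr (- s) * (1 - norm w) powr (1 / q))"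
      by (rule mult_left_mono) simp
    with 1 show ?thesis by linarith
  qed
  have "norm (h z) * norm (z - zeta d0) powr (- s) \<le> B0"
  proof (rule phragmen_lindelof_cone[OF h, of "zeta d0" 15 B0 "(c0 * K) powr (1 / q)" D "- s" N])
    fix w assume w: "w \<in> ball 0 1" "norm (w - zeta d0) = 15 * (1 - norm w)" "norm (w - zeta d0) \<le> D"
    define \<eta> where "\<eta> = 1 - norm w"
    have \<eta>: "0 < \<eta>" "\<eta> \<le> D / 15" using w by (auto simp: \<eta>_def)
    \<comment> \<open>On the side of the cone the angle is between 7/4 and 4 heights away from the
      vertex. The lower bound leaves room for the margin 3/2 of \<open>pointwise_arc\<close>; the
      upper one makes 4 + 3/2 = 11/2 heights the arc length required.\<close>
    obtain x where x: "w = of_real (norm w) * zeta x" "4 * \<bar>x - d0\<bar> \<le> 16 * \<eta>" "14 * \<eta> \<le> 8 * \<bar>x - d0\<bar>"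
      using polar_near[of w d0 15] w by (auto simp: \<eta>_def)
    have "11 / 2 * \<eta> < 1 / 2 ^ j" "11 / 2 * \<eta> < 1"
    proof -
      show *: "11 / 2 * \<eta> < 1 / 2 ^ j" using \<eta> D by (simp add: D_def)
      have "1 / 2 ^ j \<le> (1::real)" by simp
      with * show "11 / 2 * \<eta> < 1" by linarith
    qed
    then obtain m where m: "1 / 2 ^ Suc m \<le> 11 / 2 * \<eta>" "11 / 2 * \<eta> < 1 / 2 ^ m"
      using dyadic_scale[of "11 / 2 * \<eta>"] \<eta> by auto
    have jm: "j \<le> m"
    proof (rule ccontr)
      assume "\<not> j \<le> m"
      then have "1 / 2 ^ j \<le> (1 / 2 ^ Suc m :: real)" by (intro divide_left_mono power_increasing) auto
      then show False using m \<open>11 / 2 * \<eta> < 1 / 2 ^ j\<close> by linarith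
    qed
    \<comment> \<open>As \<open>j \<le> m\<close>, the point \<open>d0\<close> is also an end point
      in generation \<open>m\<close>; the tents used are those over the two arcs of that generation
      meeting there.\<close>
    define k where "k = d * 2 ^ (m - j)"
    have "(2::real) ^ m = 2 ^ j * 2 ^ (m - j)" using jm by (simp flip: power_add)
    then have k: "of_int k / 2 ^ m = d0" by (simp add: k_def d0_def)
    have k1: "(of_int k + 1) / 2 ^ m = d0 + 1 / 2 ^ m" "of_int (k - 1) / 2 ^ m = d0 - 1 / 2 ^ m"
      "(of_int (k - 1) + 1) / 2 ^ m = d0"
      using k by (simp_all add: add_divide_distrib diff_divide_distrib)
    have M: "1 / 2 ^ m \<le> 90 * (1 - norm w)" using m(1) \<eta> by (simp add: \<eta>_def[symmetric])
    define P where "P = (1::real) / 2 ^ m"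
    have mP: "11 / 2 * \<eta> < P" using m(2) by (simp only: P_def)
    have r: "0 \<le> norm w" "norm w < 1" using w by auto
    have "F w powr q \<le> c0 * K * 90"
    proof (cases "x > d0")
      case True
      then have "4 * (x - d0) \<le> 16 * \<eta>" "14 * \<eta> \<le> 8 * (x - d0)" using x(2,3) by simp_all
      then have "d0 \<le> x - 3 / 2 * \<eta>" "x + 3 / 2 * \<eta> < d0 + P" using mP \<eta>(1) by argo+
      then show ?thesis unfolding \<eta>_def
        by (intro pointwise_arc[OF x(1) r _ _ M, of k]) (simp_all only: k k1 P_def)
    next
      case False
      then have "4 * (d0 - x) \<le> 16 * \<eta>" "14 * \<eta> \<le> 8 * (d0 - x)" using x(2,3) by simp_all
      then have "d0 - P \<le> x - 3 / 2 * \<eta>" "x + 3 / 2 * \<eta> < d0" using mP \<eta>(1) by argo+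
      then show ?thesis unfolding \<eta>_def
        by (intro pointwise_arc[OF x(1) r _ _ M, of "k - 1"]) (simp_all only: k1 P_def)
    qed
    then show "norm (h w) * norm (w - zeta d0) powr (- s) \<le> B0"
      unfolding B0_def by (intro F_powr_imp_growth K90) (use w in auto)
  next
    fix w assume w: "w \<in> ball 0 1" "norm (w - zeta d0) \<le> 15 * (1 - norm w)" "norm (w - zeta d0) = D"
    define \<eta> where "\<eta> = 1 - norm w"
    have "\<eta> \<le> D" using w norm_triangle_ineq2[of "zeta d0" w] by (simp add: \<eta>_def norm_minus_commute)
    then have \<eta>: "0 < \<eta>" "\<eta> \<le> D" "D \<le> 15 * \<eta>" using w by (auto simp: \<eta>_def)
    have "F w powr q \<le> c0 * K * 90"
    proof (cases "j = 0")
      case True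
      show ?thesis by (rule pointwise_disc) (use w True \<eta> in \<open>auto simp: \<eta>_def[symmetric] D_def\<close>)
    next
      case False
      \<comment> \<open>A point of exact generation \<open>j\<close> is the midpoint of an arc of
        generation \<open>j - 1\<close>, of half-length \<open>3 * D\<close>. On the cap
        \<open>D\<close> is at most 15 heights, so this arc has length at most 6 * 15 = 90 heights,
        the origin of 90.\<close>
      with d obtain e where e: "d = 2 * e + 1" by (auto elim: oddE)
      obtain i where i: "j = Suc i" using False not0_implies_Suc by blast
      obtain x where x: "w = of_real (norm w) * zeta x" "4 * \<bar>x - d0\<bar> \<le> 2 * D"
      proof -
        obtain x where "w = of_real (norm w) * zeta x" "4 * \<bar>x - d0\<bar> \<le> (D / \<eta> + 1) * \<eta>"
          using polar_near[of w d0 "D / \<eta>"] w \<eta> by (auto simp: \<eta>_def)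
        moreover have "(D / \<eta> + 1) * \<eta> = D + \<eta>" using \<eta> by (simp add: field_simps)
        ultimately show ?thesis using that \<eta> by force
      qed
      have D': "1 / 2 ^ j = 3 * D" by (simp add: D_def)
      have k1: "of_int e / 2 ^ i = d0 - 3 * D" "(of_int e + 1) / 2 ^ i = d0 + 3 * D"
        unfolding D'[symmetric] d0_def e i by (simp_all add: field_simps)
      have M: "1 / 2 ^ i \<le> 90 * (1 - norm w)" using D' \<eta> by (simp add: i \<eta>_def[symmetric])
      have r: "0 \<le> norm w" "norm w < 1" using w by auto
      have "2 * (x - d0) \<le> D" "2 * (d0 - x) \<le> D"
        using x(2) abs_ge_self[of "x - d0"] abs_ge_minus_self[of "x - d0"] by simp_all
      then have "d0 - 3 * D \<le> x - 3 / 2 * \<eta>" "x + 3 / 2 * \<eta> < d0 + 3 * D"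
        using \<eta> D by argo+
      then show ?thesis unfolding \<eta>_def
        by (intro pointwise_arc[OF x(1) r _ _ M, of e]) (simp_all only: k1)
    qed
    then show "norm (h w) * norm (w - zeta d0) powr (- s) \<le> B0"
      unfolding B0_def by (intro F_powr_imp_growth K90) (use w in auto)
  qed (use grow z in \<open>auto simp: B0_def d0_def D_def\<close>)
  then show ?thesis by (simp add: d0_def)
qed

text \<open>A dyadic end point is interior to a dyadic arc only in the generations before its first
  appearance, so its exact generation has to be known.\<close>

lemma odd_representation:
  fixes k :: int
  shows "\<exists>j' k'. j' \<le> j \<and> (j' = 0 \<or> odd k') \<and> (of_int k / 2 ^ j :: real) = of_int k' / 2 ^ j'"
proof (induction j arbitrary: k)
  case (Suc j)
  show ?case
  proof (cases "odd k")
    case False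
    then obtain e where e: "k = 2 * e" by (auto elim: evenE)
    obtain j' k' where "j' \<le> j" "j' = 0 \<or> odd k'" "(of_int e / 2 ^ j :: real) = of_int k' / 2 ^ j'"
      using Suc.IH[of e] by blast
    then show ?thesis by (intro exI[of _ j'] exI[of _ k']) (auto simp: e)
  qed blast
qed auto

text \<open>128 serves points well inside an arc, which is then at most 128 heights long; 90 with
  the power of 15 serves the points in the cones.\<close>

definition c1 :: real where "c1 = 128 * c0 * 15 powr (- s * q)"

lemma c1_ge: "128 * c0 \<le> c1"
proof -
  have "15 powr (- s * q) \<ge> 1" using sq by (intro ge_one_powr_ge_zero) auto
  then have "128 * c0 * 1 \<le> 128 * c0 * 15 powr (- s * q)" using c0 by (intro mult_left_mono) auto
  then show ?thesis by (simp add: c1_def)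
qed

text \<open>At the scale of 64 heights a point is either well inside a dyadic arc or has its angle
  within 3/2 heights of an end point. In the second case it lies within 1 + 8 * 3/2 = 13 heights of
  the vertex: inside the cone of aperture 15, and below the cap at a third of the arc length because
  39 < 64.\<close>

lemma pointwise_bound:
  assumes z: "norm z < 1" shows "F z powr q \<le> c1 * K"
proof -
  have c: "c0 * K * 128 \<le> c1 * K" using mult_right_mono[OF c1_ge K] by (simp add: mult_ac)
  define \<delta> where "\<delta> = 1 - norm z"
  have \<delta>: "0 < \<delta>" using z by (simp add: \<delta>_def)
  show ?thesis
  proof (cases "64 * \<delta> < 1")
    case False
    have "F z powr q \<le> c0 * K * 128" by (rule pointwise_disc[OF z]) (use False in \<open>simp add: \<delta>_def\<close>)
    with c show ?thesis by linarith
  next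
    case True
    obtain j where j: "1 / 2 ^ Suc j \<le> 64 * \<delta>" "64 * \<delta> < 1 / 2 ^ j"
      using dyadic_scale[of "64 * \<delta>"] True \<delta> by auto
    obtain x where x: "z = of_real (norm z) * zeta x" using polar_zeta by blast
    define k where "k = \<lfloor>x * 2 ^ j\<rfloor>"
    have k: "of_int k / 2 ^ j \<le> x" "x < (of_int k + 1) / 2 ^ j"
      using floor_correct[of "x * 2 ^ j"] by (auto simp: k_def field_simps)
    show ?thesis
    proof (cases "of_int k / 2 ^ j \<le> x - 3 / 2 * \<delta> \<and> x + 3 / 2 * \<delta> < (of_int k + 1) / 2 ^ j")
      case True
      have "F z powr q \<le> c0 * K * 128"
        by (rule pointwise_arc[OF x, of k j]) (use True z j in \<open>auto simp: \<delta>_def\<close>)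
      with c show ?thesis by linarith
    next
      case False
      obtain d :: int where d: "\<bar>x - of_int d / 2 ^ j\<bar> \<le> 3 / 2 * \<delta>"
      proof (cases "of_int k / 2 ^ j \<le> x - 3 / 2 * \<delta>")
        case True
        with False have "(of_int k + 1) / 2 ^ j \<le> x + 3 / 2 * \<delta>" by simp
        with k(2) \<delta> have "\<bar>x - (of_int k + 1) / 2 ^ j\<bar> \<le> 3 / 2 * \<delta>" by linarith
        then have "\<bar>x - of_int (k + 1) / 2 ^ j\<bar> \<le> 3 / 2 * \<delta>" by (simp only: of_int_add of_int_1)
        then show ?thesis by (rule that)
      next
        case False
        with k have "\<bar>x - of_int k / 2 ^ j\<bar> \<le> 3 / 2 * \<delta>" by simp
        then show ?thesis by (rule that)
      qed
      obtain j' d' where d': "j' \<le> j" "j' = 0 \<or> odd d'" "(of_int d / 2 ^ j :: real) = of_int d' / 2 ^ j'"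
        using odd_representation by blast
      define d0 where "d0 = (of_int d' / 2 ^ j' :: real)"
      have "zeta x - z = zeta x - of_real (norm z) * zeta x" using x by simp
      also have "\<dots> = of_real (1 - norm z) * zeta x" by (simp add: algebra_simps)
      finally have "zeta x - z = of_real (1 - norm z) * zeta x" .
      then have "norm (zeta x - z) = \<delta>" using z by (simp only: norm_mult norm_of_real norm_zeta \<delta>_def) simp
      then have n13: "norm (z - zeta d0) \<le> 13 * \<delta>"
        using norm_triangle_ineq[of "z - zeta x" "zeta x - zeta d0"] norm_zeta_diff_le[of x d0] d d'(3)
        by (simp add: d0_def norm_minus_commute)
      have "1 / 2 ^ j \<le> (1 / 2 ^ j' :: real)" using d'(1) by (intro divide_left_mono power_increasing) auto
      then have "norm (z - zeta d0) \<le> 1 / 2 ^ j' / 3" using n13 j(2) \<delta> by simp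
      then have b: "norm (h z) * norm (z - zeta d0) powr (- s) \<le> B0"
        unfolding d0_def using n13 \<delta> z by (intro dyadic_cone_bound d'(2)) (auto simp: d0_def \<delta>_def)
      have "\<delta> \<le> norm (z - zeta d0)"
        using norm_triangle_ineq2[of "zeta d0" z] by (simp add: \<delta>_def norm_minus_commute)
      then have "\<delta> powr (- s) \<le> norm (z - zeta d0) powr (- s)" using s \<delta> by (intro powr_mono2) auto
      then have "norm (h z) * \<delta> powr (- s) \<le> norm (h z) * norm (z - zeta d0) powr (- s)"
        by (intro mult_left_mono) auto
      with b have "F z \<le> B0" by (simp add: F_def \<delta>_def mult.commute)
      then have "F z powr q \<le> B0 powr q" using F_nonneg q by (intro powr_mono2) auto
      also have "\<dots> = 15 powr (- s * q) * (c0 * K * 90)"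
        using c0 K q by (simp add: B0_def powr_mult powr_powr)
      also have "\<dots> \<le> c1 * K" using c0 K by (simp add: c1_def mult_ac)
      finally show ?thesis .
    qed
  qed
qed

end

section \<open>The Hardy maximal theorem\<close>

lemma c_analytic_continuous_on:
  assumes "c_analytic_on sm S g" shows "continuous_on S g"
proof (rule continuous_at_imp_continuous_on, intro ballI)
  fix z assume "z \<in> S"
  then obtain f' where "(g has_derivative (\<lambda>w. sm w f')) (at z)"
    using assms unfolding c_analytic_on_def by blast
  then show "isCont g z" by (rule has_derivative_continuous)
qed

lemma c_analytic_functional:
  assumes g: "c_analytic_on sm S g" and l: "bounded_linear l" "\<And>a y. l (sm a y) = a * l y"
    and z: "z \<in> S"
  shows "(\<lambda>w. l (g w)) field_differentiable (at z)"
proof -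
  obtain f' where "(g has_derivative (\<lambda>w. sm w f')) (at z)"
    using g z unfolding c_analytic_on_def by blast
  from bounded_linear.has_derivative[OF l(1) this]
  have "((\<lambda>w. l (g w)) has_derivative (\<lambda>w. w * l f')) (at z)" by (simp only: l(2))
  then have "((\<lambda>w. l (g w)) has_field_derivative l f') (at z)"
  proof -
    have "(\<lambda>w. w * l f') = (*) (l f')" by (simp add: fun_eq_iff mult.commute)
    with \<open>((\<lambda>w. l (g w)) has_derivative (\<lambda>w. w * l f')) (at z)\<close> show ?thesis
      unfolding has_field_derivative_def by (simp only:)
  qed
  then show ?thesis unfolding field_differentiable_def by blast
qed

lemma scale_in_ball:
  assumes "0 < \<rho>" "\<rho> < 1" "norm w \<le> 1" shows "complex_of_real \<rho> * w \<in> ball 0 1"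
proof -
  have "\<rho> * norm w \<le> \<rho> * 1" using assms by (intro mult_left_mono) auto
  with assms have "\<rho> * norm w < 1" by linarith
  then show ?thesis using assms by (simp add: norm_mult)
qed

text \<open>Replaces \<open>norm (g (\<rho> z)) powr (p / 2)\<close> by the modulus of a zero-free scalar function, which makes
  arbitrarily small exponents and Banach space values harmless.\<close>

lemma outer_majorant:
  fixes g :: "complex \<Rightarrow> 'a::real_normed_vector"
  assumes sm: "complex_space sm" and g: "c_analytic_on sm (ball 0 1) g"
    and \<rho>: "0 < \<rho>" "\<rho> < 1" and \<epsilon>: "0 < \<epsilon>" and p: "0 < p"
  obtains f where "f holomorphic_on UNIV"
    and "\<And>z. norm z \<le> 1 \<Longrightarrow> norm (g (of_real \<rho> * z)) powr p \<le> (cmod (f z))\<^sup>2"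
    and "\<And>z. norm z = 1 \<Longrightarrow> (cmod (f z))\<^sup>2 \<le> 4 powr p * (norm (g (of_real \<rho> * z)) + \<epsilon>) powr p"
proof -
  have contg: "continuous_on (cball 0 1) (\<lambda>z. g (of_real \<rho> * z))"
    by (rule continuous_on_compose2[OF c_analytic_continuous_on[OF g]])
       (use scale_in_ball[OF \<rho>] in \<open>auto intro!: continuous_intros\<close>)
  \<comment> \<open>\<open>\<epsilon>\<close> keeps the logarithm finite at zeros of
    \<open>g\<close>; continuity up to the circle comes from the dilation by
    \<open>\<rho>\<close>.\<close>
  define u where "u z = ln (norm (g (of_real \<rho> * z)) + \<epsilon>)" for z
  have pos: "norm (g (of_real \<rho> * z)) + \<epsilon> > 0" for z using \<epsilon> by (simp add: add_nonneg_pos)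
  have "continuous_on (sphere 0 1) u"
    unfolding u_def
    by (intro continuous_intros continuous_on_subset[OF contg] ballI less_imp_neq[THEN not_sym] pos) auto
  then obtain P where P: "\<And>\<zeta>. norm \<zeta> = 1 \<Longrightarrow> \<bar>u \<zeta> - Re (poly P \<zeta>)\<bar> < ln 2"
    using circle_poly_approx[of u "ln 2"] by auto
  \<comment> \<open>A polynomial within \<open>ln 2\<close> of \<open>u\<close> is shifted up by
    \<open>ln 2\<close>, so that on the circle \<open>exp (Re P + ln 2)\<close> lies between
    \<open>norm g + \<epsilon>\<close> and four times that. The exponent \<open>p / 2\<close> makes
    the square of \<open>|f|\<close> comparable to the power \<open>p\<close>.\<close>
  define f where "f z = exp (of_real (p / 2) * (poly P z + of_real (ln 2)))" for z
  have nf: "(cmod (f z))\<^sup>2 = exp (Re (poly P z) + ln 2) powr p" for z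
  proof -
    have "(cmod (f z))\<^sup>2 = exp (p / 2 * (Re (poly P z) + ln 2)) * exp (p / 2 * (Re (poly P z) + ln 2))"
      by (simp add: f_def power2_eq_square)
    also have "\<dots> = exp (p * (Re (poly P z) + ln 2))"
      unfolding exp_add[symmetric] by (simp add: field_simps)
    finally show ?thesis by (simp add: powr_def)
  qed
  show ?thesis
  proof (rule that[of f])
    show "f holomorphic_on UNIV" unfolding f_def[abs_def] by (intro holomorphic_intros)
  next
    fix z :: complex assume z: "norm z = 1"
    have "exp (Re (poly P z) + ln 2) \<le> exp (u z + 2 * ln 2)" using P[OF z] by (simp add: abs_less_iff)
    also have "\<dots> = 4 * (norm (g (of_real \<rho> * z)) + \<epsilon>)"
      using pos[of z] unfolding exp_add mult_2 by (simp add: u_def)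
    finally have "exp (Re (poly P z) + ln 2) powr p \<le> (4 * (norm (g (of_real \<rho> * z)) + \<epsilon>)) powr p"
      using p by (intro powr_mono2) auto
    then show "(cmod (f z))\<^sup>2 \<le> 4 powr p * (norm (g (of_real \<rho> * z)) + \<epsilon>) powr p"
      unfolding nf using pos[of z] by (subst (asm) powr_mult) auto
  next
    fix z :: complex assume z: "norm z \<le> 1"
    obtain l :: "'a \<Rightarrow> complex" where l: "bounded_linear l" "\<And>a y. l (sm a y) = a * l y"
      "\<And>y. norm (l y) \<le> norm y" "norm (l (g (of_real \<rho> * z))) = norm (g (of_real \<rho> * z))"
      using complex_norming_functional[OF sm] by metis
    \<comment> \<open>A functional that is norming at the point of interest is divided by the
      zero-free majorant. The maximum principle carries the bound 1 from the circle to
      \<open>z\<close>, where the functional is sharp.\<close>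
    define k where "k w = l (g (of_real \<rho> * w)) * exp (- (poly P w + of_real (ln 2)))" for w
    have lg: "(\<lambda>w. l (g w)) holomorphic_on ball 0 1"
      unfolding holomorphic_on_def
      using c_analytic_functional[OF g l(1,2)] field_differentiable_at_within by blast
    have "(\<lambda>w. l (g (of_real \<rho> * w))) holomorphic_on cball 0 1"
      by (rule holomorphic_on_compose_gen[OF _ lg, unfolded o_def])
         (use scale_in_ball[OF \<rho>] in \<open>auto intro!: holomorphic_intros\<close>)
    then have k: "k holomorphic_on cball 0 1"
      unfolding k_def[abs_def] by (intro holomorphic_intros)
    have nk: "norm (k w) = norm (l (g (of_real \<rho> * w))) * exp (- (Re (poly P w) + ln 2))" for w
      by (simp add: k_def norm_mult)
    have "norm (k z) \<le> 1"
    proof (rule maximum_modulus_frontier[of k "cball 0 1"])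
      show "k holomorphic_on interior (cball 0 1)" by (rule holomorphic_on_subset[OF k]) (rule interior_subset)
      show "continuous_on (closure (cball 0 1)) k" using holomorphic_on_imp_continuous_on[OF k] by simp
      fix w :: complex assume "w \<in> frontier (cball 0 1)"
      then have w: "norm w = 1" by simp
      have "norm (l (g (of_real \<rho> * w))) \<le> exp (u w)"
        using l(3)[of "g (of_real \<rho> * w)"] pos[of w] \<epsilon> by (simp add: u_def)
      moreover have "exp (- (Re (poly P w) + ln 2)) \<le> exp (- u w)" using P[OF w] by (simp add: abs_less_iff)
      ultimately have "norm (k w) \<le> exp (u w) * exp (- u w)" unfolding nk by (intro mult_mono) auto
      then show "norm (k w) \<le> 1" by (simp flip: exp_add)
    qed (use z in auto)
    then have "norm (g (of_real \<rho> * z)) * exp (- (Re (poly P z) + ln 2)) \<le> 1" by (simp add: nk l(4))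
    moreover have "a \<le> exp t" if "a * exp (- t) \<le> 1" for a t :: real
      using that by (simp add: exp_minus field_simps)
    ultimately have "norm (g (of_real \<rho> * z)) \<le> exp (Re (poly P z) + ln 2)" by blast
    then show "norm (g (of_real \<rho> * z)) powr p \<le> (cmod (f z))\<^sup>2"
      unfolding nf using p by (intro powr_mono2) auto
  qed
qed

lemma powr_add_le:
  fixes a b p :: real assumes "0 \<le> a" "0 \<le> b" "0 < p"
  shows "(a + b) powr p \<le> 2 powr p * (a powr p + b powr p)"
proof -
  have "(a + b) powr p \<le> (2 * max a b) powr p" using assms by (intro powr_mono2) auto
  also have "\<dots> = 2 powr p * (max a b) powr p" by (rule powr_mult)
  also have "\<dots> \<le> 2 powr p * (a powr p + b powr p)" by (intro mult_left_mono) (auto simp: max_def)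
  finally show ?thesis .
qed

lemma hardy_circle_integral:
  fixes g :: "complex \<Rightarrow> 'a::real_normed_vector"
  assumes g: "c_analytic_on sm (ball 0 1) g" and \<rho>: "0 < \<rho>" "\<rho> < 1" and p: "0 < p"
    and fin: "hardy_pow p g < \<infinity>"
  shows "continuous_on {0..1} (\<lambda>t. norm (g (of_real \<rho> * zeta t)) powr p)"
    and "integral {0..1} (\<lambda>t. norm (g (of_real \<rho> * zeta t)) powr p) \<le> enn2real (hardy_pow p g)"
proof -
  have "continuous_on {0..1} (\<lambda>t. g (of_real \<rho> * zeta t))"
    by (rule continuous_on_compose2[OF c_analytic_continuous_on[OF g]])
       (use scale_in_ball[OF \<rho>] in \<open>auto intro!: continuous_intros\<close>)
  then show cont: "continuous_on {0..1} (\<lambda>t. norm (g (of_real \<rho> * zeta t)) powr p)"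
    by (intro continuous_on_powr' continuous_intros) (use p in auto)
  let ?I = "integral {0..1} (\<lambda>t. norm (g (of_real \<rho> * zeta t)) powr p)"
  have "ennreal ?I = (\<integral>\<^sup>+ x\<in>{0..1}. ennreal (norm (g (of_real \<rho> * zeta x)) powr p) \<partial>lborel)"
    by (rule nn_integral_has_integral_lebesgue'[symmetric])
       (use integrable_integral[OF integrable_continuous_real[OF cont]] in auto)
  also have "\<dots> \<le> hardy_pow p g"
    unfolding hardy_pow_def by (rule SUP_upper) (use \<rho> in simp)
  also have "\<dots> = ennreal (enn2real (hardy_pow p g))" using fin by simp
  finally show "?I \<le> enn2real (hardy_pow p g)" by simp
qed

text \<open>One point per arc, chosen freely in the cones, stands for the nontangential maximal
  function. The square estimate is applied to the outer majorant of a dilation, regularised by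
  \<open>\<epsilon> = 1 - \<rho>\<close>; both disappear as \<rho> tends to 1. The base 8 is 4 from
  the majorant times 2 from \<open>powr_add_le\<close>.\<close>

lemma hardy_maximal:
  fixes g :: "complex \<Rightarrow> 'a::real_normed_vector"
  assumes sm: "complex_space sm" and g: "c_analytic_on sm (ball 0 1) g" and p: "0 < p"
    and fin: "hardy_pow p g < \<infinity>"
    and N: "0 < N" and z: "\<And>i. i < N \<Longrightarrow> norm (z i) < 1" and A: "1 \<le> A"
    and cone: "\<And>i t. i < N \<Longrightarrow> t \<in> {real i / N..(real i + 1) / N} \<Longrightarrow>
      norm (zeta t - z i) \<le> A * (1 - norm (z i))"
  shows "(\<Sum>i<N. norm (g (z i)) powr p) / N \<le> 16 * (A + 3) ^ 4 * 8 powr p * enn2real (hardy_pow p g)"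
proof -
  define H where "H = enn2real (hardy_pow p g)"
  define D where "D = 16 * (A + 3) ^ 4"
  have D: "0 \<le> D" by (simp add: D_def)
  have main: "(\<Sum>i<N. norm (g (of_real \<rho> * z i)) powr p) / N \<le> D * 8 powr p * (H + (1 - \<rho>) powr p)"
    if \<rho>: "0 < \<rho>" "\<rho> < 1" for \<rho>
  proof -
    define \<epsilon> where "\<epsilon> = 1 - \<rho>"
    have \<epsilon>: "0 < \<epsilon>" using \<rho> by (simp add: \<epsilon>_def)
    obtain f where f: "f holomorphic_on UNIV"
      "\<And>z. norm z \<le> 1 \<Longrightarrow> norm (g (of_real \<rho> * z)) powr p \<le> (cmod (f z))\<^sup>2"
      "\<And>z. norm z = 1 \<Longrightarrow> (cmod (f z))\<^sup>2 \<le> 4 powr p * (norm (g (of_real \<rho> * z)) + \<epsilon>) powr p"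
      using outer_majorant[OF sm g \<rho> \<epsilon> p] by blast
    note J = hardy_circle_integral[OF g \<rho> p fin]
    have contf: "continuous_on {0..1} (\<lambda>t. f (zeta t))"
      by (rule continuous_on_compose2[OF holomorphic_on_imp_continuous_on[OF f(1)] continuous_on_zeta]) auto
    have "(\<Sum>i<N. norm (g (of_real \<rho> * z i)) powr p) / N \<le> (\<Sum>i<N. (cmod (f (z i)))\<^sup>2) / N"
      by (rule divide_right_mono, rule sum_mono, rule f(2), rule less_imp_le, rule z) auto
    also have "\<dots> \<le> D * integral {0..1} (\<lambda>t. (cmod (f (zeta t)))\<^sup>2)"
      unfolding D_def by (rule L2_maximal[OF holomorphic_on_subset[OF f(1)] N z A cone]) auto
    also have "\<dots> \<le> D * integral {0..1} (\<lambda>t. 8 powr p * (norm (g (of_real \<rho> * zeta t)) powr p + \<epsilon> powr p))"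
    proof (rule mult_left_mono[OF integral_le D])
      show "(\<lambda>t. (cmod (f (zeta t)))\<^sup>2) integrable_on {0..1}"
        by (intro integrable_continuous_real continuous_intros contf)
      show "(\<lambda>t. 8 powr p * (norm (g (of_real \<rho> * zeta t)) powr p + \<epsilon> powr p)) integrable_on {0..1}"
        by (intro integrable_continuous_real continuous_on_mult continuous_on_add J(1) continuous_on_const)
      fix t
      have "(cmod (f (zeta t)))\<^sup>2 \<le> 4 powr p * (norm (g (of_real \<rho> * zeta t)) + \<epsilon>) powr p"
        by (rule f(3)) simp
      also have "\<dots> \<le> 4 powr p * (2 powr p * (norm (g (of_real \<rho> * zeta t)) powr p + \<epsilon> powr p))"
        using \<epsilon> p by (intro mult_left_mono powr_add_le) auto
      also have "\<dots> = 8 powr p * (norm (g (of_real \<rho> * zeta t)) powr p + \<epsilon> powr p)"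
        by (simp add: powr_mult[symmetric] mult.assoc[symmetric])
      finally show "(cmod (f (zeta t)))\<^sup>2 \<le> 8 powr p * (norm (g (of_real \<rho> * zeta t)) powr p + \<epsilon> powr p)" .
    qed
    also have "integral {0..1} (\<lambda>t. 8 powr p * (norm (g (of_real \<rho> * zeta t)) powr p + \<epsilon> powr p))
        = 8 powr p * (integral {0..1} (\<lambda>t. norm (g (of_real \<rho> * zeta t)) powr p) + \<epsilon> powr p)"
    proof -
      have "integral {0..1} (\<lambda>t. norm (g (of_real \<rho> * zeta t)) powr p + \<epsilon> powr p)
        = integral {0..1} (\<lambda>t. norm (g (of_real \<rho> * zeta t)) powr p) + integral {0..1} (\<lambda>t::real. \<epsilon> powr p)"
        by (rule integral_add[OF integrable_continuous_real[OF J(1)]]) (rule integrable_const_ivl)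
      then show ?thesis by simp
    qed
    also have "D * (8 powr p * (integral {0..1} (\<lambda>t. norm (g (of_real \<rho> * zeta t)) powr p) + \<epsilon> powr p))
        \<le> D * (8 powr p * (H + \<epsilon> powr p))"
      using J(2) D by (intro mult_left_mono add_right_mono) (auto simp: H_def)
    finally show ?thesis by (simp add: \<epsilon>_def mult.assoc)
  qed
  have lim: "((\<lambda>\<rho>. (\<Sum>i<N. norm (g (of_real \<rho> * z i)) powr p) / N) \<longlongrightarrow> (\<Sum>i<N. norm (g (z i)) powr p) / N) (at_left 1)"
  proof (intro tendsto_divide tendsto_sum tendsto_const)
    fix i assume "i \<in> {..<N}"
    then have zi: "z i \<in> ball 0 1" using z by simp
    have "isCont g (z i)"
      using c_analytic_continuous_on[OF g] zi continuous_on_eq_continuous_at[OF open_ball] by blast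
    moreover have "((\<lambda>\<rho>. complex_of_real \<rho> * z i) \<longlongrightarrow> of_real 1 * z i) (at_left 1)"
      by (intro tendsto_intros)
    ultimately have "((\<lambda>\<rho>. g (of_real \<rho> * z i)) \<longlongrightarrow> g (z i)) (at_left 1)"
      using isCont_tendsto_compose[of "z i" g "\<lambda>\<rho>. complex_of_real \<rho> * z i"] by simp
    then show "((\<lambda>\<rho>. norm (g (of_real \<rho> * z i)) powr p) \<longlongrightarrow> norm (g (z i)) powr p) (at_left 1)"
      by (intro tendsto_powr' tendsto_norm tendsto_const) (use p in auto)
  qed (use N in auto)
  have lim2: "((\<lambda>\<rho>. D * 8 powr p * (H + (1 - \<rho>) powr p)) \<longlongrightarrow> D * 8 powr p * (H + 0)) (at_left 1)"
  proof (intro tendsto_mult tendsto_add tendsto_const)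
    have "((\<lambda>\<rho>. (1 - \<rho>) powr p) \<longlongrightarrow> (1 - 1) powr p) (at_left (1::real))"
      by (intro tendsto_powr' tendsto_intros) (use p in \<open>auto simp: eventually_at_filter\<close>)
    then show "((\<lambda>\<rho>. (1 - \<rho>) powr p) \<longlongrightarrow> 0) (at_left (1::real))" by simp
  qed
  have "(\<Sum>i<N. norm (g (z i)) powr p) / N \<le> D * 8 powr p * (H + 0)"
  proof (rule tendsto_le[OF _ lim2 lim])
    have "eventually (\<lambda>\<rho>. \<rho> \<in> {0<..<1}) (at_left (1::real))" by (rule eventually_at_left_real) simp
    then show "eventually (\<lambda>\<rho>. (\<Sum>i<N. norm (g (of_real \<rho> * z i)) powr p) / N
        \<le> D * 8 powr p * (H + (1 - \<rho>) powr p)) (at_left 1)"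
      by eventually_elim (use main in auto)
  qed simp
  then show ?thesis by (simp add: D_def H_def)
qed

section \<open>Whitney boxes\<close>

definition angle :: "complex \<Rightarrow> real" where "angle z = Arg2pi z / (2 * pi)"

lemma angle_bounds: "0 \<le> angle z" "angle z < 1"
  using Arg2pi_ge_0[of z] Arg2pi_lt_2pi[of z] by (auto simp: angle_def)

lemma zeta_angle: "z = of_real (norm z) * zeta (angle z)"
  using Arg2pi_eq[of z] by (simp add: angle_def zeta_def cis_conv_exp)

text \<open>\<open>Arg2pi\<close> is continuous off the nonnegative real axis and takes the value 0
  on it, so cutting it off there does not change it.\<close>

lemma angle_measurable [measurable]: "angle \<in> borel_measurable borel"
proof -
  have "(\<lambda>z. indicator (- \<real>\<^sub>\<ge>\<^sub>0) z *\<^sub>R Arg2pi z) \<in> borel_measurable borel"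
  proof (rule borel_measurable_continuous_on_indicator)
    show "- \<real>\<^sub>\<ge>\<^sub>0 \<in> sets (borel :: complex measure)"
      using closed_nonneg_Reals_complex by (intro borel_open) (simp add: open_closed)
    show "continuous_on (- \<real>\<^sub>\<ge>\<^sub>0) Arg2pi"
      by (intro continuous_at_imp_continuous_on ballI continuous_at_Arg2pi) auto
  qed
  moreover have "indicator (- \<real>\<^sub>\<ge>\<^sub>0) z *\<^sub>R Arg2pi z = Arg2pi z" for z :: complex
    by (cases "z \<in> \<real>\<^sub>\<ge>\<^sub>0") (auto simp: Arg2pi_eq_0 nonneg_Reals_def)
  ultimately have "Arg2pi \<in> borel_measurable borel" by (simp only:)
  then show ?thesis unfolding angle_def[abs_def] by measurable
qed

text \<open>Half-open in both directions, so that the boxes with \<open>k < 2 ^ j\<close> partition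
  the disc. The origin falls into generation 0, where its angle is 0 by convention.\<close>

definition whitney :: "nat \<Rightarrow> nat \<Rightarrow> complex set" where
  "whitney j k = {z. norm z < 1 \<and> 1 / 2 ^ Suc j < 1 - norm z \<and> 1 - norm z \<le> 1 / 2 ^ j
     \<and> real k \<le> 2 ^ j * angle z \<and> 2 ^ j * angle z < real k + 1}"

lemma whitney_measurable [measurable]: "whitney j k \<in> sets borel"
  unfolding whitney_def by measurable

lemma ball_covered_by_whitney:
  assumes "norm z < 1" shows "\<exists>j k. k < 2 ^ j \<and> z \<in> whitney j k"
proof -
  obtain j where j: "1 / 2 ^ Suc j < 1 - norm z" "1 - norm z \<le> 1 / 2 ^ j"
  proof (cases "1 - norm z = 1")
    case True
    then show ?thesis by (intro that[of 0]) auto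
  next
    case False
    define t where "t = 1 - norm z"
    have t: "0 < t" "t < 1" using False assms by (auto simp: t_def)
    obtain m where m: "1 / 2 ^ Suc m \<le> t" "t < 1 / 2 ^ m" using dyadic_scale[OF t] by blast
    show ?thesis
    proof (cases "t = 1 / 2 ^ Suc m")
      case True
      then show ?thesis by (intro that[of "Suc m"]) (auto simp: t_def field_simps)
    next
      case False
      with m show ?thesis by (intro that[of m]) (auto simp: t_def)
    qed
  qed
  define k where "k = nat \<lfloor>2 ^ j * angle z\<rfloor>"
  have k: "real k \<le> 2 ^ j * angle z" "2 ^ j * angle z < real k + 1"
    using floor_correct[of "2 ^ j * angle z"] angle_bounds[of z] by (auto simp: k_def)
  have "2 ^ j * angle z < 2 ^ j * 1" using angle_bounds[of z] by (intro mult_strict_left_mono) auto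
  then have "real k < 2 ^ j" using k(1) by linarith
  then have "k < 2 ^ j" by (metis of_nat_less_numeral_power_cancel_iff)
  with j k assms show ?thesis unfolding whitney_def by blast
qed

lemma whitney_disjoint:
  assumes "z \<in> whitney j k" "z \<in> whitney j' k'" shows "j = j' \<and> k = k'"
proof -
  have *: "\<not> j < j'" if "z \<in> whitney j k" "z \<in> whitney j' k'" for j j' k k'
  proof
    assume "j < j'"
    then have "(1::real) / 2 ^ j' \<le> 1 / 2 ^ Suc j" by (intro divide_left_mono power_increasing) auto
    then show False using that unfolding whitney_def by auto
  qed
  have jj: "j = j'" using *[OF assms] *[OF assms(2,1)] by simp
  moreover have "k = k'"
  proof -
    have "real k < real k' + 1" "real k' < real k + 1" using assms jj unfolding whitney_def by auto
    then show ?thesis by linarith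
  qed
  ultimately show ?thesis by simp
qed

text \<open>The height in a box is at most the length of its arc, so one further arc on each side is
  enough margin.\<close>

lemma whitney_subset_tent:
  assumes a: "a \<le> (real k - 1) / 2 ^ j" and b: "(real k + 2) / 2 ^ j \<le> b"
  shows "whitney j k \<subseteq> tent (zeta ` {a..<b})"
proof
  fix z assume z: "z \<in> whitney j k"
  define e where "e = 1 / (2::real) ^ j"
  have e: "(real k - 1) / 2 ^ j = real k * e - e" "(real k + 2) / 2 ^ j = real k * e + 2 * e"
    by (simp_all add: e_def diff_divide_distrib add_divide_distrib)
  have d: "1 - norm z \<le> e" using z by (simp add: whitney_def e_def)
  have "real k * e \<le> angle z" "angle z < real k * e + e"
    using z by (auto simp: whitney_def e_def field_simps)
  then have "a \<le> angle z - (1 - norm z)" "angle z + (1 - norm z) < b"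
    using a b d unfolding e by linarith+
  then show "z \<in> tent (zeta ` {a..<b})"
    by (intro in_tent_arc_polar[OF zeta_angle]) (use z in \<open>auto simp: whitney_def\<close>)
qed

text \<open>The box lies in a square of half-side \<open>9 / 2 ^ j\<close>: 1 for the height, 8 for
  the arc by \<open>norm_zeta_diff_le\<close>. Then 18^2 = 324.\<close>

lemma emeasure_whitney: "emeasure lborel (whitney j k) \<le> ennreal (324 / 4 ^ j)"
proof -
  define w where "w = zeta (real k / 2 ^ j)"
  define \<rho> where "\<rho> = 9 / (2::real) ^ j"
  have "whitney j k \<subseteq> cbox (w - Complex \<rho> \<rho>) (w + Complex \<rho> \<rho>)"
  proof
    fix z assume z: "z \<in> whitney j k"
    have "z - zeta (angle z) = - of_real (1 - norm z) * zeta (angle z)"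
      by (subst (1) zeta_angle) (simp add: algebra_simps)
    then have "norm (z - zeta (angle z)) = 1 - norm z"
      using z by (simp only: norm_mult norm_minus_cancel norm_of_real norm_zeta) (simp add: whitney_def)
    then have 1: "norm (z - zeta (angle z)) \<le> 1 / 2 ^ j" using z by (simp add: whitney_def)
    have "norm (zeta (angle z) - w) \<le> 8 * \<bar>angle z - real k / 2 ^ j\<bar>" unfolding w_def by (rule norm_zeta_diff_le)
    also have "\<bar>angle z - real k / 2 ^ j\<bar> \<le> 1 / 2 ^ j"
    proof -
      have "real k / 2 ^ j \<le> angle z" "angle z < (real k + 1) / 2 ^ j"
        using z by (auto simp: whitney_def field_simps)
      then show ?thesis unfolding add_divide_distrib by linarith
    qed
    finally have "norm (zeta (angle z) - w) \<le> 8 * (1 / 2 ^ j)" by simp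
    with 1 have "norm (z - w) \<le> \<rho>"
      using norm_triangle_ineq[of "z - zeta (angle z)" "zeta (angle z) - w"] by (simp add: \<rho>_def)
    then have "\<bar>Re z - Re w\<bar> \<le> \<rho>" "\<bar>Im z - Im w\<bar> \<le> \<rho>"
      using abs_Re_le_cmod[of "z - w"] abs_Im_le_cmod[of "z - w"] by auto
    then show "z \<in> cbox (w - Complex \<rho> \<rho>) (w + Complex \<rho> \<rho>)"
      by (auto simp: in_cbox_complex_iff abs_le_iff)
  qed
  then have "emeasure lborel (whitney j k) \<le> emeasure lborel (cbox (w - Complex \<rho> \<rho>) (w + Complex \<rho> \<rho>))"
    by (rule emeasure_mono) simp
  also have "\<dots> = ennreal ((2 * \<rho>) * (2 * \<rho>))"
    by (subst emeasure_lborel_cbox) (auto simp: Basis_complex_def \<rho>_def)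
  also have "(2 * \<rho>) * (2 * \<rho>) = 324 / 4 ^ j"
    by (simp add: \<rho>_def power_mult_distrib[symmetric])
  finally show ?thesis .
qed

section \<open>Neighbouring boxes and the packing condition for shifted masses\<close>

lemma geometric_tail: "(\<Sum>m\<in>{j..<n}. 1 / (2::real) ^ m) \<le> 2 / 2 ^ j"
proof (cases "j \<le> n")
  case True
  have "(\<Sum>m\<in>{j..<n}. 1 / (2::real) ^ m) = 2 / 2 ^ j - 2 / 2 ^ n"
    using True
  proof (induction n rule: dec_induct)
    case (step i)
    have "(\<Sum>m\<in>{j..<Suc i}. 1 / (2::real) ^ m) = (\<Sum>m\<in>{j..<i}. 1 / 2 ^ m) + 1 / 2 ^ i"
      using step.hyps(1) by (rule sum.atLeastLessThan_Suc)
    also have "\<dots> = 2 / 2 ^ j - 2 / 2 ^ i + 1 / 2 ^ i" by (simp only: step.IH)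
    also have "2 / (2::real) ^ i = 1 / 2 ^ i + 1 / 2 ^ i" by (simp only: add_divide_distrib[symmetric] one_add_one)
    finally show ?case by simp
  qed simp
  then show ?thesis by simp
qed simp

lemma sum_div_block:
  fixes f :: "nat \<Rightarrow> real"
  assumes "0 < D" "A \<le> B"
  shows "(\<Sum>i\<in>{A * D..<B * D}. f (i div D)) = D * (\<Sum>k\<in>{A..<B}. f k)"
  using assms(2)
proof (induction B rule: dec_induct)
  case (step B)
  have "{A * D..<Suc B * D} = {A * D..<B * D} \<union> {B * D..<Suc B * D}"
    using step.hyps by (intro ivl_disj_un_two(3)[symmetric] mult_le_mono1) auto
  then have "(\<Sum>i\<in>{A * D..<Suc B * D}. f (i div D))
      = (\<Sum>i\<in>{A * D..<B * D}. f (i div D)) + (\<Sum>i\<in>{B * D..<Suc B * D}. f (i div D))"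
    by (subst sum.union_disjoint[symmetric]) auto
  also have "(\<Sum>i\<in>{B * D..<Suc B * D}. f (i div D)) = (\<Sum>i\<in>{B * D..<Suc B * D}. f B)"
  proof (rule sum.cong[OF refl])
    fix i assume "i \<in> {B * D..<Suc B * D}"
    then have "i div D = B" by (intro div_nat_eqI) (auto simp: mult.commute)
    then show "f (i div D) = f B" by simp
  qed
  finally show ?case using step by (simp add: algebra_simps)
qed simp

text \<open>The offsets 0, 1 and -1 modulo \<open>2 ^ j\<close>, each as one function of the
  generation, so that a whole family of neighbours is a single relabelling of the tree.
  \<open>2 ^ j - 1\<close> stands for -1 in the natural numbers.\<close>

definition shifts :: "(nat \<Rightarrow> nat) set" where
  "shifts = {\<lambda>j. 0, \<lambda>j. 1, \<lambda>j. 2 ^ j - 1}"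

lemma finite_shifts: "finite shifts" and card_shifts: "card shifts \<le> 3"
  by (auto simp: shifts_def card_insert_if)

lemma shift_near:
  assumes "e \<in> shifts"
  shows "\<exists>m::int. \<bar>int ((k + e j) mod 2 ^ j) - int k - m * 2 ^ j\<bar> \<le> 1"
proof -
  have *: "\<exists>m::int. int ((k + l) mod 2 ^ j) - int k - m * 2 ^ j = int l" for l
    by (intro exI[of _ "- int ((k + l) div 2 ^ j)"])
       (simp add: zmod_int zdiv_int algebra_simps flip: of_nat_add of_nat_mult)
  consider "e j = 0" | "e j = 1" | "e j = 2 ^ j - 1" using assms by (auto simp: shifts_def)
  then show ?thesis
  proof cases
    case 1
    then show ?thesis using *[of 0] by (metis abs_0 of_nat_0 zero_le_one)
  next
    case 2
    then show ?thesis using *[of 1] by (metis abs_1 of_nat_1 order_refl)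
  next
    case 3
    obtain m :: int where "int ((k + e j) mod 2 ^ j) - int k - m * 2 ^ j = int (e j)" using *[of "e j"] by blast
    moreover have "int (e j) = 2 ^ j - 1" using 3 by (simp add: of_nat_diff)
    ultimately show ?thesis by (intro exI[of _ "m + 1"]) (simp add: algebra_simps)
  qed
qed

lemma add_mod_cancel_nat:
  fixes l l' c M :: nat
  assumes "l < M" "l' < M" "(l + c) mod M = (l' + c) mod M" shows "l = l'"
proof -
  have *: "\<not> l < l'" if "l' < M" "(l + c) mod M = (l' + c) mod M" for l l'
  proof
    assume "l < l'"
    have "M dvd (l' + c) - (l + c)"
      using mod_eq_dvd_iff_nat[of "l + c" "l' + c" M] that \<open>l < l'\<close> by simp
    then have "M dvd l' - l" by simp
    then show False using \<open>l < l'\<close> that(1) nat_dvd_not_less[of "l' - l" M] by simp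
  qed
  show ?thesis using *[OF assms(2,3)] *[OF assms(1) assms(3)[symmetric]] by simp
qed

context carleson_function
begin

definition mass :: "nat \<Rightarrow> nat \<Rightarrow> ennreal" where
  "mass j k = (\<integral>\<^sup>+z\<in>whitney j k. ennreal (F z powr q / (1 - norm z)) \<partial>lborel)"

lemma F_measurable_on_whitney: "(\<lambda>z. ennreal (F z powr q / (1 - norm z)) * indicator (whitney j k) z) \<in> borel_measurable borel"
proof -
  have "(\<lambda>z. ennreal (indicator (ball 0 1) z *\<^sub>R (F z powr q / (1 - norm z)))) \<in> borel_measurable borel"
  proof (intro measurable_compose[OF _ measurable_ennreal] borel_measurable_continuous_on_indicator)
    have "continuous_on (ball 0 1) (\<lambda>z. (1 - norm z) powr (- s) * norm (h z))"
    proof (intro continuous_on_mult continuous_on_norm holomorphic_on_imp_continuous_on[OF h])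
      show "continuous_on (ball 0 1) (\<lambda>z::complex. (1 - norm z) powr (- s))"
        by (rule continuous_on_powr) (auto intro!: continuous_intros)
    qed
    then have "continuous_on (ball 0 1) F" unfolding F_def[abs_def] .
    then have "continuous_on (ball 0 1) (\<lambda>z. F z powr q)"
      by (rule continuous_on_powr'[OF _ continuous_on_const]) (use q F_nonneg in auto)
    then show "continuous_on (ball 0 1) (\<lambda>z. F z powr q / (1 - norm z))"
      by (rule continuous_on_divide) (auto intro!: continuous_intros)
  qed simp
  then have "(\<lambda>z. ennreal (indicator (ball 0 1) z *\<^sub>R (F z powr q / (1 - norm z))) * indicator (whitney j k) z)
      \<in> borel_measurable borel"
    by measurable
  moreover have "ennreal (indicator (ball 0 1) z *\<^sub>R (F z powr q / (1 - norm z))) * indicator (whitney j k) z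
      = ennreal (F z powr q / (1 - norm z)) * indicator (whitney j k) z" for z
    by (auto simp: indicator_def whitney_def)
  ultimately show ?thesis by (simp only:)
qed

definition c2 :: real where "c2 = 648 * c1"

lemma c1_nonneg: "0 \<le> c1" using c1_ge c0 by simp

lemma c2_nonneg: "0 \<le> c2" using c1_nonneg by (simp add: c2_def)

text \<open>Pointwise bound times area, used for boxes near the end of an arc, which need not lie in
  the tent over it. In \<open>c2\<close> the factor 2 comes from \<open>1 / (1 - |z|)\<close> and
  324 from the area.\<close>

lemma mass_le: "mass j k \<le> ennreal (c2 * K / 2 ^ j)"
proof -
  have cK: "0 \<le> c1 * K" using c1_nonneg K by simp
  have "mass j k \<le> (\<integral>\<^sup>+z. ennreal (c1 * K * 2 ^ Suc j) * indicator (whitney j k) z \<partial>lborel)"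
    unfolding mass_def
  proof (rule nn_integral_mono)
    fix z
    show "ennreal (F z powr q / (1 - norm z)) * indicator (whitney j k) z \<le> ennreal (c1 * K * 2 ^ Suc j) * indicator (whitney j k) z"
    proof (cases "z \<in> whitney j k")
      case True
      then have z: "norm z < 1" "1 / 2 ^ Suc j < 1 - norm z" by (auto simp: whitney_def)
      have "F z powr q / (1 - norm z) \<le> (c1 * K) / (1 / 2 ^ Suc j)"
        by (rule frac_le[OF cK pointwise_bound[OF z(1)]]) (use z in auto)
      then show ?thesis using True by (simp add: ennreal_leI)
    qed simp
  qed
  also have "\<dots> = ennreal (c1 * K * 2 ^ Suc j) * emeasure lborel (whitney j k)"
    by (rule nn_integral_cmult_indicator) simp
  also have "\<dots> \<le> ennreal (c1 * K * 2 ^ Suc j) * ennreal (324 / 4 ^ j)"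
    by (intro mult_left_mono emeasure_whitney) simp
  also have "\<dots> = ennreal (c1 * K * 2 ^ Suc j * (324 / 4 ^ j))"
    by (rule ennreal_mult[symmetric]) (use cK in auto)
  also have "c1 * K * 2 ^ Suc j * (324 / 4 ^ j) = c2 * K / 2 ^ j"
  proof -
    have "(4::real) ^ j = 2 ^ j * 2 ^ j" by (simp flip: power_mult_distrib)
    then show ?thesis by (simp add: c2_def)
  qed
  finally show ?thesis .
qed

definition wt :: "nat \<Rightarrow> nat \<Rightarrow> real" where "wt j k = enn2real (mass j k)"

lemma mass_eq: "mass j k = ennreal (wt j k)"
proof -
  have "mass j k < top" using mass_le[of j k] ennreal_less_top by (rule le_less_trans)
  then show ?thesis by (simp add: wt_def)
qed

lemma wt_nonneg: "0 \<le> wt j k" by (simp add: wt_def)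

lemma wt_le: "wt j k \<le> c2 * K / 2 ^ j"
proof -
  have "0 \<le> c2 * K / 2 ^ j" using c2_nonneg K by simp
  then show ?thesis using mass_le[of j k] unfolding mass_eq by (rule ennreal_le_iff[THEN iffD1])
qed

text \<open>The boxes are disjoint, so any finite number of them inside one tent is paid by the
  Carleson condition for that tent.\<close>

lemma sum_mass_tent:
  assumes X: "finite X" and sub: "\<And>j k. (j, k) \<in> X \<Longrightarrow> whitney j k \<subseteq> tent (zeta ` {of_int l / 2 ^ i..<(of_int l + 1) / 2 ^ i})"
  shows "(\<Sum>(j, k)\<in>X. wt j k) \<le> K / 2 ^ i"
proof -
  let ?T = "tent (zeta ` {of_int l / 2 ^ i..<(of_int l + 1) / 2 ^ i})"
  let ?f = "\<lambda>z. ennreal (F z powr q / (1 - norm z))"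
  have "ennreal (\<Sum>(j, k)\<in>X. wt j k) = (\<Sum>x\<in>X. mass (fst x) (snd x))"
    by (simp add: mass_eq case_prod_beta wt_nonneg)
  also have "\<dots> = (\<integral>\<^sup>+z. (\<Sum>x\<in>X. ?f z * indicator (whitney (fst x) (snd x)) z) \<partial>lborel)"
    unfolding mass_def using F_measurable_on_whitney by (subst nn_integral_sum) auto
  also have "\<dots> \<le> (\<integral>\<^sup>+ z\<in>?T. ennreal (\<bar>weighted s h z\<bar> powr q / (1 - norm z)) \<partial>lborel)"
  proof (rule nn_integral_mono)
    fix z
    have w: "\<bar>weighted s h z\<bar> = F z" using F_nonneg by (simp add: weighted_def F_def)
    show "(\<Sum>x\<in>X. ?f z * indicator (whitney (fst x) (snd x)) z)
      \<le> ennreal (\<bar>weighted s h z\<bar> powr q / (1 - norm z)) * indicator ?T z"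
    proof (cases "\<exists>x\<in>X. z \<in> whitney (fst x) (snd x)")
      case True
      then obtain x where x: "x \<in> X" "z \<in> whitney (fst x) (snd x)" by blast
      have "(\<Sum>y\<in>X. ?f z * indicator (whitney (fst y) (snd y)) z) = (\<Sum>y\<in>X. if y = x then ?f z else 0)"
      proof (rule sum.cong[OF refl])
        fix y
        show "?f z * indicator (whitney (fst y) (snd y)) z = (if y = x then ?f z else 0)"
        proof (cases "y = x")
          case True
          then show ?thesis using x(2) by simp
        next
          case False
          then have "z \<notin> whitney (fst y) (snd y)"
            using x(2) whitney_disjoint[of z "fst x" "snd x" "fst y" "snd y"] by (metis prod_eqI)
          then show ?thesis using False by simp
        qed
      qed
      also have "\<dots> = ?f z" using X x(1) by simp
      finally show ?thesis using sub[of "fst x" "snd x"] x by (auto simp: w)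
    next
      case False
      then have "(\<Sum>x\<in>X. ?f z * indicator (whitney (fst x) (snd x)) z) = 0" by (intro sum.neutral) auto
      then show ?thesis by simp
    qed
  qed
  also have "\<dots> \<le> ennreal (K / 2 ^ i)" using carl unfolding carleson_bound_def by blast
  finally show ?thesis using K by simp
qed

text \<open>1 for the boxes inside the tent; 8 = 4 * 2 for four exceptional boxes per generation,
  summed as a geometric series.\<close>

definition c3 :: real where "c3 = 1 + 8 * c2"

lemma c3_nonneg: "0 \<le> c3" using c2_nonneg by (simp add: c3_def)

text \<open>A cyclic shift by one position takes boxes out of the tent of the ancestor only near the
  ends of its arc. Boxes with a neighbour inside on both sides lie in the tent; at most four per
  generation do not qualify, and for these the individual bound \<open>wt_le\<close>
  suffices.\<close>

lemma shifted_carleson: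
  assumes e: "e \<in> shifts" and k: "k < 2 ^ j"
  shows "(\<Sum>i\<in>{j..<n}. \<Sum>l\<in>{k * 2 ^ (i - j)..<Suc k * 2 ^ (i - j)}. wt i ((l + e i) mod 2 ^ i)) \<le> c3 * K / 2 ^ j"
proof -
  define \<sigma> where "\<sigma> i l = (l + e i) mod 2 ^ i" for i l
  define Bl where "Bl i = {k * 2 ^ (i - j)..<Suc k * 2 ^ (i - j)}" for i
  define good where "good i l \<longleftrightarrow> k * 2 ^ (i - j) + 1 \<le> \<sigma> i l \<and> \<sigma> i l + 2 \<le> Suc k * 2 ^ (i - j)" for i l
  have Blub: "l < 2 ^ i" if "l \<in> Bl i" "j \<le> i" for l i
  proof -
    have "Suc k * 2 ^ (i - j) \<le> 2 ^ j * 2 ^ (i - j)" using k by (intro mult_le_mono1) simp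
    also have "\<dots> = 2 ^ i" using that(2) by (simp flip: power_add)
    finally show ?thesis using that(1) by (simp add: Bl_def)
  qed
  define X where "X = (SIGMA i:{j..<n}. \<sigma> i ` {l \<in> Bl i. good i l})"
  have inj: "inj_on (\<sigma> i) (Bl i)" if "j \<le> i" for i
  proof (rule inj_onI)
    fix l l' assume l: "l \<in> Bl i" "l' \<in> Bl i" "\<sigma> i l = \<sigma> i l'"
    then show "l = l'" using add_mod_cancel_nat[OF Blub[OF l(1) that] Blub[OF l(2) that]] by (simp add: \<sigma>_def)
  qed
  have goodsum: "(\<Sum>i\<in>{j..<n}. \<Sum>l\<in>{l \<in> Bl i. good i l}. wt i (\<sigma> i l)) \<le> K / 2 ^ j"
  proof -
    have "(\<Sum>i\<in>{j..<n}. \<Sum>l\<in>{l \<in> Bl i. good i l}. wt i (\<sigma> i l))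
        = (\<Sum>i\<in>{j..<n}. \<Sum>l\<in>\<sigma> i ` {l \<in> Bl i. good i l}. wt i l)"
    proof (rule sum.cong[OF refl])
      fix i assume "i \<in> {j..<n}"
      then have "inj_on (\<sigma> i) {l \<in> Bl i. good i l}" by (intro inj_on_subset[OF inj]) auto
      from sum.reindex[OF this, of "wt i"]
      show "(\<Sum>l\<in>{l \<in> Bl i. good i l}. wt i (\<sigma> i l)) = (\<Sum>l\<in>\<sigma> i ` {l \<in> Bl i. good i l}. wt i l)"
        by (simp add: o_def)
    qed
    also have "\<dots> = (\<Sum>(i, l)\<in>X. wt i l)"
      unfolding X_def by (rule sum.Sigma) (auto simp: Bl_def)
    also have "\<dots> \<le> K / 2 ^ j"
    proof (rule sum_mass_tent[of X "int k"])
      show "finite X" unfolding X_def by (auto simp: Bl_def)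
      fix i t assume "(i, t) \<in> X"
      then obtain l where l: "j \<le> i" "t = \<sigma> i l" "good i l" unfolding X_def by auto
      have p: "(2::real) ^ i = 2 ^ j * 2 ^ (i - j)" using l(1) by (simp flip: power_add)
      have 1: "real k * 2 ^ (i - j) + 1 \<le> real t"
      proof -
        have "real (k * 2 ^ (i - j) + 1) \<le> real t" using l unfolding good_def of_nat_le_iff by simp
        then show ?thesis by simp
      qed
      have 2: "real t + 2 \<le> (real k + 1) * 2 ^ (i - j)"
      proof -
        have "real (t + 2) \<le> real (Suc k * 2 ^ (i - j))" using l unfolding good_def of_nat_le_iff by simp
        then show ?thesis by (simp add: algebra_simps)
      qed
      show "whitney i t \<subseteq> tent (zeta ` {of_int (int k) / 2 ^ j..<(of_int (int k) + 1) / 2 ^ j})"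
      proof (rule whitney_subset_tent)
        have "of_int (int k) / 2 ^ j = (real k * 2 ^ (i - j)) / 2 ^ i" by (simp add: p)
        also have "\<dots> \<le> (real t - 1) / 2 ^ i" using 1 by (intro divide_right_mono) auto
        finally show "of_int (int k) / 2 ^ j \<le> (real t - 1) / 2 ^ i" .
        have "(real t + 2) / 2 ^ i \<le> ((real k + 1) * 2 ^ (i - j)) / 2 ^ i" by (rule divide_right_mono[OF 2]) simp
        also have "\<dots> = (of_int (int k) + 1) / 2 ^ j" by (simp add: p)
        finally show "(real t + 2) / 2 ^ i \<le> (of_int (int k) + 1) / 2 ^ j" .
      qed
    qed
    finally show ?thesis .
  qed
  have badcard: "card {l \<in> Bl i. \<not> good i l} \<le> 4" if "j \<le> i" for i
  proof -
    define a b where "a = k * 2 ^ (i - j)" and "b = Suc k * 2 ^ (i - j)"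
    have good: "good i l \<longleftrightarrow> a + 1 \<le> \<sigma> i l \<and> \<sigma> i l + 2 \<le> b" for l
      by (simp only: good_def a_def b_def)
    \<comment> \<open>The margin excludes one position at each end, and a shift moves this window by
      one. Wrapping around happens only at the last or the first position, which are in the
      list.\<close>
    have "{l \<in> Bl i. \<not> good i l} \<subseteq> {a, a + 1, b - 1, b - 2}"
    proof
      fix l assume "l \<in> {l \<in> Bl i. \<not> good i l}"
      then have l: "l \<in> Bl i" "\<not> good i l" by auto
      have lb: "a \<le> l" "l < b" using l(1) by (auto simp: Bl_def a_def b_def)
      have li: "l < 2 ^ i" by (rule Blub[OF l(1) that])
      have bi: "b \<le> 2 ^ i"
      proof -
        have "b \<le> 2 ^ j * 2 ^ (i - j)" unfolding b_def using k by (intro mult_le_mono1) simp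
        then show ?thesis using that by (simp flip: power_add)
      qed
      consider "e i = 0" | "e i = 1" | "e i = 2 ^ i - 1" using e by (auto simp: shifts_def)
      then show "l \<in> {a, a + 1, b - 1, b - 2}"
      proof cases
        case 1
        then have "\<sigma> i l = l" using li by (simp add: \<sigma>_def)
        then show ?thesis using l(2) lb unfolding good insert_iff by linarith
      next
        case 2
        show ?thesis
        proof (cases "Suc l < 2 ^ i")
          case True
          with 2 have "\<sigma> i l = l + 1" by (simp add: \<sigma>_def)
          then show ?thesis using l(2) lb unfolding good insert_iff by linarith
        next
          case False
          then have "l = b - 1" using li bi lb by linarith
          then show ?thesis by simp
        qed
      next
        case 3
        show ?thesis
        proof (cases "l = a")
          case False
          then have l1: "1 \<le> l" using lb by simp
          have "l + e i = (l - 1) + 2 ^ i" using 3 l1 by simp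
          then have "\<sigma> i l = (l - 1) mod 2 ^ i" unfolding \<sigma>_def by simp
          then have "\<sigma> i l = l - 1" using li by simp
          then show ?thesis using l(2) lb l1 False unfolding good insert_iff by linarith
        qed simp
      qed
    qed
    then have "card {l \<in> Bl i. \<not> good i l} \<le> card {a, a + 1, b - 1, b - 2}" by (intro card_mono) auto
    also have "\<dots> \<le> 4" by (simp add: card_insert_if)
    finally show ?thesis .
  qed
  have badsum: "(\<Sum>i\<in>{j..<n}. \<Sum>l\<in>{l \<in> Bl i. \<not> good i l}. wt i (\<sigma> i l)) \<le> 8 * c2 * K / 2 ^ j"
  proof -
    have "(\<Sum>i\<in>{j..<n}. \<Sum>l\<in>{l \<in> Bl i. \<not> good i l}. wt i (\<sigma> i l)) \<le> (\<Sum>i\<in>{j..<n}. 4 * (c2 * K / 2 ^ i))"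
    proof (rule sum_mono)
      fix i assume i: "i \<in> {j..<n}"
      have "(\<Sum>l\<in>{l \<in> Bl i. \<not> good i l}. wt i (\<sigma> i l)) \<le> real (card {l \<in> Bl i. \<not> good i l}) * (c2 * K / 2 ^ i)"
        by (rule sum_bounded_above) (rule wt_le)
      also have "\<dots> \<le> 4 * (c2 * K / 2 ^ i)"
        using badcard[of i] i c2_nonneg K by (intro mult_right_mono) auto
      finally show "(\<Sum>l\<in>{l \<in> Bl i. \<not> good i l}. wt i (\<sigma> i l)) \<le> 4 * (c2 * K / 2 ^ i)" .
    qed
    also have "\<dots> = 4 * (c2 * K) * (\<Sum>i\<in>{j..<n}. 1 / 2 ^ i)" by (simp add: sum_distrib_left)
    also have "\<dots> \<le> 4 * (c2 * K) * (2 / 2 ^ j)"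
      using c2_nonneg K by (intro mult_left_mono geometric_tail) auto
    finally show ?thesis by simp
  qed
  have "(\<Sum>i\<in>{j..<n}. \<Sum>l\<in>Bl i. wt i (\<sigma> i l))
      = (\<Sum>i\<in>{j..<n}. \<Sum>l\<in>{l \<in> Bl i. good i l}. wt i (\<sigma> i l)) + (\<Sum>i\<in>{j..<n}. \<Sum>l\<in>{l \<in> Bl i. \<not> good i l}. wt i (\<sigma> i l))"
    unfolding sum.distrib[symmetric]
  proof (rule sum.cong[OF refl])
    fix i
    have fin: "finite (Bl i)" by (simp add: Bl_def)
    have "(\<Sum>l\<in>{l \<in> Bl i. good i l} \<union> {l \<in> Bl i. \<not> good i l}. wt i (\<sigma> i l))
        = (\<Sum>l\<in>{l \<in> Bl i. good i l}. wt i (\<sigma> i l)) + (\<Sum>l\<in>{l \<in> Bl i. \<not> good i l}. wt i (\<sigma> i l))"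
      by (rule sum.union_disjoint) (use fin in auto)
    moreover have "{l \<in> Bl i. good i l} \<union> {l \<in> Bl i. \<not> good i l} = Bl i" by blast
    ultimately show "(\<Sum>l\<in>Bl i. wt i (\<sigma> i l)) = (\<Sum>l\<in>{l \<in> Bl i. good i l}. wt i (\<sigma> i l)) + (\<Sum>l\<in>{l \<in> Bl i. \<not> good i l}. wt i (\<sigma> i l))"
      by (simp only:)
  qed
  also have "\<dots> \<le> K / 2 ^ j + 8 * c2 * K / 2 ^ j" by (rule add_mono[OF goodsum badsum])
  also have "\<dots> = c3 * K / 2 ^ j"
    unfolding c3_def distrib_right mult_1 by (rule add_divide_distrib[symmetric])
  finally show ?thesis by (simp only: Bl_def \<sigma>_def)
qed

end

section \<open>Extremal points of boxes, cones, and dyadic step functions\<close>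

definition closed_whitney :: "nat \<Rightarrow> nat \<Rightarrow> complex set" where
  "closed_whitney j k = (\<lambda>(d, y). of_real (1 - d) * zeta y) `
     ({1 / 2 ^ Suc j..1 / 2 ^ j} \<times> {real k / 2 ^ j..(real k + 1) / 2 ^ j})"

lemma whitney_subset_closed: "whitney j k \<subseteq> closed_whitney j k"
proof
  fix z assume z: "z \<in> whitney j k"
  have "z = (\<lambda>(d, y). of_real (1 - d) * zeta y) (1 - norm z, angle z)" using zeta_angle[of z] by simp
  moreover have "real k / 2 ^ j \<le> angle z" "angle z \<le> (real k + 1) / 2 ^ j"
    using z by (auto simp: whitney_def field_simps)
  ultimately show "z \<in> closed_whitney j k"
    unfolding closed_whitney_def using z by (intro image_eqI[of _ _ "(1 - norm z, angle z)"]) (auto simp: whitney_def)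
qed

lemma closed_whitney_elim:
  assumes "z \<in> closed_whitney j k"
  obtains d y where "z = of_real (1 - d) * zeta y" "1 / 2 ^ Suc j \<le> d" "d \<le> 1 / 2 ^ j"
    "real k / 2 ^ j \<le> y" "y \<le> (real k + 1) / 2 ^ j" "norm z = 1 - d" "0 < d" "d \<le> 1"
proof -
  obtain d y where dy: "z = of_real (1 - d) * zeta y" "1 / 2 ^ Suc j \<le> d" "d \<le> 1 / 2 ^ j"
    "real k / 2 ^ j \<le> y" "y \<le> (real k + 1) / 2 ^ j"
    using assms unfolding closed_whitney_def by auto
  have "(0::real) < 1 / 2 ^ Suc j" "1 / 2 ^ j \<le> (1::real)" by (auto simp: divide_le_eq_1)
  then have d: "0 < d" "d \<le> 1" using dy(2,3) by linarith+
  then have "norm z = 1 - d" by (simp only: dy(1) norm_mult norm_of_real norm_zeta) simp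
  with dy d that show ?thesis by blast
qed

lemma closed_whitney_maximum:
  fixes g :: "complex \<Rightarrow> 'a::real_normed_vector"
  assumes g: "continuous_on (ball 0 1) g"
  shows "\<exists>z\<in>closed_whitney j k. \<forall>w\<in>whitney j k. norm (g w) \<le> norm (g z)"
proof -
  have "compact (closed_whitney j k)"
    unfolding closed_whitney_def case_prod_beta
    by (intro compact_continuous_image compact_Times compact_Icc continuous_intros
        continuous_on_compose2[OF continuous_on_zeta[of UNIV]]) auto
  moreover have "closed_whitney j k \<noteq> {}"
  proof -
    have "1 / 2 ^ Suc j \<le> (1 / 2 ^ j :: real)" by (intro divide_left_mono power_increasing) auto
    moreover have "real k / 2 ^ j \<le> (real k + 1) / 2 ^ j" by (rule divide_right_mono) auto
    ultimately show ?thesis unfolding closed_whitney_def by auto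
  qed
  moreover have "closed_whitney j k \<subseteq> ball 0 1"
    by (auto elim!: closed_whitney_elim)
  then have "continuous_on (closed_whitney j k) (\<lambda>z. norm (g z))"
    by (intro continuous_on_norm continuous_on_subset[OF g])
  ultimately obtain z where "z \<in> closed_whitney j k" "\<forall>w\<in>closed_whitney j k. norm (g w) \<le> norm (g z)"
    using continuous_attains_sup by blast
  then show ?thesis using whitney_subset_closed by blast
qed

text \<open>The shifted box is at most one position away, so the angles differ by at most two arc
  lengths, that is 4 heights. The factor 8 of \<open>norm_zeta_diff_le\<close> makes this 32, and
  the height itself gives 33.\<close>

lemma closed_whitney_cone:
  assumes z: "z \<in> closed_whitney j ((k + e j) mod 2 ^ j)" and e: "e \<in> shifts"
    and t: "real k / 2 ^ j \<le> t" "t \<le> (real k + 1) / 2 ^ j"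
  shows "norm z < 1" "norm (zeta t - z) \<le> 33 * (1 - norm z)"
proof -
  define l where "l = (k + e j) mod 2 ^ j"
  obtain d y where dy: "z = of_real (1 - d) * zeta y" "1 / 2 ^ Suc j \<le> d" "d \<le> 1 / 2 ^ j"
    "real l / 2 ^ j \<le> y" "y \<le> (real l + 1) / 2 ^ j" "norm z = 1 - d" "0 < d" "d \<le> 1"
    using closed_whitney_elim[OF z[folded l_def]] by metis
  show "norm z < 1" using dy by simp
  obtain m :: int where "\<bar>int l - int k - m * 2 ^ j\<bar> \<le> 1" using shift_near[OF e] unfolding l_def by blast
  then have "real_of_int \<bar>int l - int k - m * 2 ^ j\<bar> \<le> 1" by (simp only: of_int_le_1_iff)
  then have "\<bar>real l - real k - of_int m * 2 ^ j\<bar> \<le> 1" by simp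
  moreover define E where "E = (2::real) ^ j"
  ultimately have m: "\<bar>real l - real k - of_int m * E\<bar> \<le> 1" by simp
  have E: "E > 0" by (simp add: E_def)
  have "real l \<le> y * E" "y * E \<le> real l + 1" "real k \<le> t * E" "t * E \<le> real k + 1"
    using dy(4,5) t E unfolding E_def[symmetric] by (simp_all add: field_simps)
  with m have "\<bar>t * E + of_int m * E - y * E\<bar> \<le> 2" by (simp add: abs_le_iff)
  moreover have "t * E + of_int m * E - y * E = (t + of_int m - y) * E" by (simp add: algebra_simps)
  ultimately have "\<bar>t + of_int m - y\<bar> * E \<le> 2" using E by (simp add: abs_mult)
  then have "\<bar>t + of_int m - y\<bar> \<le> 2 / E" using E by (simp add: field_simps)
  moreover have "2 / E \<le> 4 * d" using dy(2) by (simp add: E_def)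
  ultimately have "\<bar>t + of_int m - y\<bar> \<le> 4 * d" by (rule order_trans)
  then have "8 * \<bar>t + of_int m - y\<bar> \<le> 32 * d" by simp
  then have 1: "norm (zeta t - zeta y) \<le> 32 * d"
    using norm_zeta_diff_le[of "t + of_int m" y] by simp
  have "zeta y - z = of_real d * zeta y" by (simp add: dy(1) algebra_simps)
  then have "norm (zeta y - z) = norm (of_real d * zeta y)" by (rule arg_cong)
  then have "norm (zeta y - z) = d" using dy(7) by (simp add: norm_mult)
  with 1 show "norm (zeta t - z) \<le> 33 * (1 - norm z)"
    using norm_triangle_ineq[of "zeta t - zeta y" "zeta y - z"] dy(6) by simp
qed

text \<open>Inside the Stolz angle the angle of \<open>z\<close> differs from \<open>x\<close> by at
  most \<open>1 - |z|\<close>, hence by at most one arc length; the two positions then differ by at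
  most one modulo \<open>2 ^ j\<close>.\<close>

lemma stolz_meets_whitney:
  assumes z: "z \<in> stolz (zeta x)" "z \<in> whitney j k" and k: "k < 2 ^ j" and x: "0 \<le> x"
  shows "\<exists>e\<in>shifts. k = (nat \<lfloor>2 ^ j * x\<rfloor> + e j) mod 2 ^ j"
proof -
  define d where "d = 1 - norm z"
  define k0 where "k0 = nat \<lfloor>2 ^ j * x\<rfloor>"
  have d: "0 < d" "d \<le> 1 / 2 ^ j" using z(2) by (auto simp: whitney_def d_def)
  have "norm (z - zeta x) \<le> 3 * d" unfolding d_def by (rule stolz_dist[OF _ z(1)]) simp
  moreover have "zeta (angle z) - z = of_real d * zeta (angle z)"
    by (subst (2) zeta_angle) (simp add: d_def algebra_simps)
  then have "norm (zeta (angle z) - z) = norm (of_real d * zeta (angle z))" by (rule arg_cong)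
  then have "norm (zeta (angle z) - z) = d" using d by (simp add: norm_mult)
  ultimately have "norm (zeta (angle z) - zeta x) \<le> 4 * d"
    using norm_triangle_ineq[of "zeta (angle z) - z" "z - zeta x"] by simp
  moreover obtain m :: int where "4 * \<bar>angle z - x - of_int m\<bar> \<le> norm (zeta (angle z) - zeta x)"
    using norm_zeta_diff_ge by blast
  ultimately have "4 * \<bar>angle z - x - of_int m\<bar> \<le> 4 * d" by (rule order_trans[rotated])
  then have "\<bar>angle z - x - of_int m\<bar> \<le> d" by simp
  then have "\<bar>angle z - x - of_int m\<bar> \<le> 1 / 2 ^ j" using d(2) by (rule order_trans)
  then have "2 ^ j * \<bar>angle z - x - of_int m\<bar> \<le> 2 ^ j * (1 / 2 ^ j)" by (rule mult_left_mono) simp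
  then have "\<bar>2 ^ j * (angle z - x - of_int m)\<bar> \<le> 1" by (simp add: abs_mult)
  then have near: "\<bar>2 ^ j * angle z - 2 ^ j * x - of_int (2 ^ j * m)\<bar> \<le> 1" by (simp add: algebra_simps)
  have k0: "of_int (int k0) \<le> 2 ^ j * x" "2 ^ j * x < of_int (int k0) + 1"
    using x floor_correct[of "2 ^ j * x"] by (auto simp: k0_def)
  have kz: "of_int (int k) \<le> 2 ^ j * angle z" "2 ^ j * angle z < of_int (int k) + 1"
    using z(2) by (auto simp: whitney_def)
  have "real_of_int (int k - int k0 - 2 ^ j * m) < 2" "real_of_int (int k - int k0 - 2 ^ j * m) > - 2"
    using near k0 kz unfolding abs_le_iff of_int_diff by linarith+
  then have "int k - int k0 - 2 ^ j * m < 2" "int k - int k0 - 2 ^ j * m > - 2" by linarith+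
  then consider "int k = int k0 + 2 ^ j * m" | "int k = int k0 + 1 + 2 ^ j * m" | "int k = int k0 - 1 + 2 ^ j * m"
    by linarith
  then show ?thesis
  proof cases
    case 1
    then have "int k mod 2 ^ j = int k0 mod 2 ^ j" by simp
    then have "int (k mod 2 ^ j) = int (k0 mod 2 ^ j)" by (simp add: zmod_int)
    then have "k mod 2 ^ j = (k0 + 0) mod 2 ^ j" by simp
    then show ?thesis using k unfolding k0_def[symmetric] by (intro bexI[of _ "\<lambda>j. 0"]) (auto simp: shifts_def)
  next
    case 2
    then have "int k mod 2 ^ j = (int k0 + 1) mod 2 ^ j" by simp
    then have "int (k mod 2 ^ j) = int ((k0 + 1) mod 2 ^ j)" by (simp add: zmod_int add.commute)
    then have "k mod 2 ^ j = (k0 + 1) mod 2 ^ j" by (simp only: of_nat_eq_iff)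
    then show ?thesis using k unfolding k0_def[symmetric] by (intro bexI[of _ "\<lambda>j. 1"]) (auto simp: shifts_def)
  next
    case 3
    have "int k0 + (2 ^ j - 1) = int k + 2 ^ j * (1 - m)" using 3 by (simp add: algebra_simps)
    then have "(int k0 + (2 ^ j - 1)) mod 2 ^ j = int k mod 2 ^ j" by simp
    moreover have "int (k0 + (2 ^ j - 1)) = int k0 + (2 ^ j - 1)"
    proof -
      have "int (2 ^ j - 1) = 2 ^ j - 1" by (simp add: of_nat_diff)
      then show ?thesis by (simp only: of_nat_add)
    qed
    ultimately have "int ((k0 + (2 ^ j - 1)) mod 2 ^ j) = int (k mod 2 ^ j)"
      by (simp only: zmod_int of_nat_power of_nat_numeral)
    then have "k mod 2 ^ j = (k0 + (2 ^ j - 1)) mod 2 ^ j" by (simp only: of_nat_eq_iff)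
    then show ?thesis using k unfolding k0_def[symmetric]
      by (intro bexI[of _ "\<lambda>j. 2 ^ j - 1"]) (auto simp: shifts_def)
  qed
qed

lemma floor_dyadic_div:
  fixes x :: real
  assumes "j \<le> n" "0 \<le> x"
  shows "nat \<lfloor>2 ^ j * x\<rfloor> = nat \<lfloor>2 ^ n * x\<rfloor> div 2 ^ (n - j)"
proof -
  have p: "(2::real) ^ n = 2 ^ j * 2 ^ (n - j)" using assms(1) by (simp flip: power_add)
  have "\<lfloor>2 ^ n * x / real_of_int (2 ^ (n - j))\<rfloor> = \<lfloor>2 ^ n * x\<rfloor> div 2 ^ (n - j)"
    by (rule floor_divide_real_eq_div) simp
  moreover have "2 ^ n * x / real_of_int (2 ^ (n - j)) = 2 ^ j * x" by (simp add: p)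
  ultimately have "\<lfloor>2 ^ j * x\<rfloor> = \<lfloor>2 ^ n * x\<rfloor> div 2 ^ (n - j)" by simp
  then show ?thesis using assms(2) by (simp add: nat_div_distrib nat_power_eq)
qed

text \<open>A quasi-triangle inequality through the largest term, valid on both sides of exponent
  1.\<close>

lemma sum_powr_le_card:
  fixes a :: "'i \<Rightarrow> real"
  assumes "finite I" "\<And>i. i \<in> I \<Longrightarrow> 0 \<le> a i" "0 < r"
  shows "(\<Sum>i\<in>I. a i) powr r \<le> real (card I) powr r * (\<Sum>i\<in>I. a i powr r)"
proof (cases "I = {}")
  case False
  define M where "M = Max (a ` I)"
  have "M \<in> a ` I" unfolding M_def using assms False by (intro Max_in) auto
  then obtain i0 where i0: "i0 \<in> I" "M = a i0" by blast
  have "(\<Sum>i\<in>I. a i) \<le> real (card I) * M"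
    by (rule sum_bounded_above) (use assms in \<open>simp add: M_def\<close>)
  then have "(\<Sum>i\<in>I. a i) powr r \<le> (real (card I) * M) powr r"
    using assms by (intro powr_mono2 sum_nonneg) auto
  also have "\<dots> = real (card I) powr r * M powr r" by (rule powr_mult)
  also have "M powr r \<le> (\<Sum>i\<in>I. a i powr r)"
    unfolding i0(2) by (rule member_le_sum[OF i0(1)]) (use assms in auto)
  finally show ?thesis by (simp add: mult_left_mono)
qed simp

lemma enn_powr_mono:
  assumes "a \<le> b" "0 \<le> r" shows "enn_powr a r \<le> enn_powr b r"
proof (cases "b = \<infinity>")
  case False
  then have "a \<noteq> \<infinity>" using assms by (auto simp: top_unique)
  moreover have "enn2real a powr r \<le> enn2real b powr r"
    using False assms by (intro powr_mono2 enn2real_mono) (auto simp: less_top)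
  ultimately show ?thesis using False by (simp add: enn_powr_def ennreal_leI)
qed (simp add: enn_powr_def)

text \<open>Moves the power inside the supremum: a finite value \<open>y\<close> on the right bounds
  every \<open>S n\<close> by \<open>y powr (1 / r)\<close>, hence also \<open>X\<close>.\<close>

lemma enn_powr_le_SUP:
  assumes "X \<le> (SUP n. ennreal (S n))" "\<And>n. 0 \<le> S n" "0 < r"
  shows "enn_powr X r \<le> (SUP n. ennreal (S n powr r))"
proof (cases "SUP n. ennreal (S n powr r)")
  case (real y)
  have "S n \<le> y powr (1 / r)" for n
  proof -
    have "ennreal (S n powr r) \<le> ennreal y" unfolding real(2)[symmetric] by (rule SUP_upper) simp
    then have "S n powr r \<le> y" using real(1) by simp
    then have "(S n powr r) powr (1 / r) \<le> y powr (1 / r)" using assms(3) by (intro powr_mono2) auto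
    then show ?thesis using assms(2,3) by (simp add: powr_powr)
  qed
  then have "(SUP n. ennreal (S n)) \<le> ennreal (y powr (1 / r))" by (intro SUP_least ennreal_leI)
  then have "X \<le> ennreal (y powr (1 / r))" using assms(1) by (rule order_trans[rotated])
  then have "enn_powr X r \<le> enn_powr (ennreal (y powr (1 / r))) r" using assms(3) by (intro enn_powr_mono) auto
  also have "\<dots> = ennreal y" using real(1) assms(3) by (simp add: enn_powr_def powr_powr)
  finally show ?thesis using real by simp
next
  case top
  show ?thesis unfolding top by (rule top_greatest)
qed

lemma nn_integral_dyadic_step:
  fixes G :: "nat \<Rightarrow> real"
  assumes "\<And>i. 0 \<le> G i"
  shows "(\<integral>\<^sup>+x\<in>{0..<1}. ennreal (G (nat \<lfloor>2 ^ n * x :: real\<rfloor>)) \<partial>lborel) \<le> ennreal ((\<Sum>i<2 ^ n. G i) / 2 ^ n)"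
proof -
  define J where "J i = {real i / 2 ^ n..<(real i + 1) / 2 ^ n}" for i
  have "(\<integral>\<^sup>+x\<in>{0..<1}. ennreal (G (nat \<lfloor>2 ^ n * x :: real\<rfloor>)) \<partial>lborel)
      \<le> (\<integral>\<^sup>+x. (\<Sum>i<2 ^ n. ennreal (G i) * indicator (J i) x) \<partial>lborel)"
  proof (rule nn_integral_mono)
    fix x :: real
    show "ennreal (G (nat \<lfloor>2 ^ n * x\<rfloor>)) * indicator {0..<1} x \<le> (\<Sum>i<2 ^ n. ennreal (G i) * indicator (J i) x)"
    proof (cases "x \<in> {0..<1}")
      case True
      define i where "i = nat \<lfloor>2 ^ n * x\<rfloor>"
      have i: "real i \<le> 2 ^ n * x" "2 ^ n * x < real i + 1"
        using True floor_correct[of "2 ^ n * x"] by (auto simp: i_def)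
      have "2 ^ n * x < 2 ^ n * 1" using True by (intro mult_strict_left_mono) auto
      then have "real i < 2 ^ n" using i by linarith
      then have i2: "i < 2 ^ n" by (metis of_nat_less_numeral_power_cancel_iff)
      have "x \<in> J i" using i by (simp add: J_def field_simps)
      then have "ennreal (G i) * indicator {0..<1} x = ennreal (G i) * indicator (J i) x" using True by simp
      also have "\<dots> \<le> (\<Sum>i<2 ^ n. ennreal (G i) * indicator (J i) x)"
        by (rule member_le_sum) (use i2 in auto)
      finally show ?thesis by (simp add: i_def)
    qed simp
  qed
  also have "\<dots> = (\<Sum>i<2 ^ n. ennreal (G i) * emeasure lborel (J i))"
    by (subst nn_integral_sum) (auto simp: J_def nn_integral_cmult_indicator)
  also have "\<dots> = (\<Sum>i<2 ^ n. ennreal (G i / 2 ^ n))"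
  proof (rule sum.cong[OF refl])
    fix i
    have "real i / 2 ^ n \<le> (real i + 1) / 2 ^ n" by (rule divide_right_mono) auto
    then have "emeasure lborel (J i) = ennreal ((real i + 1) / 2 ^ n - real i / 2 ^ n)"
      unfolding J_def by simp
    also have "(real i + 1) / 2 ^ n - real i / 2 ^ n = 1 / 2 ^ n" by (simp add: diff_divide_distrib[symmetric])
    finally show "ennreal (G i) * emeasure lborel (J i) = ennreal (G i / 2 ^ n)"
      using assms by (simp add: ennreal_mult[symmetric])
  qed
  also have "\<dots> = ennreal ((\<Sum>i<2 ^ n. G i) / 2 ^ n)"
    using assms by (simp add: sum_divide_distrib)
  finally show ?thesis .
qed

section \<open>Orthonormal sequences\<close>

locale complex_hilbert =
  fixes sm :: "complex \<Rightarrow> 'h::{real_inner, complete_space} \<Rightarrow> 'h"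
  assumes sm: "complex_space sm"
begin

sublocale bounded_bilinear sm by (rule complex_space_bounded_bilinear[OF sm])

lemma sm_simps: "sm a (sm b x) = sm (a * b) x" "sm 1 x = x" "sm (complex_of_real r) x = r *\<^sub>R x"
    "norm (sm a x) = cmod a * norm x"
  using sm unfolding complex_space_def by auto

lemma sm_split: "sm a x = Re a *\<^sub>R x + Im a *\<^sub>R sm \<i> x"
proof -
  have "a = of_real (Re a) + of_real (Im a) * \<i>" by (simp add: complex_eq_iff)
  then have "sm a x = sm (of_real (Re a)) x + sm (of_real (Im a)) (sm \<i> x)"
    using add_left[of "of_real (Re a)" "of_real (Im a) * \<i>" x] sm_simps(1)[of "of_real (Im a)" \<i> x] by simp
  then show ?thesis by (simp add: sm_simps(3))
qed

text \<open>Polarisation: scalars multiply the norm by their modulus, and the norm determines the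
  real inner product.\<close>

lemma inner_sm_sm: "inner (sm a x) (sm a y) = (cmod a)\<^sup>2 * inner x y"
proof -
  have "norm (sm a x + sm a y) = cmod a * norm (x + y)" by (simp only: add_right[symmetric] sm_simps(4))
  then show ?thesis
    unfolding dot_norm sm_simps(4) by (simp only: power_mult_distrib right_diff_distrib[symmetric] times_divide_eq_right)
qed

lemma sm_minus_one: "sm (-1) x = - x"
  using minus_left[of 1 x] sm_simps(2) by simp

lemma inner_i_left: "inner (sm \<i> x) y = - inner x (sm \<i> y)"
proof -
  have "inner (sm \<i> x) (sm \<i> (sm \<i> y)) = inner x (sm \<i> y)"
    using inner_sm_sm[of \<i> x "sm \<i> y"] by simp
  moreover have "sm \<i> (sm \<i> y) = - y" by (simp add: sm_simps(1) sm_minus_one)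
  ultimately show ?thesis by simp
qed

text \<open>Orthogonality for the Hermitian product with real part \<open>inner\<close>; the two
  conditions are its real and its imaginary part.\<close>

definition ortho :: "'h \<Rightarrow> 'h \<Rightarrow> bool" where
  "ortho x y \<longleftrightarrow> inner x y = 0 \<and> inner x (sm \<i> y) = 0"

lemma ortho_inner:
  assumes "ortho x y" shows "inner (sm a x) (sm b y) = 0"
proof -
  have "inner (sm \<i> x) (sm \<i> y) = 0" "inner (sm \<i> x) y = 0"
    using assms inner_sm_sm[of \<i> x y] inner_i_left[of x y] by (auto simp: ortho_def)
  then show ?thesis
    using assms by (subst (1 2) sm_split) (simp add: ortho_def inner_add_left inner_add_right)
qed

lemma ortho_commute: "ortho x y \<Longrightarrow> ortho y x"
  unfolding ortho_def using inner_i_left[of y x] by (simp add: inner_commute)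

lemma exists_orthonormal_next:
  assumes inf: "\<not> (\<exists>S. finite S \<and> (\<forall>x. \<exists>c. x = (\<Sum>v\<in>S. sm (c v) v)))"
    and B: "finite B" "\<And>x y. x \<in> B \<Longrightarrow> y \<in> B \<Longrightarrow> x \<noteq> y \<Longrightarrow> ortho x y" "\<And>x. x \<in> B \<Longrightarrow> norm x = 1"
  shows "\<exists>x. norm x = 1 \<and> (\<forall>b\<in>B. ortho x b)"
proof -
  obtain x where x: "\<And>c. x \<noteq> (\<Sum>v\<in>B. sm (c v) v)" using inf B(1) by blast
  \<comment> \<open>The Hermitian coefficient of \<open>x\<close> along \<open>v\<close>, assembled
    from two real inner products; this is one step of Gram-Schmidt.\<close>
  define c where "c v = Complex (inner x v) (inner x (sm \<i> v))" for v
  define y where "y = x - (\<Sum>v\<in>B. sm (c v) v)"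
  have y0: "y \<noteq> 0" using x[of c] by (simp add: y_def)
  have orth: "ortho y b" if b: "b \<in> B" for b
  proof -
    have *: "inner (\<Sum>v\<in>B. sm (c v) v) (sm a b) = inner (sm (c b) b) (sm a b)" for a
    proof -
      have "inner (\<Sum>v\<in>B. sm (c v) v) (sm a b) = (\<Sum>v\<in>B. if v = b then inner (sm (c b) b) (sm a b) else 0)"
        unfolding inner_sum_left
      proof (rule sum.cong[OF refl])
        fix v assume "v \<in> B"
        then show "inner (sm (c v) v) (sm a b) = (if v = b then inner (sm (c b) b) (sm a b) else 0)"
          using ortho_inner[OF B(2)[of v b], of "c v" a] b by auto
      qed
      then show ?thesis using b B(1) by simp
    qed
    have bb: "inner b b = 1" using B(3)[OF b] by (simp add: norm_eq_1)
    have ib: "inner b (sm \<i> b) = 0" "inner (sm \<i> b) b = 0"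
      using inner_i_left[of b b] by (auto simp: inner_commute[of "sm \<i> b" b])
    have ii: "inner (sm \<i> b) (sm \<i> b) = 1" using inner_sm_sm[of \<i> b b] bb by simp
    have "inner y b = 0"
      using *[of 1] unfolding y_def inner_diff_left sm_simps(2)
      by (subst (asm) (2) sm_split) (simp add: inner_add_left bb ib c_def)
    moreover have "inner y (sm \<i> b) = 0"
      using *[of \<i>] unfolding y_def inner_diff_left
      by (subst (asm) (2) sm_split) (simp add: inner_add_left bb ib ii c_def)
    ultimately show ?thesis by (simp add: ortho_def)
  qed
  have "ortho (y /\<^sub>R norm y) b" if "b \<in> B" for b
    using orth[OF that] by (simp add: ortho_def)
  moreover have "norm (y /\<^sub>R norm y) = 1" using y0 by simp
  ultimately show ?thesis by blast
qed

text \<open>Each new vector depends on all earlier ones, so the recursion builds the finite sets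
  \<open>Bs n\<close> and the sequence is read off from them.\<close>

lemma exists_orthonormal_sequence:
  assumes inf: "\<not> (\<exists>S. finite S \<and> (\<forall>x. \<exists>c. x = (\<Sum>v\<in>S. sm (c v) v)))"
  obtains e :: "nat \<Rightarrow> 'h" where "\<And>n. norm (e n) = 1" "\<And>m n. m \<noteq> n \<Longrightarrow> ortho (e m) (e n)"
proof -
  define P where "P B \<longleftrightarrow> finite B \<and> (\<forall>x\<in>B. \<forall>y\<in>B. x \<noteq> y \<longrightarrow> ortho x y) \<and> (\<forall>x\<in>B. norm x = 1)" for B :: "'h set"
  define nx where "nx B = (SOME x. norm x = 1 \<and> (\<forall>b\<in>B. ortho x b))" for B
  define Bs where "Bs = rec_nat {} (\<lambda>_ B. insert (nx B) B)"
  have Bs: "Bs 0 = {}" "Bs (Suc n) = insert (nx (Bs n)) (Bs n)" for n by (simp_all add: Bs_def)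
  have nx: "norm (nx B) = 1 \<and> (\<forall>b\<in>B. ortho (nx B) b)" if "P B" for B
    unfolding nx_def
    by (rule someI_ex, rule exists_orthonormal_next[OF inf]) (use that in \<open>auto simp: P_def\<close>)
  have PB: "P (Bs n)" for n
  proof (induction n)
    case (Suc n)
    show ?case unfolding Bs(2) using Suc nx[OF Suc] ortho_commute by (auto simp: P_def)
  qed (simp add: Bs(1) P_def)
  define e where "e n = nx (Bs n)" for n
  have mem: "e m \<in> Bs n" if "m < n" for m n
    using that
  proof (induction n)
    case (Suc n)
    then show ?case by (cases "m = n") (auto simp: Bs(2) e_def)
  qed simp
  have o: "ortho (e n) (e m)" if "m < n" for m n
    using nx[OF PB[of n]] mem[OF that] by (simp add: e_def)
  show ?thesis
  proof (rule that[of e])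
    show "norm (e n) = 1" for n using nx[OF PB[of n]] by (simp add: e_def)
    show "ortho (e m) (e n)" if "m \<noteq> n" for m n
      using that o ortho_commute by (metis linorder_neqE_nat)
  qed
qed

lemma norm_sum_orthonormal:
  fixes e :: "nat \<Rightarrow> 'h" and n :: nat
  assumes e: "\<And>n. norm (e n) = 1" "\<And>m n. m \<noteq> n \<Longrightarrow> ortho (e m) (e n)"
  shows "(norm (\<Sum>i<n. sm (a i) (e i)))\<^sup>2 = (\<Sum>i<n. (cmod (a i))\<^sup>2)"
proof (induction n)
  case (Suc n)
  have "inner (\<Sum>i<n. sm (a i) (e i)) (sm (a n) (e n)) = 0"
    unfolding inner_sum_left by (rule sum.neutral) (auto intro!: ortho_inner e(2))
  then have "(norm (\<Sum>i<Suc n. sm (a i) (e i)))\<^sup>2 = (norm (\<Sum>i<n. sm (a i) (e i)))\<^sup>2 + (norm (sm (a n) (e n)))\<^sup>2"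
    by (simp add: power2_norm_eq_inner inner_add_left inner_add_right inner_commute)
  then show ?case using Suc e(1) by (simp add: sm_simps(4))
qed simp

end

section \<open>The product estimate\<close>

context carleson_function
begin

definition neighbour :: "(nat \<Rightarrow> nat) \<Rightarrow> nat \<Rightarrow> nat \<Rightarrow> nat" where
  "neighbour e j k = (k + e j) mod 2 ^ j"

text \<open>The leaves are the \<open>2 ^ n\<close> arcs of generation \<open>n\<close>, with
  ancestors \<open>i div 2 ^ (n - j)\<close>. The weight \<open>2 ^ j * wt\<close> is the mass of a
  box relative to its arc length, and the packing condition is \<open>shifted_carleson\<close> times
  the number of leaves.\<close>

lemma tree_bound:
  fixes b :: "nat \<Rightarrow> nat \<Rightarrow> real"
  assumes e: "e \<in> shifts" and n: "0 < n" and b: "\<And>j k. 0 \<le> b j k" and r: "0 < r"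
  shows "(\<Sum>i<2 ^ n. (\<Sum>j<n. 2 ^ j * wt j (neighbour e j (i div 2 ^ (n - j))) * b j (neighbour e j (i div 2 ^ (n - j)))) powr r)
    \<le> (max 1 r * (c3 * K)) powr r * (\<Sum>i<2 ^ n. Max ((\<lambda>j. b j (neighbour e j (i div 2 ^ (n - j)))) ` {..<n}) powr r)"
proof -
  interpret cf: carleson_filtration "{..<(2::nat) ^ n}" "\<lambda>j i. i div 2 ^ (n - j)" n
    "\<lambda>j i. 2 ^ j * wt j (neighbour e j (i div 2 ^ (n - j)))" "c3 * K"
  proof
    fix j i i' :: nat assume eq: "i div 2 ^ (n - Suc j) = i' div 2 ^ (n - Suc j)"
    show "i div 2 ^ (n - j) = i' div 2 ^ (n - j)"
    \<comment> \<open>For \<open>j \<ge> n\<close> the truncated difference \<open>n - j\<close> is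
      0 and every leaf is its own ancestor.\<close>
    proof (cases "j < n")
      case True
      then have "n - j = Suc (n - Suc j)" by simp
      then have "l div 2 ^ (n - j) = l div 2 ^ (n - Suc j) div 2" for l :: nat
        by (simp add: div_mult2_eq power_Suc2 del: power_Suc)
      then show ?thesis using eq by simp
    next
      case False
      then show ?thesis using eq by simp
    qed
  next
    fix j b :: nat assume j: "j < n"
    let ?A = "{i \<in> {..<2 ^ n}. i div 2 ^ (n - j) = b}"
    let ?a = "\<lambda>i l. 2 ^ i * wt i (neighbour e i (l div 2 ^ (n - i)))"
    show "(\<Sum>i | i \<in> {..<2 ^ n} \<and> i div 2 ^ (n - j) = b. \<Sum>m\<in>{j..<n}. ?a m i) \<le> c3 * K * real (card ?A)"
    proof (cases "b < 2 ^ j")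
      case True
      have A: "?A = {b * 2 ^ (n - j)..<Suc b * 2 ^ (n - j)}"
      proof -
        have "Suc b * 2 ^ (n - j) \<le> 2 ^ j * 2 ^ (n - j)" using True by (intro mult_le_mono1) simp
        then have "Suc b * 2 ^ (n - j) \<le> 2 ^ n" using j by (simp flip: power_add)
        note le = this
        have iff: "i div 2 ^ (n - j) = b \<longleftrightarrow> b * 2 ^ (n - j) \<le> i \<and> i < Suc b * 2 ^ (n - j)" for i
        proof
          assume "i div 2 ^ (n - j) = b"
          then show "b * 2 ^ (n - j) \<le> i \<and> i < Suc b * 2 ^ (n - j)"
            using div_times_less_eq_dividend[of i "2 ^ (n - j)"] dividend_less_div_times[of "2 ^ (n - j)" i] by simp
        next
          assume "b * 2 ^ (n - j) \<le> i \<and> i < Suc b * 2 ^ (n - j)"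
          then show "i div 2 ^ (n - j) = b" by (intro div_nat_eqI) (simp_all add: mult.commute)
        qed
        show ?thesis
        proof (rule set_eqI)
          fix i
          show "i \<in> ?A \<longleftrightarrow> i \<in> {b * 2 ^ (n - j)..<Suc b * 2 ^ (n - j)}"
            unfolding mem_Collect_eq iff lessThan_iff atLeastLessThan_iff using le by linarith
        qed
      qed
      have "(\<Sum>i\<in>?A. \<Sum>m\<in>{j..<n}. ?a m i) = (\<Sum>m\<in>{j..<n}. \<Sum>i\<in>?A. ?a m i)" by (rule sum.swap)
      also have "\<dots> = (\<Sum>m\<in>{j..<n}. 2 ^ n * (\<Sum>l\<in>{b * 2 ^ (m - j)..<Suc b * 2 ^ (m - j)}. wt m ((l + e m) mod 2 ^ m)))"
      proof (rule sum.cong[OF refl])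
        fix m assume m: "m \<in> {j..<n}"
        have p: "(2::nat) ^ (n - j) = 2 ^ (m - j) * 2 ^ (n - m)" using m by (simp flip: power_add)
        have "(\<Sum>i\<in>?A. ?a m i) = (\<Sum>i\<in>{b * 2 ^ (m - j) * 2 ^ (n - m)..<Suc b * 2 ^ (m - j) * 2 ^ (n - m)}. ?a m i)"
          by (subst A) (simp only: p mult.assoc)
        also have "\<dots> = real (2 ^ (n - m)) * (\<Sum>l\<in>{b * 2 ^ (m - j)..<Suc b * 2 ^ (m - j)}. 2 ^ m * wt m (neighbour e m l))"
          by (rule sum_div_block) (auto intro: mult_le_mono1)
        also have "\<dots> = 2 ^ (n - m) * 2 ^ m * (\<Sum>l\<in>{b * 2 ^ (m - j)..<Suc b * 2 ^ (m - j)}. wt m (neighbour e m l))"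
          by (simp add: sum_distrib_left mult.assoc)
        also have "(2::real) ^ (n - m) * 2 ^ m = 2 ^ n" using m by (simp flip: power_add)
        finally show "(\<Sum>i\<in>?A. ?a m i) = 2 ^ n * (\<Sum>l\<in>{b * 2 ^ (m - j)..<Suc b * 2 ^ (m - j)}. wt m ((l + e m) mod 2 ^ m))"
          by (simp only: neighbour_def)
      qed
      also have "\<dots> = 2 ^ n * (\<Sum>m\<in>{j..<n}. \<Sum>l\<in>{b * 2 ^ (m - j)..<Suc b * 2 ^ (m - j)}. wt m ((l + e m) mod 2 ^ m))"
        by (simp only: sum_distrib_left)
      also have "\<dots> \<le> 2 ^ n * (c3 * K / 2 ^ j)"
        by (intro mult_left_mono shifted_carleson e True) simp
      also have "(2::real) ^ n = 2 ^ j * 2 ^ (n - j)" using j by (simp flip: power_add)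
      also have "2 ^ j * 2 ^ (n - j) * (c3 * K / 2 ^ j) = c3 * K * real (card ?A)"
        unfolding A by simp
      finally show ?thesis .
    next
      case False
      have A: "?A = {}"
      proof -
        have "i div 2 ^ (n - j) < 2 ^ j" if "i < 2 ^ n" for i :: nat
          by (rule less_mult_imp_div_less) (use that j in \<open>simp flip: power_add\<close>)
        then show ?thesis using False by auto
      qed
      show ?thesis unfolding A by (simp only: sum.empty card.empty of_nat_0 mult_zero_right order_refl)
    qed
  qed (use wt_nonneg c3_nonneg K in auto)
  show ?thesis
    by (rule cf.sum_powr_le[OF _ b n r]) (simp add: cf.adapted_def)
qed

text \<open>36 is the aperture 33 of the boxes plus the 3 in the constant of
  \<open>hardy_maximal\<close>.\<close>

definition maximal_const :: "real \<Rightarrow> real" where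
  "maximal_const p = 16 * 36 ^ 4 * 8 powr p"

text \<open>6 counts three neighbours, doubled by the factor in \<open>layer\<close>, inside the
  power; 3 counts the neighbours again in the sum of the powers. Neither \<open>K\<close> nor
  \<open>h\<close> enters.\<close>

definition tent_const :: "real \<Rightarrow> real" where
  "tent_const p = 6 powr (p / q) * (3 * ((max 1 (p / q) * c3) powr (p / q) * maximal_const p))"

context
  fixes sm :: "complex \<Rightarrow> 'a::real_normed_vector \<Rightarrow> 'a" and g :: "complex \<Rightarrow> 'a" and p :: real
    and zc :: "nat \<Rightarrow> nat \<Rightarrow> complex"
  assumes sm: "complex_space sm" and g: "c_analytic_on sm (ball 0 1) g" and p: "0 < p"
    and fin: "hardy_pow p g < \<infinity>"
    and zc: "\<And>j k. zc j k \<in> closed_whitney j k" "\<And>j k w. w \<in> whitney j k \<Longrightarrow> norm (g w) \<le> norm (g (zc j k))"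
begin

definition top_val :: "nat \<Rightarrow> nat \<Rightarrow> real" where
  "top_val j k = norm (g (zc j k)) powr q"

text \<open>For each leaf the maximum along its branch is attained in a generation
  \<open>J i\<close>, and the point \<open>z i\<close> of that box sees the whole arc of the leaf
  with aperture 33. The exponent \<open>p / q\<close> turns the power \<open>q\<close> of
  \<open>norm g\<close> into \<open>p\<close>, so the left-hand side is a discretised maximal
  function.\<close>

lemma top_val_maximal:
  assumes e: "e \<in> shifts" and n: "0 < n"
  shows "(\<Sum>i<2 ^ n. Max ((\<lambda>j. top_val j (neighbour e j (i div 2 ^ (n - j)))) ` {..<n}) powr (p / q)) / 2 ^ n
    \<le> maximal_const p * enn2real (hardy_pow p g)"
proof -
  let ?b = "\<lambda>i j. top_val j (neighbour e j (i div 2 ^ (n - j)))"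
  have "\<exists>j<n. Max (?b i ` {..<n}) = ?b i j" for i
  proof -
    have "Max (?b i ` {..<n}) \<in> ?b i ` {..<n}" using n by (intro Max_in) auto
    then show ?thesis by auto
  qed
  then obtain J where J: "\<And>i. J i < n" "\<And>i. Max (?b i ` {..<n}) = ?b i (J i)" by metis
  define z where "z i = zc (J i) (neighbour e (J i) (i div 2 ^ (n - J i)))" for i
  have eq: "Max (?b i ` {..<n}) powr (p / q) = norm (g (z i)) powr p" for i
  proof -
    have "Max (?b i ` {..<n}) = norm (g (z i)) powr q"
      unfolding J(2) by (simp only: top_val_def z_def)
    then show ?thesis using q by (simp add: powr_powr)
  qed
  have z: "norm (z i) < 1 \<and> norm (zeta t - z i) \<le> 33 * (1 - norm (z i))"
    if "t \<in> {real i / real (2 ^ n)..(real i + 1) / real (2 ^ n)}" for i t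
  proof -
    define j where "j = J i"
    define k where "k = i div 2 ^ (n - j)"
    have p2: "(2::real) ^ n = 2 ^ j * 2 ^ (n - j)" using J(1)[of i] by (simp add: j_def flip: power_add)
    have "k * 2 ^ (n - j) \<le> i" "i + 1 \<le> (k + 1) * 2 ^ (n - j)"
      using dividend_less_times_div[of "2 ^ (n - j)" i] times_div_less_eq_dividend[of "2 ^ (n - j)" i]
      by (auto simp: k_def mult.commute)
    then have ki: "real (k * 2 ^ (n - j)) \<le> real i" "real (i + 1) \<le> real ((k + 1) * 2 ^ (n - j))"
      by (simp_all only: of_nat_le_iff)
    have "real k / 2 ^ j = real (k * 2 ^ (n - j)) / 2 ^ n" by (simp add: p2)
    also have "\<dots> \<le> real i / 2 ^ n" by (rule divide_right_mono[OF ki(1)]) simp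
    also have "\<dots> \<le> t" using that by simp
    finally have 1: "real k / 2 ^ j \<le> t" .
    have "t \<le> real (i + 1) / 2 ^ n" using that by (simp add: add.commute)
    also have "\<dots> \<le> real ((k + 1) * 2 ^ (n - j)) / 2 ^ n" by (rule divide_right_mono[OF ki(2)]) simp
    also have "\<dots> = ((real k + 1) * 2 ^ (n - j)) / (2 ^ j * 2 ^ (n - j))"
      by (simp only: p2 of_nat_mult of_nat_add of_nat_1 of_nat_power of_nat_numeral)
    also have "\<dots> = (real k + 1) / 2 ^ j" by (rule nonzero_mult_divide_mult_cancel_right) simp
    finally have 2: "t \<le> (real k + 1) / 2 ^ j" .
    have "z i \<in> closed_whitney j ((k + e j) mod 2 ^ j)"
      unfolding z_def j_def k_def neighbour_def by (rule zc)
    from closed_whitney_cone[OF this e 1 2] show ?thesis by blast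
  qed
  have z1: "norm (z i) < 1" for i
    using z[of "real i / real (2 ^ n)" i] by (simp add: divide_right_mono)
  have "(\<Sum>i<2 ^ n. norm (g (z i)) powr p) / real (2 ^ n) \<le> 16 * (33 + 3) ^ 4 * 8 powr p * enn2real (hardy_pow p g)"
    by (rule hardy_maximal[OF sm g p fin]) (use z z1 in auto)
  then show ?thesis by (simp add: eq maximal_const_def)
qed

text \<open>Bounds what the three boxes of generation \<open>j\<close> around position
  \<open>k\<close> contribute to the area integral; \<open>2 * 2 ^ j\<close> bounds
  \<open>1 / (1 - |z|)\<close> there.\<close>

definition layer :: "nat \<Rightarrow> nat \<Rightarrow> real" where
  "layer j k = (\<Sum>e\<in>shifts. 2 * (2 ^ j * wt j (neighbour e j k) * top_val j (neighbour e j k)))"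

lemma layer_nonneg: "0 \<le> layer j k"
  unfolding layer_def top_val_def by (intro sum_nonneg mult_nonneg_nonneg wt_nonneg) auto

lemma layer_sum_bound:
  "(\<Sum>i<2 ^ n. (\<Sum>j<n. layer j (i div 2 ^ (n - j))) powr (p / q)) / 2 ^ n
    \<le> tent_const p * K powr (p / q) * enn2real (hardy_pow p g)"
proof (cases "n = 0")
  case True
  have "0 \<le> tent_const p * K powr (p / q) * enn2real (hardy_pow p g)"
    by (simp add: tent_const_def maximal_const_def)
  then show ?thesis using True by simp
next
  case False
  then have n: "0 < n" by simp
  define r where "r = p / q"
  have r: "0 < r" using p q by (simp add: r_def)
  define H where "H = enn2real (hardy_pow p g)"
  define \<Phi> where "\<Phi> e i = (\<Sum>j<n. 2 ^ j * wt j (neighbour e j (i div 2 ^ (n - j))) * top_val j (neighbour e j (i div 2 ^ (n - j))))" for e i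
  have tv: "0 \<le> top_val j k" for j k by (simp add: top_val_def)
  have \<Phi>0: "0 \<le> \<Phi> e i" for e i
    unfolding \<Phi>_def by (intro sum_nonneg mult_nonneg_nonneg wt_nonneg tv) auto
  have lay: "(\<Sum>j<n. layer j (i div 2 ^ (n - j))) = (\<Sum>e\<in>shifts. 2 * \<Phi> e i)" for i
    unfolding layer_def \<Phi>_def sum_distrib_left by (rule sum.swap)
  have pw: "(\<Sum>j<n. layer j (i div 2 ^ (n - j))) powr r \<le> 6 powr r * (\<Sum>e\<in>shifts. \<Phi> e i powr r)" for i
  proof -
    have "(\<Sum>e\<in>shifts. 2 * \<Phi> e i) powr r \<le> real (card shifts) powr r * (\<Sum>e\<in>shifts. (2 * \<Phi> e i) powr r)"
      by (rule sum_powr_le_card[OF finite_shifts _ r]) (simp add: \<Phi>0)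
    also have "\<dots> \<le> 3 powr r * (\<Sum>e\<in>shifts. (2 * \<Phi> e i) powr r)"
      using card_shifts r by (intro mult_right_mono powr_mono2 sum_nonneg) auto
    also have "\<dots> = 3 powr r * (2 powr r * (\<Sum>e\<in>shifts. \<Phi> e i powr r))"
      by (simp add: powr_mult sum_distrib_left)
    also have "\<dots> = 6 powr r * (\<Sum>e\<in>shifts. \<Phi> e i powr r)"
      by (simp add: mult.assoc[symmetric] powr_mult[symmetric])
    finally show ?thesis unfolding lay .
  qed
  define T where "T = (max 1 r * (c3 * K)) powr r * (maximal_const p * H)"
  have T0: "0 \<le> T" by (simp add: T_def maximal_const_def H_def)
  have e: "(\<Sum>i<2 ^ n. \<Phi> e i powr r) / 2 ^ n \<le> T" if "e \<in> shifts" for e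
  proof -
    have "(\<Sum>i<2 ^ n. \<Phi> e i powr r) / 2 ^ n
      \<le> ((max 1 r * (c3 * K)) powr r * (\<Sum>i<2 ^ n. Max ((\<lambda>j. top_val j (neighbour e j (i div 2 ^ (n - j)))) ` {..<n}) powr r)) / 2 ^ n"
      unfolding \<Phi>_def by (rule divide_right_mono[OF tree_bound[OF that n tv r]]) simp
    also have "\<dots> = (max 1 r * (c3 * K)) powr r * ((\<Sum>i<2 ^ n. Max ((\<lambda>j. top_val j (neighbour e j (i div 2 ^ (n - j)))) ` {..<n}) powr r) / 2 ^ n)"
      by simp
    also have "\<dots> \<le> T"
      unfolding T_def H_def r_def by (rule mult_left_mono[OF top_val_maximal[OF that n]]) simp
    finally show ?thesis .
  qed
  have "(\<Sum>i<2 ^ n. (\<Sum>j<n. layer j (i div 2 ^ (n - j))) powr r) / 2 ^ n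
      \<le> (\<Sum>i<2 ^ n. 6 powr r * (\<Sum>e\<in>shifts. \<Phi> e i powr r)) / 2 ^ n"
    by (intro divide_right_mono sum_mono pw) simp
  also have "\<dots> = 6 powr r * (\<Sum>e\<in>shifts. (\<Sum>i<2 ^ n. \<Phi> e i powr r) / 2 ^ n)"
    by (simp only: sum_distrib_left[symmetric] sum_divide_distrib[symmetric] times_divide_eq_right sum.swap[of _ shifts])
  also have "\<dots> \<le> 6 powr r * (\<Sum>e\<in>shifts. T)" by (intro mult_left_mono sum_mono e) auto
  also have "\<dots> \<le> 6 powr r * (3 * T)"
    using card_shifts T0 by (intro mult_left_mono) (auto intro!: mult_right_mono)
  also have "\<dots> = tent_const p * K powr r * H"
    using c3_nonneg K by (simp add: T_def tent_const_def r_def[symmetric] powr_mult mult_ac)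
  finally show ?thesis by (simp add: r_def H_def)
qed

text \<open>Of the two factors \<open>1 / (1 - |z|)\<close> in the area integral, one stays in the
  masses and the other is replaced by \<open>2 ^ Suc j\<close>. A point of the Stolz angle lies in
  some box, and this is one of the three neighbours in its generation.\<close>

lemma area_le_layers:
  assumes x: "0 \<le> x"
  shows "area_q q (weighted s (\<lambda>z. sm (h z) (g z))) (zeta x)
    \<le> (SUP n. ennreal (\<Sum>j<n. layer j (nat \<lfloor>2 ^ j * x\<rfloor>)))"
proof -
  let ?W = "weighted s (\<lambda>z. sm (h z) (g z))"
  define k0 where "k0 j = nat \<lfloor>2 ^ j * x\<rfloor>" for j
  let ?nb = "\<lambda>e j. neighbour e j (k0 j)"
  define f where "f z = ennreal (F z powr q / (1 - norm z))" for z
  define tm where "tm j e z = ennreal (2 ^ Suc j * top_val j (?nb e j)) * (f z * indicator (whitney j (?nb e j)) z)" for j e z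
  have tmm: "tm j e \<in> borel_measurable borel" for j e
    unfolding tm_def[abs_def] f_def
    by (rule borel_measurable_times_ennreal[OF borel_measurable_const F_measurable_on_whitney])
  have pt: "ennreal (\<bar>?W z\<bar> powr q / (1 - norm z)\<^sup>2) * indicator (stolz (zeta x) \<inter> ball 0 1) z \<le> (\<Sum>j. \<Sum>e\<in>shifts. tm j e z)" for z
  proof (cases "z \<in> stolz (zeta x) \<inter> ball 0 1")
    case True
    then have z: "norm z < 1" "z \<in> stolz (zeta x)" by auto
    obtain j k where jk: "k < 2 ^ j" "z \<in> whitney j k" using ball_covered_by_whitney[OF z(1)] by blast
    obtain e where e: "e \<in> shifts" "k = ?nb e j"
      using stolz_meets_whitney[OF z(2) jk(2,1) x] unfolding neighbour_def k0_def by blast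
    have d: "1 / 2 ^ Suc j < 1 - norm z" "0 < 1 - norm z" using jk(2) z by (auto simp: whitney_def)
    have "1 / (1 - norm z) \<le> 1 / (1 / 2 ^ Suc j)"
      by (rule divide_left_mono) (use d in auto)
    then have d2: "1 / (1 - norm z) \<le> 2 ^ Suc j" by simp
    have W: "\<bar>?W z\<bar> powr q = F z powr q * norm (g z) powr q"
    proof -
      have "norm (sm (h z) (g z)) = cmod (h z) * norm (g z)" using sm unfolding complex_space_def by blast
      then have "\<bar>?W z\<bar> = F z * norm (g z)" by (simp add: weighted_def F_def abs_mult mult.assoc)
      then show ?thesis by (simp only: powr_mult)
    qed
    have "norm (g z) powr q * (1 / (1 - norm z)) \<le> top_val j k * 2 ^ Suc j"
      unfolding top_val_def using zc(2)[OF jk(2)] d d2 q by (intro mult_mono powr_mono2) auto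
    then have "(F z powr q / (1 - norm z)) * (norm (g z) powr q * (1 / (1 - norm z))) \<le> (F z powr q / (1 - norm z)) * (top_val j k * 2 ^ Suc j)"
      using d by (intro mult_left_mono) auto
    moreover have "\<bar>?W z\<bar> powr q / (1 - norm z)\<^sup>2 = (F z powr q / (1 - norm z)) * (norm (g z) powr q * (1 / (1 - norm z)))"
      unfolding W by (simp add: power2_eq_square)
    ultimately have "\<bar>?W z\<bar> powr q / (1 - norm z)\<^sup>2 \<le> 2 ^ Suc j * top_val j k * (F z powr q / (1 - norm z))"
      by (simp only: mult.commute mult.left_commute)
    then have "ennreal (\<bar>?W z\<bar> powr q / (1 - norm z)\<^sup>2) \<le> ennreal (2 ^ Suc j * top_val j k * (F z powr q / (1 - norm z)))"
      by (rule ennreal_leI)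
    also have "\<dots> = tm j e z"
    proof -
      have "ennreal (2 ^ Suc j * top_val j k * (F z powr q / (1 - norm z)))
        = ennreal (2 ^ Suc j * top_val j k) * ennreal (F z powr q / (1 - norm z))"
        by (rule ennreal_mult) (use d in \<open>auto simp: top_val_def\<close>)
      then show ?thesis using jk(2) by (simp only: tm_def f_def e(2)[symmetric] indicator_simps mult_1_right)
    qed
    also have "\<dots> \<le> (\<Sum>e\<in>shifts. tm j e z)" by (rule member_le_sum[OF e(1)]) (auto simp: finite_shifts)
    also have "\<dots> = (\<Sum>j\<in>{j}. \<Sum>e\<in>shifts. tm j e z)" by simp
    also have "\<dots> \<le> (\<Sum>j. \<Sum>e\<in>shifts. tm j e z)" by (rule sum_le_suminf) auto
    finally show ?thesis using True by simp
  qed simp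
  have "area_q q ?W (zeta x) \<le> (\<integral>\<^sup>+z. (\<Sum>j. \<Sum>e\<in>shifts. tm j e z) \<partial>lborel)"
    unfolding area_q_def by (rule nn_integral_mono) (rule pt)
  also have "\<dots> = (\<Sum>j. \<integral>\<^sup>+z. (\<Sum>e\<in>shifts. tm j e z) \<partial>lborel)"
    using tmm by (intro nn_integral_suminf borel_measurable_sum) simp
  also have "\<dots> = (\<Sum>j. \<Sum>e\<in>shifts. \<integral>\<^sup>+z. tm j e z \<partial>lborel)"
    using tmm by (subst nn_integral_sum) simp_all
  also have "\<dots> = (\<Sum>j. ennreal (layer j (k0 j)))"
  proof -
    have "(\<integral>\<^sup>+z. tm j e z \<partial>lborel) = ennreal (2 * (2 ^ j * wt j (?nb e j) * top_val j (?nb e j)))" for j e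
    proof -
      have "(\<integral>\<^sup>+z. tm j e z \<partial>lborel) = ennreal (2 ^ Suc j * top_val j (?nb e j)) * mass j (?nb e j)"
        unfolding tm_def f_def mass_def by (rule nn_integral_cmult) (use F_measurable_on_whitney in simp)
      also have "\<dots> = ennreal (2 ^ Suc j * top_val j (?nb e j) * wt j (?nb e j))"
        unfolding mass_eq by (rule ennreal_mult[symmetric]) (auto simp: top_val_def wt_nonneg)
      finally show ?thesis by (simp add: mult_ac)
    qed
    then have "(\<Sum>e\<in>shifts. \<integral>\<^sup>+z. tm j e z \<partial>lborel) = ennreal (layer j (k0 j))" for j
      unfolding layer_def by (simp add: top_val_def wt_nonneg)
    then show ?thesis by simp
  qed
  also have "\<dots> = (SUP n. \<Sum>j<n. ennreal (layer j (k0 j)))" by (rule suminf_eq_SUP)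
  also have "\<dots> = (SUP n. ennreal (\<Sum>j<n. layer j (k0 j)))" by (simp add: layer_nonneg)
  finally show ?thesis by (simp only: k0_def)
qed

text \<open>The first \<open>n\<close> generations give a step function on the arcs of generation
  \<open>n\<close>, to which the tree estimate applies with a constant independent of
  \<open>n\<close>; monotone convergence removes the truncation.\<close>

lemma tent_pow_product_aux:
  "tent_pow p q (weighted s (\<lambda>z. sm (h z) (g z))) \<le> ennreal (tent_const p * K powr (p / q) * enn2real (hardy_pow p g))"
proof -
  define r where "r = p / q"
  have r: "0 < r" using p q by (simp add: r_def)
  let ?W = "weighted s (\<lambda>z. sm (h z) (g z))"
  define S where "S n x = (\<Sum>j<n. layer j (nat \<lfloor>2 ^ j * x\<rfloor>))" for n and x :: real
  have S0: "0 \<le> S n x" for n x unfolding S_def by (intro sum_nonneg layer_nonneg)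
  have meas: "(\<lambda>x. ennreal (S n x powr r) * indicator {0..<1} x) \<in> borel_measurable borel" for n
  proof -
    have "(\<lambda>x::real. layer j (nat \<lfloor>2 ^ j * x\<rfloor>)) \<in> borel_measurable borel" for j
    proof (rule measurable_compose[of "\<lambda>x::real. nat \<lfloor>2 ^ j * x\<rfloor>" borel "count_space UNIV"])
      show "(\<lambda>x::real. nat \<lfloor>2 ^ j * x\<rfloor>) \<in> borel \<rightarrow>\<^sub>M count_space UNIV" by measurable
    qed simp
    then show ?thesis unfolding S_def by measurable
  qed
  have step: "(\<integral>\<^sup>+x. ennreal (S n x powr r) * indicator {0..<1} x \<partial>lborel)
      \<le> ennreal (tent_const p * K powr r * enn2real (hardy_pow p g))" for n
  proof -
    define G where "G i = (\<Sum>j<n. layer j (i div 2 ^ (n - j))) powr r" for i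
    have "(\<integral>\<^sup>+x. ennreal (S n x powr r) * indicator {0..<1} x \<partial>lborel)
        = (\<integral>\<^sup>+x\<in>{0..<1}. ennreal (G (nat \<lfloor>2 ^ n * x :: real\<rfloor>)) \<partial>lborel)"
    proof (rule nn_integral_cong)
      fix x :: real
      show "ennreal (S n x powr r) * indicator {0..<1} x = ennreal (G (nat \<lfloor>2 ^ n * x\<rfloor>)) * indicator {0..<1} x"
      proof (cases "x \<in> {0..<1}")
        case True
        have "S n x = (\<Sum>j<n. layer j (nat \<lfloor>2 ^ n * x\<rfloor> div 2 ^ (n - j)))"
          unfolding S_def by (intro sum.cong refl arg_cong[of _ _ "layer _"] floor_dyadic_div) (use True in auto)
        then show ?thesis by (simp add: G_def)
      qed simp
    qed
    also have "\<dots> \<le> ennreal ((\<Sum>i<2 ^ n. G i) / 2 ^ n)" by (rule nn_integral_dyadic_step) (simp add: G_def)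
    also have "\<dots> \<le> ennreal (tent_const p * K powr r * enn2real (hardy_pow p g))"
      unfolding G_def r_def by (rule ennreal_leI[OF layer_sum_bound])
    finally show ?thesis .
  qed
  have "tent_pow p q ?W = (\<integral>\<^sup>+x. enn_powr (area_q q ?W (zeta x)) r * indicator {0..1} x \<partial>lborel)"
    by (simp add: tent_pow_def r_def)
  also have "\<dots> \<le> (\<integral>\<^sup>+x. (SUP n. ennreal (S n x powr r) * indicator {0..<1} x) \<partial>lborel)"
  proof (rule nn_integral_mono_AE)
    \<comment> \<open>At \<open>x = 1\<close> the floor would be \<open>2 ^ j\<close>, beyond the
      last position; this single point is discarded as a null set.\<close>
    have "AE x in lborel. x \<noteq> (1::real)" by (rule AE_lborel_singleton)
    then show "AE x in lborel. enn_powr (area_q q ?W (zeta x)) r * indicator {0..1} x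
        \<le> (SUP n. ennreal (S n x powr r) * indicator {0..<1} x)"
    proof eventually_elim
      case (elim x)
      show ?case
      proof (cases "x \<in> {0..1}")
        case True
        then have x: "x \<in> {0..<1}" using elim by auto
        have "area_q q ?W (zeta x) \<le> (SUP n. ennreal (S n x))"
          unfolding S_def by (rule area_le_layers) (use x in simp)
        then have "enn_powr (area_q q ?W (zeta x)) r \<le> (SUP n. ennreal (S n x powr r))"
          by (rule enn_powr_le_SUP[OF _ S0 r])
        then show ?thesis using x by simp
      qed simp
    qed
  qed
  also have "\<dots> = (SUP n. \<integral>\<^sup>+x. ennreal (S n x powr r) * indicator {0..<1} x \<partial>lborel)"
  proof (rule nn_integral_monotone_convergence_SUP)
    have "S m x \<le> S n x" if "m \<le> n" for m n x
      unfolding S_def by (rule sum_mono2) (use that layer_nonneg in auto)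
    then show "incseq (\<lambda>n x. ennreal (S n x powr r) * indicator {0..<1} x)"
      using S0 r by (intro incseq_SucI le_funI mult_right_mono ennreal_leI powr_mono2) auto
  qed (use meas in simp)
  also have "\<dots> \<le> ennreal (tent_const p * K powr r * enn2real (hardy_pow p g))"
    by (rule SUP_least) (rule step)
  finally show ?thesis by (simp only: r_def)
qed

end

lemma tent_pow_product:
  fixes g :: "complex \<Rightarrow> 'a::real_normed_vector"
  assumes sm: "complex_space sm" and g: "c_analytic_on sm (ball 0 1) g" and p: "0 < p"
    and fin: "hardy_pow p g < \<infinity>"
  shows "tent_pow p q (weighted s (\<lambda>z. sm (h z) (g z)))
    \<le> ennreal (tent_const p * K powr (p / q) * enn2real (hardy_pow p g))"
proof -
  have "\<forall>j k. \<exists>z\<in>closed_whitney j k. \<forall>w\<in>whitney j k. norm (g w) \<le> norm (g z)"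
    using closed_whitney_maximum[OF c_analytic_continuous_on[OF g]] by blast
  then obtain zc where "\<And>j k. zc j k \<in> closed_whitney j k"
    "\<And>j k w. w \<in> whitney j k \<Longrightarrow> norm (g w) \<le> norm (g (zc j k))"
    by metis
  from tent_pow_product_aux[OF sm g p fin this] show ?thesis .
qed

end

section \<open>A function that is not a product\<close>

text \<open>Taylor coefficients of \<open>(1 - x) powr s\<close>; for \<open>s < 0\<close> they are
  the nonnegative numbers \<open>pochhammer (- s) n / fact n\<close>.\<close>

definition bcoeff :: "real \<Rightarrow> nat \<Rightarrow> real" where
  "bcoeff s n = (-1) ^ n * (s gchoose n)"

lemma bcoeff_nonneg: "s < 0 \<Longrightarrow> 0 \<le> bcoeff s n"
proof -
  assume "s < 0"
  have "bcoeff s n = ((-1) ^ n * (-1) ^ n) * (pochhammer (- s) n / fact n)"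
    unfolding bcoeff_def gbinomial_pochhammer by simp
  also have "(-1) ^ n * (-1) ^ n = (1::real)" by (simp flip: power_mult_distrib)
  finally show ?thesis using pochhammer_nonneg[of "- s" n] \<open>s < 0\<close> by simp
qed

lemma bcoeff_sums:
  assumes "\<bar>x\<bar> < 1" shows "(\<lambda>n. bcoeff s n * x ^ n) sums (1 - x) powr s"
proof -
  have "(\<lambda>n. (s gchoose n) * (- x) ^ n) sums (1 + (- x)) powr s"
    by (rule gen_binomial_real) (use assms in simp)
  moreover have "(s gchoose n) * (- x) ^ n = bcoeff s n * x ^ n" for n
    unfolding bcoeff_def power_minus[of x] by simp
  ultimately show ?thesis by simp
qed

text \<open>Square roots, so that orthonormality turns the squared norm of the series into the
  binomial series in \<open>|z|^2\<close>.\<close>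

definition ecoeff :: "real \<Rightarrow> nat \<Rightarrow> real" where
  "ecoeff s n = sqrt (bcoeff s n)"

lemma ecoeff_nonneg: "s < 0 \<Longrightarrow> 0 \<le> ecoeff s n"
  unfolding ecoeff_def using bcoeff_nonneg by simp

text \<open>The bound \<open>sqrt b \<le> 1 + b\<close> compares with a geometric series plus the
  binomial series itself.\<close>

lemma ecoeff_summable:
  assumes s: "s < 0" and x: "norm x < 1"
  shows "summable (\<lambda>n. ecoeff s n * x ^ n :: real)"
proof (rule summable_comparison_test')
  have "summable (\<lambda>n. \<bar>x\<bar> ^ n + bcoeff s n * \<bar>x\<bar> ^ n)"
    using x bcoeff_sums[of "\<bar>x\<bar>" s] by (intro summable_add summable_geometric) (auto simp: sums_iff)
  then show "summable (\<lambda>n. (1 + bcoeff s n) * \<bar>x\<bar> ^ n)" by (simp add: distrib_right)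
  fix n :: nat
  have "ecoeff s n \<le> 1 + bcoeff s n"
  proof -
    have "0 \<le> (ecoeff s n - 1)\<^sup>2" by simp
    also have "\<dots> = bcoeff s n - 2 * ecoeff s n + 1"
      using bcoeff_nonneg[OF s, of n] by (simp add: power2_diff ecoeff_def)
    finally show ?thesis using ecoeff_nonneg[OF s, of n] by linarith
  qed
  then show "norm (ecoeff s n * x ^ n) \<le> (1 + bcoeff s n) * \<bar>x\<bar> ^ n"
    using ecoeff_nonneg[OF s, of n] by (simp add: abs_mult power_abs mult_right_mono)
qed

lemma ecoeff_deriv_summable:
  assumes s: "s < 0" and x: "norm x < 1"
  shows "summable (\<lambda>n. real n * ecoeff s n * x ^ (n - 1))"
proof -
  have "summable (\<lambda>n. diffs (ecoeff s) n * x ^ n)"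
    by (rule termdiff_converges[OF x ecoeff_summable[OF s]])
  then have "summable (\<lambda>n. real (Suc n) * ecoeff s (Suc n) * x ^ (Suc n - 1))"
    by (simp add: diffs_def mult_ac)
  then show ?thesis by (rule summable_Suc_iff[THEN iffD1])
qed

lemma ecoeff_deriv2_summable:
  assumes s: "s < 0" and x: "norm x < 1"
  shows "summable (\<lambda>n. real n * real (n - 1) * ecoeff s n * x ^ (n - 2))"
proof -
  have "summable (\<lambda>n. diffs (ecoeff s) n * y ^ n)" if "norm y < 1" for y :: real
    by (rule termdiff_converges[OF that ecoeff_summable[OF s]])
  then have "summable (\<lambda>n. diffs (diffs (ecoeff s)) n * x ^ n)"
    by (rule termdiff_converges[OF x])
  then have "summable (\<lambda>n. real (n + 2) * real (n + 2 - 1) * ecoeff s (n + 2) * x ^ (n + 2 - 2))"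
    by (simp add: diffs_def mult_ac)
  then show ?thesis by (rule summable_iff_shift[THEN iffD1])
qed

text \<open>The sort \<open>{real_inner, complete_space}\<close> is not a subsort of \<open>banach\<close>, so the library's
  absolute convergence criterion does not apply.\<close>

lemma norm_bounded_summable:
  fixes f :: "nat \<Rightarrow> 'a::{real_normed_vector, complete_space}"
  assumes f: "\<And>n. norm (f n) \<le> M n" and M: "summable M"
  shows "summable f"
proof -
  have "Cauchy (\<lambda>n. \<Sum>i<n. f i)"
  proof (rule CauchyI')
    fix \<epsilon> :: real assume "0 < \<epsilon>"
    then obtain N where N: "\<And>m n. N \<le> m \<Longrightarrow> norm (sum M {m..<n}) < \<epsilon>"
      using M unfolding summable_Cauchy by blast
    have "norm ((\<Sum>i<m. f i) - (\<Sum>i<n. f i)) < \<epsilon>" if "N \<le> m" "m < n" for m n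
    proof -
      have "(\<Sum>i<n. f i) = (\<Sum>i<m. f i) + sum f {m..<n}"
        using that by (simp add: sum.atLeastLessThan_concat[of 0 m n f, symmetric] flip: atLeast0LessThan)
      then have "norm ((\<Sum>i<m. f i) - (\<Sum>i<n. f i)) = norm (sum f {m..<n})" by simp
      also have "\<dots> \<le> sum M {m..<n}" by (rule sum_norm_le) (rule f)
      also have "\<dots> \<le> norm (sum M {m..<n})" by simp
      also have "\<dots> < \<epsilon>" by (rule N[OF that(1)])
      finally show ?thesis .
    qed
    then show "\<exists>N. \<forall>m\<ge>N. \<forall>n>m. dist (\<Sum>i<m. f i) (\<Sum>i<n. f i) < \<epsilon>" unfolding dist_norm by blast
  qed
  then show ?thesis by (simp add: summable_iff_convergent Cauchy_convergent)
qed

lemma norm_bounded_sums_le: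
  fixes f :: "nat \<Rightarrow> 'a::real_normed_vector"
  assumes "f sums l" "M sums m" "\<And>n. norm (f n) \<le> M n"
  shows "norm l \<le> m"
proof (rule LIMSEQ_le)
  show "(\<lambda>n. norm (\<Sum>i<n. f i)) \<longlonglongrightarrow> norm l" "(\<lambda>n. \<Sum>i<n. M i) \<longlonglongrightarrow> m"
    using assms(1,2) by (auto simp: sums_def intro: tendsto_norm)
  show "\<exists>N. \<forall>n\<ge>N. norm (\<Sum>i<n. f i) \<le> (\<Sum>i<n. M i)"
    using assms(3) by (auto intro: sum_norm_le)
qed

section \<open>Size and analyticity of the vector-valued series\<close>

context complex_hilbert
begin

context
  fixes e :: "nat \<Rightarrow> 'h" and s :: real
  assumes e: "\<And>n. norm (e n) = 1" "\<And>m n. m \<noteq> n \<Longrightarrow> ortho (e m) (e n)" and s: "s < 0"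
begin

definition ex_term :: "nat \<Rightarrow> complex \<Rightarrow> 'h" where
  "ex_term n z = sm (of_real (ecoeff s n) * z ^ n) (e n)"

definition ex_fun :: "complex \<Rightarrow> 'h" where "ex_fun z = (\<Sum>n. ex_term n z)"

lemma norm_ex_term: "norm (ex_term n z) = ecoeff s n * norm z ^ n"
  using ecoeff_nonneg[OF s, of n] by (simp add: ex_term_def sm_simps(4) e norm_mult norm_power)

lemma ex_term_sums: "norm z < 1 \<Longrightarrow> (\<lambda>n. ex_term n z) sums ex_fun z"
proof -
  assume "norm z < 1"
  then have "summable (\<lambda>n. ecoeff s n * norm z ^ n)" by (intro ecoeff_summable[OF s]) simp
  then have "summable (\<lambda>n. ex_term n z)" by (rule norm_bounded_summable[rotated]) (simp add: norm_ex_term)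
  then show ?thesis unfolding ex_fun_def by (rule summable_sums)
qed

lemma norm_ex_fun:
  assumes z: "norm z < 1" shows "(norm (ex_fun z))\<^sup>2 = (1 - (norm z)\<^sup>2) powr s"
proof -
  have "(\<lambda>n. (norm (\<Sum>i<n. ex_term i z))\<^sup>2) \<longlonglongrightarrow> (norm (ex_fun z))\<^sup>2"
    using ex_term_sums[OF z] unfolding sums_def by (intro tendsto_intros)
  moreover have "(norm (\<Sum>i<n. ex_term i z))\<^sup>2 = (\<Sum>i<n. bcoeff s i * ((norm z)\<^sup>2) ^ i)" for n
  proof -
    have "(norm (\<Sum>i<n. ex_term i z))\<^sup>2 = (\<Sum>i<n. (cmod (of_real (ecoeff s i) * z ^ i))\<^sup>2)"
      unfolding ex_term_def by (rule norm_sum_orthonormal[OF e])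
    also have "\<dots> = (\<Sum>i<n. bcoeff s i * ((norm z)\<^sup>2) ^ i)"
    proof (rule sum.cong[OF refl])
      fix i
      have "(ecoeff s i)\<^sup>2 = bcoeff s i" using bcoeff_nonneg[OF s] by (simp add: ecoeff_def)
      then show "(cmod (of_real (ecoeff s i) * z ^ i))\<^sup>2 = bcoeff s i * ((norm z)\<^sup>2) ^ i"
        by (simp add: norm_mult norm_power power_mult_distrib mult.commute flip: power_mult)
    qed
    finally show ?thesis .
  qed
  moreover have "(\<lambda>n. \<Sum>i<n. bcoeff s i * ((norm z)\<^sup>2) ^ i) \<longlonglongrightarrow> (1 - (norm z)\<^sup>2) powr s"
    using bcoeff_sums[of "(norm z)\<^sup>2" s] z by (simp add: sums_def abs_square_less_1)
  ultimately show ?thesis by (simp add: LIMSEQ_unique)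
qed

text \<open>Differentiability with a quadratic remainder: the first-order errors of the monomials
  are bounded, on the disc of radius \<open>R\<close> between \<open>|z|\<close> and 1, by the terms
  of the twice differentiated series, whose sum is \<open>C\<close>.\<close>

lemma ex_fun_analytic: "c_analytic_on sm (ball 0 1) ex_fun"
  unfolding c_analytic_on_def
proof
  fix z :: complex assume "z \<in> ball 0 1"
  then have z: "norm z < 1" by simp
  define R where "R = (1 + norm z) / 2"
  have R: "norm z < R" "R < 1" "0 < R" using z by (auto simp: R_def field_simps add_pos_nonneg)
  define dt where "dt n = sm (of_nat n * of_real (ecoeff s n) * z ^ (n - 1)) (e n)" for n
  have ndt: "norm (dt n) = real n * ecoeff s n * norm z ^ (n - 1)" for n
    using ecoeff_nonneg[OF s, of n] by (simp add: dt_def sm_simps(4) e norm_mult norm_power)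
  have dsum: "dt sums suminf dt"
    by (intro summable_sums norm_bounded_summable[OF _ ecoeff_deriv_summable[OF s, of "norm z"]])
      (use z in \<open>auto simp: ndt\<close>)
  define M where "M n = real n * real (n - 1) * ecoeff s n * R ^ (n - 2)" for n
  have Ms: "summable M" unfolding M_def by (rule ecoeff_deriv2_summable[OF s]) (use R in simp)
  define C where "C = suminf M"
  have est: "norm (ex_fun (z + h) - ex_fun z - sm h (suminf dt)) \<le> C * (norm h)\<^sup>2"
    if h: "h \<noteq> 0" "norm h < R - norm z" for h
  proof -
    have zh: "norm (z + h) \<le> R" using norm_triangle_ineq[of z h] h(2) by linarith
    then have zh1: "norm (z + h) < 1" using R by linarith
    have sums: "(\<lambda>n. ex_term n (z + h) - ex_term n z - sm h (dt n)) sums (ex_fun (z + h) - ex_fun z - sm h (suminf dt))"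
      by (intro sums_diff ex_term_sums zh1 z bounded_linear.sums[OF bounded_linear_right dsum])
    have "(\<lambda>n. M n * (norm h)\<^sup>2) sums (C * (norm h)\<^sup>2)"
      unfolding C_def by (intro sums_mult2 summable_sums Ms)
    from sums this show ?thesis
    proof (rule norm_bounded_sums_le)
      fix n
      let ?d = "((z + h) ^ n - z ^ n) / h - of_nat n * z ^ (n - Suc 0)"
      have "ex_term n (z + h) - ex_term n z - sm h (dt n) = sm (of_real (ecoeff s n) * (z + h) ^ n - of_real (ecoeff s n) * z ^ n - h * (of_nat n * of_real (ecoeff s n) * z ^ (n - 1))) (e n)"
        by (simp only: ex_term_def dt_def sm_simps(1) diff_left)
      also have "of_real (ecoeff s n) * (z + h) ^ n - of_real (ecoeff s n) * z ^ n - h * (of_nat n * of_real (ecoeff s n) * z ^ (n - 1))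
        = of_real (ecoeff s n) * (h * ?d)"
        using h(1) by (simp add: field_simps)
      finally have "norm (ex_term n (z + h) - ex_term n z - sm h (dt n)) = ecoeff s n * (norm h * norm ?d)"
        using ecoeff_nonneg[OF s, of n] by (simp only: sm_simps(4) e norm_mult norm_of_real abs_of_nonneg mult_1_right)
      also have "\<dots> \<le> ecoeff s n * (norm h * (real n * real (n - Suc 0) * R ^ (n - 2) * norm h))"
        by (intro mult_left_mono lemma_termdiff3 h(1) zh ecoeff_nonneg[OF s] less_imp_le[OF R(1)]) simp
      also have "\<dots> = M n * (norm h)\<^sup>2" by (simp add: M_def power2_eq_square)
      finally show "norm (ex_term n (z + h) - ex_term n z - sm h (dt n)) \<le> M n * (norm h)\<^sup>2" .
    qed
  qed
  have "(\<lambda>h. norm (ex_fun (z + h) - ex_fun z - sm h (suminf dt)) / norm h) \<midarrow>0\<rightarrow> 0"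
  proof (rule Lim_null_comparison)
    have "\<forall>\<^sub>F h in at 0. h \<noteq> 0 \<and> norm h < R - norm z"
      unfolding eventually_at by (rule exI[of _ "R - norm z"]) (use R in auto)
    then show "\<forall>\<^sub>F h in at 0. norm (norm (ex_fun (z + h) - ex_fun z - sm h (suminf dt)) / norm h) \<le> C * norm h"
    proof eventually_elim
      case (elim h)
      then have "norm (ex_fun (z + h) - ex_fun z - sm h (suminf dt)) / norm h \<le> C * (norm h)\<^sup>2 / norm h"
        by (intro divide_right_mono est) auto
      also have "\<dots> = C * norm h" by (simp add: power2_eq_square)
      finally show ?case by simp
    qed
    show "((\<lambda>h::complex. C * norm h) \<longlongrightarrow> 0) (at 0)" by (auto intro!: tendsto_eq_intros)
  qed
  then have "(ex_fun has_derivative (\<lambda>w. sm w (suminf dt))) (at z)"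
    unfolding has_derivative_at using bounded_linear_left by blast
  then show "\<exists>f'. (ex_fun has_derivative (\<lambda>w. sm w f')) (at z)" by blast
qed

lemma ex_fun_not_product:
  assumes g: "in_Hp sm 1 g" and h: "h holomorphic_on ball 0 1"
  shows "\<exists>z\<in>ball 0 1. ex_fun z \<noteq> sm (h z) (g z)"
proof (rule ccontr)
  assume "\<not> ?thesis"
  then have eq: "ex_fun z = sm (h z) (g z)" if "z \<in> ball 0 1" for z using that by blast
  have ga: "c_analytic_on sm (ball 0 1) g" "hardy_pow 1 g < \<infinity>" using g by (auto simp: in_Hp_def)
  have pos: "0 < norm (ex_fun z)" if "z \<in> ball 0 1" for z
  proof -
    have "(norm z)\<^sup>2 < 1" using that power_strict_mono[of "norm z" 1 2] by simp
    then have "0 < (1 - (norm z)\<^sup>2) powr s" by simp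
    then have "0 < (norm (ex_fun z))\<^sup>2" using norm_ex_fun[of z] that by simp
    then show ?thesis by auto
  qed
  have h0: "h z \<noteq> 0" if "z \<in> ball 0 1" for z
    using pos[OF that] eq[OF that] by (auto simp: sm_simps(4))
  define H where "H = enn2real (hardy_pow 1 g)"
  have bound: "(1 - \<rho>\<^sup>2) powr (s / 2) \<le> H * cmod (h 0)" if \<rho>: "0 < \<rho>" "\<rho> < 1" for \<rho>
  proof -
    define v where "v = (1 - \<rho>\<^sup>2) powr (s / 2)"
    have \<rho>2: "\<rho>\<^sup>2 < 1" using \<rho> by (simp add: abs_square_less_1)
    have v: "0 < v" using \<rho>2 by (simp add: v_def)
    define k where "k w = inverse (h (of_real \<rho> * w))" for w
    have sc: "complex_of_real \<rho> * w \<in> ball 0 1" if "norm w \<le> 1" for w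
    proof -
      have "\<rho> * norm w \<le> \<rho> * 1" using \<rho> that by (intro mult_left_mono) auto
      then have "\<rho> * norm w < 1" using \<rho> by linarith
      then show ?thesis using \<rho> by (simp add: norm_mult)
    qed
    have "(\<lambda>w. h (of_real \<rho> * w)) holomorphic_on cball 0 1"
      by (rule holomorphic_on_compose_gen[OF _ h, unfolded o_def]) (use sc in \<open>auto intro!: holomorphic_intros\<close>)
    then have k: "k holomorphic_on cball 0 1"
      unfolding k_def[abs_def] by (rule holomorphic_on_inverse) (use sc h0 in auto)
    have kc: "continuous_on {0..1} (\<lambda>t. k (zeta t))"
      by (rule continuous_on_compose2[OF holomorphic_on_imp_continuous_on[OF k] continuous_on_zeta]) auto
    \<comment> \<open>The Poisson kernel at 0 is the constant 1, so the representation becomes the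
      mean value property.\<close>
    have "((\<lambda>t. k (zeta t)) has_integral k 0) {0..1}"
      using poisson_representation[OF k, of 0] by (simp add: poisson_def)
    then have "cmod (k 0) = cmod (integral {0..1} (\<lambda>t. k (zeta t)))" by (simp add: integral_unique)
    also have "\<dots> \<le> integral {0..1} (\<lambda>t. cmod (k (zeta t)))"
      by (rule integral_norm_bound_integral) (auto intro!: integrable_continuous_real continuous_intros kc)
    finally have 1: "v * cmod (k 0) \<le> v * integral {0..1} (\<lambda>t. cmod (k (zeta t)))"
      using v by (intro mult_left_mono) auto
    have "v * cmod (k (zeta t)) = norm (g (of_real \<rho> * zeta t)) powr 1" for t
    proof -
      let ?z = "of_real \<rho> * zeta t"
      have z: "?z \<in> ball 0 1" by (rule sc) simp
      have nz: "norm ?z = \<rho>" using \<rho> by (simp add: norm_mult)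
      have "(norm (ex_fun ?z))\<^sup>2 = v\<^sup>2"
      proof -
        have "norm ?z < 1" using \<rho> nz by (simp only: nz)
        from norm_ex_fun[OF this] have "(norm (ex_fun ?z))\<^sup>2 = (1 - \<rho>\<^sup>2) powr s" by (simp only: nz)
        then show ?thesis by (simp add: v_def power2_eq_square flip: powr_add)
      qed
      then have "norm (ex_fun ?z) = v" using v by (simp add: power2_eq_iff_nonneg)
      then have "v = cmod (h ?z) * norm (g ?z)" by (simp add: eq[OF z] sm_simps(4))
      then show ?thesis using h0[OF z] by (simp add: k_def norm_inverse)
    qed
    then have "v * integral {0..1} (\<lambda>t. cmod (k (zeta t))) = integral {0..1} (\<lambda>t. norm (g (of_real \<rho> * zeta t)) powr 1)"
      by (simp flip: integral_mult_right)
    also have "\<dots> \<le> H" unfolding H_def by (rule hardy_circle_integral(2)[OF ga(1) \<rho> _ ga(2)]) simp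
    finally have "v * cmod (k 0) \<le> H" using 1 by linarith
    moreover have "cmod (k 0) = inverse (cmod (h 0))" by (simp add: k_def norm_inverse)
    moreover have "0 < cmod (h 0)" using h0[of 0] by simp
    ultimately show ?thesis by (simp add: v_def field_simps)
  qed
  define Y where "Y = H * cmod (h 0) + 2"
  have Y: "Y > 1" 
  proof -
    have "0 \<le> H * cmod (h 0)" by (simp add: H_def)
    then show ?thesis unfolding Y_def by linarith
  qed
  \<comment> \<open>\<open>a\<close> is the value of \<open>1 - \<rho>^2\<close> at which the
    left-hand side of \<open>bound\<close> equals \<open>Y\<close>, which exceeds the right-hand
    side; it is below 1 because \<open>Y > 1\<close> and \<open>s < 0\<close>.\<close>
  define a where "a = Y powr (2 / s)"
  have a: "0 < a" "a < 1"
  proof -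
    show "0 < a" using Y by (simp add: a_def)
    have "Y powr (2 / s) < Y powr 0" using Y s by (intro powr_less_mono) (auto simp: divide_neg_neg divide_pos_neg)
    then show "a < 1" using Y by (simp add: a_def)
  qed
  have "(1 - (sqrt (1 - a))\<^sup>2) powr (s / 2) \<le> H * cmod (h 0)"
    by (rule bound) (use a in auto)
  moreover have "(1 - (sqrt (1 - a))\<^sup>2) powr (s / 2) = Y"
    using a Y s by (simp add: a_def powr_powr)
  ultimately show False by (simp add: Y_def)
qed

end

end

text \<open>In generation \<open>j\<close> the Stolz angle lies in a square of side
  \<open>6 / 2 ^ j\<close>, and the integrand is at most 4 times
  \<open>(1 / 2 ^ j) powr (b - 2)\<close>, the 4 covering negative exponents. The terms
  \<open>144 * (2 powr (- b)) ^ j\<close> are summable because \<open>b > 0\<close>, uniformly in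
  the vertex.\<close>

lemma cone_integral_finite:
  assumes b: "0 < b"
  obtains C where "\<And>\<zeta>. norm \<zeta> = 1 \<Longrightarrow>
    (\<integral>\<^sup>+z\<in>stolz \<zeta> \<inter> ball 0 1. ennreal ((1 - norm z) powr (b - 2)) \<partial>lborel) \<le> ennreal C"
proof -
  define M where "M j = 4 * (1 / 2 ^ j) powr (b - 2)" for j :: nat
  have Mj: "M j * (6 / 2 ^ j) ^ 2 = 144 * (2 powr (- b)) ^ j" for j
  proof -
    have u: "1 / 2 ^ j = (2::real) powr (- real j)" by (simp add: powr_minus powr_realpow inverse_eq_divide)
    have "((2::real) powr (- real j)) powr (b - 2) * (2 powr (- real j))\<^sup>2 = 2 powr (- real j * (b - 2) + (- real j + - real j))"
      by (simp only: powr_powr power2_eq_square powr_add)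
    also have "- real j * (b - 2) + (- real j + - real j) = - b * real j" by (simp add: algebra_simps)
    also have "(2::real) powr (- b * real j) = (2 powr (- b)) ^ j" by (simp only: powr_powr[symmetric] powr_realpow powr_gt_zero)
    finally have "(1 / 2 ^ j) powr (b - 2) * (1 / 2 ^ j)\<^sup>2 = (2 powr (- b)) ^ j" unfolding u .
    moreover have "M j * (6 / 2 ^ j) ^ 2 = 144 * ((1 / 2 ^ j) powr (b - 2) * (1 / 2 ^ j)\<^sup>2)"
      unfolding M_def power_divide by simp
    ultimately show ?thesis by (simp only:)
  qed
  have "2 powr (- b) < (1::real)" using powr_less_mono[of "- b" 0 2] b by simp
  then have summ: "summable (\<lambda>j. 144 * (2 powr (- b)) ^ j)"
    by (intro summable_mult summable_geometric) simp
  show ?thesis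
  proof (rule that)
    fix \<zeta> :: complex assume \<zeta>: "norm \<zeta> = 1"
    define Q where "Q j = cbox (\<zeta> - Complex (3 / 2 ^ j) (3 / 2 ^ j)) (\<zeta> + Complex (3 / 2 ^ j) (3 / 2 ^ j))" for j :: nat
    have pt: "ennreal ((1 - norm z) powr (b - 2)) * indicator (stolz \<zeta> \<inter> ball 0 1) z \<le> (\<Sum>j. ennreal (M j) * indicator (Q j) z)" for z
    proof (cases "z \<in> stolz \<zeta> \<inter> ball 0 1")
      case True
      then have z: "norm z < 1" "norm (z - \<zeta>) \<le> 3 * (1 - norm z)" using stolz_dist[OF \<zeta>] by auto
      obtain j k where "z \<in> whitney j k" using ball_covered_by_whitney[OF z(1)] by blast
      then have j: "1 / 2 ^ Suc j < 1 - norm z" "1 - norm z \<le> 1 / 2 ^ j" by (auto simp: whitney_def)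
      have "norm (z - \<zeta>) \<le> 3 / 2 ^ j" using z(2) j(2) by simp
      then have "\<bar>Re z - Re \<zeta>\<bar> \<le> 3 / 2 ^ j" "\<bar>Im z - Im \<zeta>\<bar> \<le> 3 / 2 ^ j"
        using abs_Re_le_cmod[of "z - \<zeta>"] abs_Im_le_cmod[of "z - \<zeta>"] by auto
      then have zQ: "z \<in> Q j" unfolding Q_def by (auto simp: in_cbox_complex_iff abs_le_iff)
      have "(1 - norm z) powr (b - 2) \<le> M j"
      proof (cases "b \<ge> 2")
        case True
        then have "(1 - norm z) powr (b - 2) \<le> (1 / 2 ^ j) powr (b - 2)" using j z by (intro powr_mono2) auto
        then show ?thesis unfolding M_def by (smt (verit) powr_ge_zero)
      next
        case False
        have "(1 - norm z) powr (b - 2) \<le> (1 / 2 ^ Suc j) powr (b - 2)"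
          using False j(1) by (intro powr_mono2') auto
        also have "\<dots> = (1 / 2) powr (b - 2) * (1 / 2 ^ j) powr (b - 2)"
          using powr_mult[of "1 / 2" "1 / 2 ^ j" "b - 2"] by simp
        also have "(1 / 2 :: real) powr (b - 2) = 2 powr (2 - b)"
          by (simp add: powr_divide powr_minus_divide[symmetric])
        also have "2 powr (2 - b) \<le> 2 powr (2::real)" using b by (intro powr_mono) auto
        finally show ?thesis unfolding M_def by (simp add: mult_right_mono)
      qed
      then have "ennreal ((1 - norm z) powr (b - 2)) \<le> ennreal (M j) * indicator (Q j) z" using zQ by (simp add: ennreal_leI)
      also have "\<dots> = (\<Sum>i\<in>{j}. ennreal (M i) * indicator (Q i) z)" using sum.insert[of "{}" j "\<lambda>i. ennreal (M i) * indicator (Q i) z"] by (simp only: finite.emptyI empty_iff sum.empty add_0_right simp_thms)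
      also have "\<dots> \<le> (\<Sum>j. ennreal (M j) * indicator (Q j) z)" by (rule sum_le_suminf) auto
      finally show ?thesis using True by simp
    qed simp
    have "(\<integral>\<^sup>+z\<in>stolz \<zeta> \<inter> ball 0 1. ennreal ((1 - norm z) powr (b - 2)) \<partial>lborel)
      \<le> (\<integral>\<^sup>+z. (\<Sum>j. ennreal (M j) * indicator (Q j) z) \<partial>lborel)"
      by (rule nn_integral_mono) (rule pt)
    also have "\<dots> = (\<Sum>j. \<integral>\<^sup>+z. ennreal (M j) * indicator (Q j) z \<partial>lborel)"
      by (rule nn_integral_suminf) (simp add: Q_def)
    also have "\<dots> = (\<Sum>j. ennreal (144 * (2 powr (- b)) ^ j))"
    proof (rule suminf_cong)
      fix j
      have "emeasure lborel (Q j) = ennreal ((6 / 2 ^ j) * (6 / 2 ^ j))"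
        unfolding Q_def by (subst emeasure_lborel_cbox) (auto simp: Basis_complex_def)
      then have "(\<integral>\<^sup>+z. ennreal (M j) * indicator (Q j) z \<partial>lborel) = ennreal (M j) * ennreal ((6 / 2 ^ j) ^ 2)"
        by (subst nn_integral_cmult_indicator) (auto simp: Q_def power2_eq_square)
      also have "\<dots> = ennreal (M j * (6 / 2 ^ j) ^ 2)"
        by (rule ennreal_mult[symmetric]) (auto simp: M_def)
      finally show "(\<integral>\<^sup>+z. ennreal (M j) * indicator (Q j) z \<partial>lborel) = ennreal (144 * (2 powr (- b)) ^ j)"
        unfolding Mj .
    qed
    also have "\<dots> = ennreal (\<Sum>j. 144 * (2 powr (- b)) ^ j)" by (rule suminf_ennreal2[OF _ summ]) simp
    finally show "(\<integral>\<^sup>+z\<in>stolz \<zeta> \<inter> ball 0 1. ennreal ((1 - norm z) powr (b - 2)) \<partial>lborel) \<le> ennreal (\<Sum>j. 144 * (2 powr (- b)) ^ j)" .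
  qed
qed

context complex_hilbert
begin

text \<open>As \<open>1 - |z|^2 \<ge> 1 - |z|\<close> and \<open>s < 0\<close>, the squared weighted
  norm is at most \<open>(1 - |z|) powr (- s)\<close>. The area function is then bounded on the
  circle by \<open>cone_integral_finite\<close> with \<open>b = - s\<close>.\<close>

lemma ex_fun_in_F:
  assumes e: "\<And>n. norm (e n) = 1" "\<And>m n. m \<noteq> n \<Longrightarrow> ortho (e m) (e n)" and s: "s < 0"
  shows "in_F sm s 1 2 (ex_fun e s)"
proof -
  have "0 < - s" using s by simp
  then obtain C where C: "\<And>\<zeta>. norm \<zeta> = 1 \<Longrightarrow>
    (\<integral>\<^sup>+z\<in>stolz \<zeta> \<inter> ball 0 1. ennreal ((1 - norm z) powr (- s - 2)) \<partial>lborel) \<le> ennreal C"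
    using cone_integral_finite by blast
  have area: "area_q 2 (weighted s (ex_fun e s)) \<zeta> \<le> ennreal C" if "norm \<zeta> = 1" for \<zeta>
  proof -
    have "area_q 2 (weighted s (ex_fun e s)) \<zeta> \<le> (\<integral>\<^sup>+z\<in>stolz \<zeta> \<inter> ball 0 1. ennreal ((1 - norm z) powr (- s - 2)) \<partial>lborel)"
      unfolding area_q_def
    proof (rule nn_integral_mono)
      fix z
      show "ennreal (\<bar>weighted s (ex_fun e s) z\<bar> powr 2 / (1 - norm z)\<^sup>2) * indicator (stolz \<zeta> \<inter> ball 0 1) z
        \<le> ennreal ((1 - norm z) powr (- s - 2)) * indicator (stolz \<zeta> \<inter> ball 0 1) z"
      proof (cases "z \<in> stolz \<zeta> \<inter> ball 0 1")
        case True
        define t where "t = 1 - norm z"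
        have t: "0 < t" "norm z < 1" using True by (auto simp: t_def)
        have "(norm z)\<^sup>2 \<le> norm z" using t(2) by (simp add: power2_eq_square mult_left_le_one_le)
        then have "(1 - (norm z)\<^sup>2) powr s \<le> t powr s" using s t by (intro powr_mono2') (auto simp: t_def)
        then have ns: "(norm (ex_fun e s z))\<^sup>2 \<le> t powr s" using norm_ex_fun[OF e s t(2)] by simp
        have "\<bar>weighted s (ex_fun e s) z\<bar> powr 2 = (t powr (- s) * norm (ex_fun e s z)) powr 2"
          by (simp add: weighted_def t_def[symmetric] abs_mult)
        also have "\<dots> = (t powr (- s) * norm (ex_fun e s z))\<^sup>2" by (rule powr_numeral) simp
        also have "\<dots> = (t powr (- s) * t powr (- s)) * (norm (ex_fun e s z))\<^sup>2" by (simp add: power2_eq_square mult_ac)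
        also have "\<dots> \<le> (t powr (- s) * t powr (- s)) * t powr s" by (intro mult_left_mono ns) simp
        also have "\<dots> = t powr (- s)" by (simp flip: powr_add)
        finally have "\<bar>weighted s (ex_fun e s) z\<bar> powr 2 / t\<^sup>2 \<le> t powr (- s) / t\<^sup>2" by (rule divide_right_mono) simp
        also have "\<dots> = t powr (- s - 2)" using t by (simp add: powr_diff)
        finally show ?thesis using True by (simp add: t_def ennreal_leI)
      qed simp
    qed
    also have "\<dots> \<le> ennreal C" by (rule C[OF that])
    finally show ?thesis .
  qed
  have "tent_pow 1 2 (weighted s (ex_fun e s)) \<le> (\<integral>\<^sup>+x. enn_powr (ennreal C) (1 / 2) * indicator {0..1::real} x \<partial>lborel)"
    unfolding tent_pow_def
    by (intro nn_integral_mono mult_right_mono enn_powr_mono area) auto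
  also have "\<dots> = enn_powr (ennreal C) (1 / 2)" by (subst nn_integral_cmult_indicator) auto
  also have "\<dots> < \<infinity>" by (simp add: enn_powr_def)
  finally show ?thesis using ex_fun_analytic[OF e s] by (simp add: in_F_def)
qed

end

section \<open>Passage from the tent estimate to the function spaces\<close>

lemma c_analytic_on_product:
  fixes sm :: "complex \<Rightarrow> 'a::real_normed_vector \<Rightarrow> 'a"
  assumes sm: "complex_space sm" and g: "c_analytic_on sm S g" and S: "open S" and h: "h holomorphic_on S"
  shows "c_analytic_on sm S (\<lambda>z. sm (h z) (g z))"
  unfolding c_analytic_on_def
proof
  interpret bounded_bilinear sm by (rule complex_space_bounded_bilinear[OF sm])
  have ss: "sm a (sm b x) = sm (a * b) x" for a b x using sm unfolding complex_space_def by auto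
  fix z assume z: "z \<in> S"
  obtain g' where g': "(g has_derivative (\<lambda>w. sm w g')) (at z)"
    using g z unfolding c_analytic_on_def by blast
  have h': "(h has_derivative (\<lambda>w. deriv h z * w)) (at z)"
    by (rule has_field_derivative_imp_has_derivative[OF holomorphic_derivI[OF h S z]])
  have "((\<lambda>z. sm (h z) (g z)) has_derivative (\<lambda>w. sm (h z) (sm w g') + sm (deriv h z * w) (g z))) (at z)"
    by (rule FDERIV[OF h' g'])
  moreover have "sm (h z) (sm w g') + sm (deriv h z * w) (g z) = sm w (sm (h z) g' + sm (deriv h z) (g z))" for w
    by (simp only: ss add_right mult.commute)
  ultimately show "\<exists>f'. ((\<lambda>z. sm (h z) (g z)) has_derivative (\<lambda>w. sm w f')) (at z)" by auto
qed

theorem theorem6: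
  fixes smX :: "complex \<Rightarrow> 'a::banach \<Rightarrow> 'a"
    and smH :: "complex \<Rightarrow> 'h::{real_inner, complete_space} \<Rightarrow> 'h"
    and s p q :: real
  assumes "complex_space smX"
    and "s < 0" and "0 < p" and "1 \<le> q"
  shows "(\<exists>C. \<forall>g h. in_Hp smX p g \<and> in_Finf s q h \<longrightarrow>
            in_F smX s p q (\<lambda>z. smX (h z) (g z)) \<and>
            F_norm s p q (\<lambda>z. smX (h z) (g z)) \<le> C * Hp_norm p g * Finf_norm s q h)
       \<and> ((complex_space smH
            \<and> \<not> (\<exists>S. finite S \<and> (\<forall>x. \<exists>c. x = (\<Sum>v\<in>S. smH (c v) v)))
            \<and> (\<exists>D. countable D \<and> closure D = (UNIV :: 'h set)))
          \<longrightarrow> (\<exists>f. in_F smH s 1 2 f \<and>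
                 (\<forall>g h. in_Hp smH 1 g \<and> in_Finf s 2 h \<longrightarrow>
                    (\<exists>z\<in>ball 0 1. f z \<noteq> smH (h z) (g z)))))"
proof (intro conjI impI)
  \<comment> \<open>The constants of the locale depend on \<open>s\<close>, \<open>q\<close> and
    \<open>p\<close> alone, so \<open>T\<close> is fixed before \<open>g\<close> and
    \<open>h\<close> are given.\<close>
  define T where "T = carleson_function.tent_const s q p"
  have "in_F smX s p q (\<lambda>z. smX (h z) (g z)) \<and>
      F_norm s p q (\<lambda>z. smX (h z) (g z)) \<le> T powr (1 / p) * Hp_norm p g * Finf_norm s q h"
    if g: "in_Hp smX p g" and h: "in_Finf s q h" for g h
  proof -
    have ga: "c_analytic_on smX (ball 0 1) g" and gf: "hardy_pow p g < \<infinity>"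
      using g by (auto simp: in_Hp_def)
    have hh: "h holomorphic_on ball 0 1" and hf: "tent_inf_pow q (weighted s h) < \<infinity>"
      using h by (auto simp: in_Finf_def)
    define K where "K = enn2real (tent_inf_pow q (weighted s h))"
    define H where "H = enn2real (hardy_pow p g)"
    have K: "0 \<le> K" and H: "0 \<le> H" by (simp_all add: K_def H_def)
    interpret carleson_function s q h K
      by unfold_locales (use assms hh K carleson_boundI[OF hf] in \<open>auto simp: K_def\<close>)
    have T: "0 \<le> T" unfolding T_def tent_const_def maximal_const_def by simp
    have le: "tent_pow p q (weighted s (\<lambda>z. smX (h z) (g z))) \<le> ennreal (T * K powr (p / q) * H)"
      unfolding T_def H_def by (rule tent_pow_product[OF assms(1) ga assms(3) gf])
    also have "\<dots> < \<infinity>" by simp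
    finally have fin: "tent_pow p q (weighted s (\<lambda>z. smX (h z) (g z))) < \<infinity>" .
    have "enn2real (tent_pow p q (weighted s (\<lambda>z. smX (h z) (g z)))) \<le> T * K powr (p / q) * H"
      using enn2real_mono[OF le] T H by simp
    then have "F_norm s p q (\<lambda>z. smX (h z) (g z)) \<le> (T * K powr (p / q) * H) powr (1 / p)"
      unfolding F_norm_def using assms(3) by (intro powr_mono2) auto
    also have "\<dots> = T powr (1 / p) * K powr (1 / q) * H powr (1 / p)"
      using T H assms(3) by (simp add: powr_mult powr_powr)
    finally have "F_norm s p q (\<lambda>z. smX (h z) (g z)) \<le> T powr (1 / p) * Hp_norm p g * Finf_norm s q h"
      by (simp add: Hp_norm_def Finf_norm_def H_def K_def mult_ac)
    then show ?thesis
      using fin c_analytic_on_product[OF assms(1) ga open_ball hh] by (simp add: in_F_def)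
  qed
  then show "\<exists>C. \<forall>g h. in_Hp smX p g \<and> in_Finf s q h \<longrightarrow>
            in_F smX s p q (\<lambda>z. smX (h z) (g z)) \<and>
            F_norm s p q (\<lambda>z. smX (h z) (g z)) \<le> C * Hp_norm p g * Finf_norm s q h"
    by blast
next
  assume H: "complex_space smH
            \<and> \<not> (\<exists>S. finite S \<and> (\<forall>x. \<exists>c. x = (\<Sum>v\<in>S. smH (c v) v)))
            \<and> (\<exists>D. countable D \<and> closure D = (UNIV :: 'h set))"
  interpret complex_hilbert smH by unfold_locales (rule H[THEN conjunct1])
  have "\<exists>e::nat \<Rightarrow> 'h. (\<forall>n. norm (e n) = 1) \<and> (\<forall>m n. m \<noteq> n \<longrightarrow> ortho (e m) (e n))"
    by (rule exists_orthonormal_sequence[OF H[THEN conjunct2, THEN conjunct1]]) blast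
  then obtain e :: "nat \<Rightarrow> 'h" where "\<forall>n. norm (e n) = 1" "\<forall>m n. m \<noteq> n \<longrightarrow> ortho (e m) (e n)"
    by (elim exE conjE)
  then have e: "norm (e n) = 1" "m \<noteq> n \<Longrightarrow> ortho (e m) (e n)" for m n
    by simp_all
  show "\<exists>f. in_F smH s 1 2 f \<and>
                 (\<forall>g h. in_Hp smH 1 g \<and> in_Finf s 2 h \<longrightarrow>
                    (\<exists>z\<in>ball 0 1. f z \<noteq> smH (h z) (g z)))"
  proof (intro exI conjI allI impI)
    show "in_F smH s 1 2 (ex_fun e s)" by (rule ex_fun_in_F[OF e assms(2)])
    fix g h assume "in_Hp smH 1 g \<and> in_Finf s 2 h"
    then have gh: "in_Hp smH 1 g" "h holomorphic_on ball 0 1" by (simp_all add: in_Finf_def)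
    show "\<exists>z\<in>ball 0 1. ex_fun e s z \<noteq> smH (h z) (g z)"
      by (rule ex_fun_not_product[OF e assms(2) gh])
  qed
qed

end
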